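(* Let $D$ be a link diagram with a base point $b$. (i) There is a short exact sequence of chain complexes $$0\to\mathcal{C}_+(D)\xrightarrow{\ \phi\ }\mathcal{C}(D)\xrightarrow{\ \psi\ }\mathcal{C}^-(D)\to 0 .$$ (ii) There is a long exact sequence of homology $$\cdots\to H^r_{i,j}(D)\xrightarrow{\phi_*}H_{i,j}(D)\xrightarrow{\psi_*}H^{\bar r}_{i,j}(D)\xrightarrow{\ \partial\ }H^r_{i-2,j}(D)\to\cdots$$ where $H^{\bar r}_{i,j}(D)$ is the homology of $\mathcal{C}^-(D)$; the boundary map $\partial$ is described, for an enhanced state $S\in S_-(D)$, by the component of $d(S)$ in $\mathcal{C}_+(D)$.
   Context: Diagrams: $D$ is a diagram in the plane (disc) of an unoriented framed link, with ordered crossings, and $b$ is a base point on $D$ (not a crossing). At each crossing there are two smoothings: the positive-marker smoothing ($A$-smoothing) joins the two local regions swept out when the overcrossing arc is rotated counterclockwise until it meets the undercrossing arc; the negative-marker smoothing joins the other two regions. A Kauffman state $s$ assigns $+1$ or $-1$ (a positive or negative marker) to each crossing; $D_s$ is the system of circles obtained by smoothing all crossings according to $s$, and $\sigma(s)$ is the number of positive minus the number of negative markers. Khovanov homology: an enhanced state $S$ is a Kauffman state $s$ with a sign $+$ or $-$ on each circle of $D_s$; put $\sigma(S)=\sigma(s)$ and $\tau(S)=\#\{\text{positive circles}\}-\#\{\text{negative circles}\}$. $\mathcal{C}_{i,j}(D)$ is the free abelian group on enhanced states with $\sigma(S)=i$ and $\sigma(S)+2\tau(S)=j$, and $\mathcal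 C(D)=\bigoplus_{i,j}\mathcal C_{i,j}(D)$. The differential $d_{i,j}:\mathcal{C}_{i,j}(D)\to\mathcal{C}_{i-2,j}(D)$ is $d(S)=\sum_{S'}(-1)^{t(S:S')}[S:S']S'$, the sum over enhanced states $S'$ generating $\mathcal C_{i-2,j}(D)$, where $[S:S']=1$ if the markers of $S$ and $S'$ differ at exactly one crossing $v$ and all circles not touching $v$ have the same sign in $S$ and $S'$, and $[S:S']=0$ otherwise; $t(S:S')$ is the number of negative markers of $S$ at crossings bigger than $v$ in the ordering. $H_{i,j}(D)=\ker(d_{i,j})/\mathrm{im}(d_{i+2,j})$. Reduced and co-reduced homology: $S_+(D)$ (resp. $S_-(D)$) is the set of enhanced states in which the circle containing $b$ is positive (resp. negative). $\mathcal{C}_+(D)$ and $\mathcal C_-(D)$ are the subgroups of $\mathcal{C}(D)$ spanned by $S_+(D)$ and $S_-(D)$, so $\mathcal C(D)=\mathcal C_+(D)\oplus\mathcal C_-(D)$ as groups. $\mathcal{C}_+(D)$ is a chain subcomplex of $\mathcal{C}(D)$; its homology $H^r_{i,j}(D)$ is the reduced Khovanov homology. $\mathcal{C}^-(D)=\mathcal{C}(D)/\mathcal{C}_+(D)$ is the co-reduced chain complex, identified as a graded group with $\mathcal C_-(D)$; its homology $H^{\bar r}_{i,j}(D)$ is the co-reduced Khovanov homology. $\phi$ is the inclusion and $\psi$ the quotient map. *)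

theory Defs
  imports "HOL-Algebra.Algebra"
begin

section \<open>Link diagrams\<close>

text \<open>
  An unoriented link diagram in the plane is encoded by its planar-diagram code.  The crossings
  are numbered 0, ..., ncross D - 1, and this numbering is the ordering of the crossings.
  Cutting the diagram at the crossings leaves the arcs; a component without crossings is a single
  closed arc.  The four arc-ends at a crossing are numbered 0, 1, 2, 3 counterclockwise, so that
  the ends 0 and 2 belong to the undercrossing strand and the ends 1 and 3 to the overcrossing
  strand; arc_at D c k is the arc having the k-th end at the crossing c.  An arc occurs at two
  ends, or at none if it is closed.  The framing is the blackboard framing.
\<close>

record 'a diagram =
  ncross :: nat
  arcs :: "'a set"
  arc_at :: "nat \<Rightarrow> nat \<Rightarrow> 'a"

definition ends :: "'a diagram \<Rightarrow> (nat \<times> nat) set" where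
  "ends D = {..<ncross D} \<times> {..<4}"

definition same_arc :: "'a diagram \<Rightarrow> nat \<times> nat \<Rightarrow> nat \<times> nat \<Rightarrow> bool" where
  "same_arc D x y \<longleftrightarrow> x \<in> ends D \<and> y \<in> ends D \<and> x \<noteq> y
     \<and> arc_at D (fst x) (snd x) = arc_at D (fst y) (snd y)"

definition conn_classes :: "'b set \<Rightarrow> ('b \<Rightarrow> 'b \<Rightarrow> bool) \<Rightarrow> 'b set set" where
  "conn_classes A r = A // {(x, y). x \<in> A \<and> y \<in> A \<and> equivclp r x y}"

text \<open>
  The pair (c, k) also denotes the corner at the crossing c between the ends k and k+1.  Going
  along the arc that starts at the end k+1, with this corner on the right, one arrives at another
  end (c', k'), and the corner (c', k') lies in the same face.  Only faces and connected
  components of the part of the diagram that meets a crossing are counted.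
\<close>

definition faces :: "'a diagram \<Rightarrow> (nat \<times> nat) set set" where
  "faces D = conn_classes (ends D) (\<lambda>x y. same_arc D (fst x, (snd x + 1) mod 4) y)"

definition crossing_components :: "'a diagram \<Rightarrow> nat set set" where
  "crossing_components D =
     conn_classes {..<ncross D} (\<lambda>c c'. \<exists>k k'. same_arc D (c, k) (c', k'))"

definition crossing_arcs :: "'a diagram \<Rightarrow> 'a set" where
  "crossing_arcs D = {a \<in> arcs D. \<exists>(c, k) \<in> ends D. arc_at D c k = a}"

text \<open>
  Euler's formula, summed over the connected components: each of them contributes at most 2, with
  equality if and only if it is drawn on the sphere.
\<close>

definition planar :: "'a diagram \<Rightarrow> bool" where
  "planar D \<longleftrightarrow> int (ncross D) - int (card (crossing_arcs D)) + int (card (faces D))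
     = 2 * int (card (crossing_components D))"

definition link_diagram :: "'a diagram \<Rightarrow> bool" where
  "link_diagram D \<longleftrightarrow> finite (arcs D)
     \<and> (\<forall>(c, k) \<in> ends D. arc_at D c k \<in> arcs D)
     \<and> (\<forall>a \<in> arcs D. card {(c, k) \<in> ends D. arc_at D c k = a} \<in> {0, 2})
     \<and> planar D"

section \<open>Kauffman states and enhanced states\<close>

definition kauffman_states :: "'a diagram \<Rightarrow> (nat \<Rightarrow> int) set" where
  "kauffman_states D = {..<ncross D} \<rightarrow>\<^sub>E {1, -1}"

text \<open>
  Rotated counterclockwise, the overcrossing strand (ends 1 and 3) sweeps out the corners between
  the ends 1, 2 and between the ends 3, 0.  Merging these two regions leaves one strand joining
  the ends 0, 1 and one joining the ends 2, 3.
\<close>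

definition joined :: "'a diagram \<Rightarrow> (nat \<Rightarrow> int) \<Rightarrow> 'a \<Rightarrow> 'a \<Rightarrow> bool" where
  "joined D s x y \<longleftrightarrow> (\<exists>c < ncross D.
     if s c = 1
     then x = arc_at D c 0 \<and> y = arc_at D c 1 \<or> x = arc_at D c 2 \<and> y = arc_at D c 3
     else x = arc_at D c 1 \<and> y = arc_at D c 2 \<or> x = arc_at D c 3 \<and> y = arc_at D c 0)"

text \<open>A circle of the smoothed diagram is represented by the set of arcs it runs through.\<close>

definition circles :: "'a diagram \<Rightarrow> (nat \<Rightarrow> int) \<Rightarrow> 'a set set" where
  "circles D s = conn_classes (arcs D) (joined D s)"

definition touches :: "'a diagram \<Rightarrow> nat \<Rightarrow> 'a set \<Rightarrow> bool" where
  "touches D v C \<longleftrightarrow> (\<exists>k < 4. arc_at D v k \<in> C)"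

type_synonym 'a enhanced_state = "(nat \<Rightarrow> int) \<times> ('a set \<Rightarrow> int)"

definition enhanced_states :: "'a diagram \<Rightarrow> 'a enhanced_state set" where
  "enhanced_states D =
     {(s, e). s \<in> kauffman_states D \<and> e \<in> circles D s \<rightarrow>\<^sub>E {1, -1}}"

definition sigma :: "'a diagram \<Rightarrow> 'a enhanced_state \<Rightarrow> int" where
  "sigma D S = int (card {c. c < ncross D \<and> fst S c = 1})
             - int (card {c. c < ncross D \<and> fst S c = -1})"

definition tau :: "'a diagram \<Rightarrow> 'a enhanced_state \<Rightarrow> int" where
  "tau D S = int (card {C \<in> circles D (fst S). snd S C = 1})
           - int (card {C \<in> circles D (fst S). snd S C = -1})"

definition states_in :: "'a diagram \<Rightarrow> int \<Rightarrow> int \<Rightarrow> 'a enhanced_state set" where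
  "states_in D i j =
     {S \<in> enhanced_states D. sigma D S = i \<and> sigma D S + 2 * tau D S = j}"

section \<open>Bigraded chain complexes with differential of degree (-2, 0)\<close>

type_synonym 'x bigraded = "int \<Rightarrow> int \<Rightarrow> 'x monoid"
type_synonym ('x, 'y) bigraded_map = "int \<Rightarrow> int \<Rightarrow> 'x \<Rightarrow> 'y"

definition chain_complex :: "'x bigraded \<Rightarrow> ('x, 'x) bigraded_map \<Rightarrow> bool" where
  "chain_complex A d \<longleftrightarrow> (\<forall>i j. comm_group (A i j)
     \<and> d i j \<in> hom (A i j) (A (i - 2) j)
     \<and> (\<forall>x \<in> carrier (A i j). d (i - 2) j (d i j x) = \<one>\<^bsub>A (i - 2 - 2) j\<^esub>))"

definition chain_map ::
    "'x bigraded \<Rightarrow> ('x, 'x) bigraded_map \<Rightarrow> 'y bigraded \<Rightarrow> ('y, 'y) bigraded_map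
      \<Rightarrow> ('x, 'y) bigraded_map \<Rightarrow> bool" where
  "chain_map A d B d' f \<longleftrightarrow> (\<forall>i j. f i j \<in> hom (A i j) (B i j)
     \<and> (\<forall>x \<in> carrier (A i j). f (i - 2) j (d i j x) = d' i j (f i j x)))"

definition short_exact_complexes ::
    "'x bigraded \<Rightarrow> ('x, 'x) bigraded_map \<Rightarrow> ('x, 'y) bigraded_map
      \<Rightarrow> 'y bigraded \<Rightarrow> ('y, 'y) bigraded_map \<Rightarrow> ('y, 'z) bigraded_map
      \<Rightarrow> 'z bigraded \<Rightarrow> ('z, 'z) bigraded_map \<Rightarrow> bool" where
  "short_exact_complexes A dA f B dB g C dC \<longleftrightarrow>
     chain_complex A dA \<and> chain_complex B dB \<and> chain_complex C dC
     \<and> chain_map A dA B dB f \<and> chain_map B dB C dC g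
     \<and> (\<forall>i j. f i j \<in> mon (A i j) (B i j)
          \<and> f i j ` carrier (A i j) = kernel (B i j) (C i j) (g i j)
          \<and> g i j \<in> epi (B i j) (C i j))"

definition cycles :: "'x bigraded \<Rightarrow> ('x, 'x) bigraded_map \<Rightarrow> int \<Rightarrow> int \<Rightarrow> 'x set" where
  "cycles A d i j = kernel (A i j) (A (i - 2) j) (d i j)"

definition boundaries :: "'x bigraded \<Rightarrow> ('x, 'x) bigraded_map \<Rightarrow> int \<Rightarrow> int \<Rightarrow> 'x set" where
  "boundaries A d i j = d (i + 2) j ` carrier (A (i + 2) j)"

definition homology :: "'x bigraded \<Rightarrow> ('x, 'x) bigraded_map \<Rightarrow> 'x set bigraded" where
  "homology A d i j = (A i j)\<lparr>carrier := cycles A d i j\<rparr> Mod boundaries A d i j"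

definition homology_class ::
    "'x bigraded \<Rightarrow> ('x, 'x) bigraded_map \<Rightarrow> ('x, 'x set) bigraded_map" where
  "homology_class A d i j z = boundaries A d i j #>\<^bsub>A i j\<^esub> z"

text \<open>
  Homology classes are cosets, that is, sets of cycles.  For a chain map f, the cycles in a class
  all have images in one and the same class, so the union below is that class.
\<close>

definition induced_map ::
    "'y bigraded \<Rightarrow> ('y, 'y) bigraded_map \<Rightarrow> ('x, 'y) bigraded_map
      \<Rightarrow> ('x set, 'y set) bigraded_map" where
  "induced_map B d' f i j Z = (\<Union>z \<in> Z. homology_class B d' i j (f i j z))"

text \<open>
  The boundary map of a short exact sequence of complexes A, B, C with maps f and g: lift a cycle
  of the class Z along g, apply the differential of B, and pull back along f.  All possible
  results together form one homology class of A.
\<close>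

definition connecting ::
    "'x bigraded \<Rightarrow> ('x, 'y) bigraded_map \<Rightarrow> 'y bigraded \<Rightarrow> ('y, 'y) bigraded_map
      \<Rightarrow> ('y, 'z) bigraded_map \<Rightarrow> ('z set, 'x set) bigraded_map" where
  "connecting A f B dB g i j Z =
     {a \<in> carrier (A (i - 2) j). \<exists>c \<in> carrier (B i j). g i j c \<in> Z \<and> dB i j c = f (i - 2) j a}"

definition long_exact_sequence ::
    "'x bigraded \<Rightarrow> ('x, 'y) bigraded_map \<Rightarrow> 'y bigraded \<Rightarrow> ('y, 'z) bigraded_map
      \<Rightarrow> 'z bigraded \<Rightarrow> ('z, 'x) bigraded_map \<Rightarrow> bool" where
  "long_exact_sequence P f Q g R h \<longleftrightarrow> (\<forall>i j.
       comm_group (P i j) \<and> comm_group (Q i j) \<and> comm_group (R i j)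
     \<and> f i j \<in> hom (P i j) (Q i j)
     \<and> g i j \<in> hom (Q i j) (R i j)
     \<and> h i j \<in> hom (R i j) (P (i - 2) j)
     \<and> f i j ` carrier (P i j) = kernel (Q i j) (R i j) (g i j)
     \<and> g i j ` carrier (Q i j) = kernel (R i j) (P (i - 2) j) (h i j)
     \<and> h i j ` carrier (R i j) = kernel (P (i - 2) j) (Q (i - 2) j) (f (i - 2) j))"

section \<open>Khovanov complexes\<close>

definition kh_chains :: "'a diagram \<Rightarrow> ('a enhanced_state \<Rightarrow>\<^sub>0 int) bigraded" where
  "kh_chains D i j = free_Abelian_group (states_in D i j)"

definition differ_at :: "'a diagram \<Rightarrow> 'a enhanced_state \<Rightarrow> 'a enhanced_state \<Rightarrow> nat \<Rightarrow> bool" where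
  "differ_at D S S' v \<longleftrightarrow>
     v < ncross D \<and> (\<forall>c < ncross D. fst S c \<noteq> fst S' c \<longleftrightarrow> c = v)"

text \<open>A circle that does not touch v is a circle of both smoothings, as the same set of arcs.\<close>

definition incidence :: "'a diagram \<Rightarrow> 'a enhanced_state \<Rightarrow> 'a enhanced_state \<Rightarrow> int" where
  "incidence D S S' =
     (if \<exists>v. differ_at D S S' v
           \<and> (\<forall>C \<in> circles D (fst S). \<not> touches D v C \<longrightarrow> snd S C = snd S' C)
      then 1 else 0)"

definition neg_after :: "'a diagram \<Rightarrow> 'a enhanced_state \<Rightarrow> 'a enhanced_state \<Rightarrow> nat" where
  "neg_after D S S' =
     card {c. c < ncross D \<and> (THE v. differ_at D S S' v) < c \<and> fst S c = -1}"

definition kh_diff ::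
    "'a diagram \<Rightarrow> ('a enhanced_state \<Rightarrow>\<^sub>0 int, 'a enhanced_state \<Rightarrow>\<^sub>0 int) bigraded_map" where
  "kh_diff D i j = frag_extend (\<lambda>S. \<Sum>S' \<in> states_in D (i - 2) j.
     frag_cmul ((-1) ^ neg_after D S S' * incidence D S S') (frag_of S'))"

definition pos_states :: "'a diagram \<Rightarrow> 'a \<Rightarrow> 'a enhanced_state set" where
  "pos_states D b = {S \<in> enhanced_states D. \<exists>C \<in> circles D (fst S). b \<in> C \<and> snd S C = 1}"

definition neg_states :: "'a diagram \<Rightarrow> 'a \<Rightarrow> 'a enhanced_state set" where
  "neg_states D b = {S \<in> enhanced_states D. \<exists>C \<in> circles D (fst S). b \<in> C \<and> snd S C = -1}"

definition pos_chains :: "'a diagram \<Rightarrow> 'a \<Rightarrow> ('a enhanced_state \<Rightarrow>\<^sub>0 int) bigraded" where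
  "pos_chains D b i j =
     subgroup_generated (kh_chains D i j) (frag_of ` (pos_states D b \<inter> states_in D i j))"

definition neg_chains :: "'a diagram \<Rightarrow> 'a \<Rightarrow> ('a enhanced_state \<Rightarrow>\<^sub>0 int) bigraded" where
  "neg_chains D b i j =
     subgroup_generated (kh_chains D i j) (frag_of ` (neg_states D b \<inter> states_in D i j))"

definition coreduced_chains ::
    "'a diagram \<Rightarrow> 'a \<Rightarrow> ('a enhanced_state \<Rightarrow>\<^sub>0 int) set bigraded" where
  "coreduced_chains D b i j = kh_chains D i j Mod carrier (pos_chains D b i j)"

definition incl ::
    "('a enhanced_state \<Rightarrow>\<^sub>0 int, 'a enhanced_state \<Rightarrow>\<^sub>0 int) bigraded_map" where
  "incl i j c = c"

definition quot ::
    "'a diagram \<Rightarrow> 'a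
      \<Rightarrow> ('a enhanced_state \<Rightarrow>\<^sub>0 int, ('a enhanced_state \<Rightarrow>\<^sub>0 int) set) bigraded_map" where
  "quot D b i j c = carrier (pos_chains D b i j) #>\<^bsub>kh_chains D i j\<^esub> c"

text \<open>The differential of the quotient complex; the union is over chains with the same image.\<close>

definition coreduced_diff ::
    "'a diagram \<Rightarrow> 'a
      \<Rightarrow> (('a enhanced_state \<Rightarrow>\<^sub>0 int) set, ('a enhanced_state \<Rightarrow>\<^sub>0 int) set) bigraded_map" where
  "coreduced_diff D b i j Z = (\<Union>c \<in> Z. quot D b (i - 2) j (kh_diff D i j c))"

abbreviation "kh_homology D \<equiv> homology (kh_chains D) (kh_diff D)"

abbreviation "reduced_homology D b \<equiv> homology (pos_chains D b) (kh_diff D)"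

abbreviation "coreduced_homology D b \<equiv> homology (coreduced_chains D b) (coreduced_diff D b)"

text \<open>
  The component in the positive summand of a chain, and the homomorphism that sends an enhanced
  state S to the positive component of d(S).
\<close>

definition pos_part ::
    "'a diagram \<Rightarrow> 'a \<Rightarrow> ('a enhanced_state \<Rightarrow>\<^sub>0 int) \<Rightarrow> ('a enhanced_state \<Rightarrow>\<^sub>0 int)" where
  "pos_part D b = frag_extend (\<lambda>S. if S \<in> pos_states D b then frag_of S else 0)"

definition pos_diff ::
    "'a diagram \<Rightarrow> 'a
      \<Rightarrow> ('a enhanced_state \<Rightarrow>\<^sub>0 int, 'a enhanced_state \<Rightarrow>\<^sub>0 int) bigraded_map" where
  "pos_diff D b i j = frag_extend (\<lambda>S. pos_part D b (kh_diff D i j (frag_of S)))"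

end

theory Submission
  imports Defs
begin

text \<open>
  The crux is that the differential squares to zero.  If the states after changing two crossings are
  fixed, the two orders of changing them contribute with opposite signs, and one has to match the
  intermediate enhanced states.  Reading a positive circle as X and a negative one as 1, the
  differential consists of multiplications and comultiplications over Z[X]/X^2, which commute with
  the multiplication by X at any arc; hence it suffices to follow the labelling without positive
  circles.  This works only if changing a crossing always merges two circles or splits one.
  For that, Euler's formula yields, by counting modulo 2, orientations of the arcs that are
  alternately incoming and outgoing around each crossing.  Every circle inherits an orientation, and
  the change of a crossing composes the permutation traced out by the circles with a transposition.
  Commuting with the multiplication by X at the base point also makes the reduced complex a
  subcomplex, and the rest is the long exact sequence of a quotient complex.
\<close>

section \<open>The long exact sequence in homology\<close>

text \<open>On a surface of higher genus a changed crossing can turn one circle into one circle.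
  Parity of \<open>tau\<close> makes that incidence zero, and a square whose other side is a split
  followed by a merge, sending 1 to 2X, has nothing to cancel it. So planarity must enter, but it is
  available only as a numerical identity, without curves or regions. It is used as a dimension count
  for sets of arcs over the field with two elements: with n crossings, E arcs, F faces and c
  components, the face boundaries span at least F - c dimensions, and the cuts by sets of crossings,
  enlarged by the obstruction to an orientation, would span at least n + 1 - c. The two spaces are
  orthogonal, so n + 1 + F \<le> E + 2c, against n - E + F = 2c. The orientation then halves the
  ends: a walk from all ends traces each circle in both directions, and a changed crossing alters
  four of its steps, whereas on the outgoing ends just two images are exchanged. The factor in 2X is
  also why intermediate labellings are counted, not merely shown to exist.\<close>

lemma r_coset_carrier_update [simp]: "H #>\<^bsub>G\<lparr>carrier := C\<rparr>\<^esub> x = H #>\<^bsub>G\<^esub> x"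
  by (simp add: r_coset_def)

lemma (in comm_group) r_coset_eq_iff:
  assumes "subgroup H G" "x \<in> carrier G" "y \<in> carrier G"
  shows "H #> x = H #> y \<longleftrightarrow> x \<otimes> inv y \<in> H"
proof
  assume "H #> x = H #> y"
  with rcos_self[OF assms(2,1)] have "x \<in> H #> y"
    by simp
  then show "x \<otimes> inv y \<in> H"
    using subgroup.rcos_module[OF assms(1) is_group assms(3,2)] by simp
next
  assume "x \<otimes> inv y \<in> H"
  then have "x \<in> H #> y"
    using subgroup.rcos_module[OF assms(1) is_group assms(3,2)] by simp
  then show "H #> x = H #> y"
    using repr_independence[OF _ assms(3,1)] by simp
qed

lemma (in comm_group) set_mult_r_coset:
  assumes "subgroup H G" "x \<in> carrier G" "y \<in> carrier G"
  shows "(H #> x) <#> (H #> y) = H #> (x \<otimes> y)"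
  using normal.rcos_sum[OF subgroup_imp_normal[OF assms(1)] assms(2,3)] .

lemma image_hom_subgroup:
  assumes "h \<in> hom G H" "group G" "group H"
  shows "subgroup (h ` carrier G) H"
  by (meson assms group_hom.img_is_subgroup group_hom_axioms.intro group_hom_def)

lemma kernel_hom_subgroup:
  assumes "h \<in> hom G H" "group G" "group H"
  shows "subgroup (kernel G H h) G"
  by (meson assms group_hom.subgroup_kernel group_hom_axioms.intro group_hom_def)

lemma hom_inv:
  assumes "h \<in> hom G H" "group G" "group H" "x \<in> carrier G"
  shows "h (inv\<^bsub>G\<^esub> x) = inv\<^bsub>H\<^esub> h x"
  by (meson assms group_hom.hom_inv group_hom_axioms.intro group_hom_def)

section \<open>Homology of a single complex\<close>

context
  fixes A :: "'x bigraded" and d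
  assumes cc: "chain_complex A d"
begin

lemma chain_complex_comm_group: "comm_group (A i j)"
  and chain_complex_hom: "d i j \<in> hom (A i j) (A (i - 2) j)"
  and chain_complex_square: "x \<in> carrier (A i j) \<Longrightarrow> d (i - 2) j (d i j x) = \<one>\<^bsub>A (i - 2 - 2) j\<^esub>"
  using cc by (auto simp: chain_complex_def)

lemma chain_complex_group: "group (A i j)"
  using chain_complex_comm_group comm_group.axioms(2) by blast

lemma cycles_subgroup: "subgroup (cycles A d i j) (A i j)"
  unfolding cycles_def
  by (intro kernel_hom_subgroup chain_complex_hom chain_complex_group)

lemma cycles_iff: "x \<in> cycles A d i j \<longleftrightarrow> x \<in> carrier (A i j) \<and> d i j x = \<one>\<^bsub>A (i - 2) j\<^esub>"
  by (auto simp: cycles_def kernel_def)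

lemma boundaries_minus_2: "boundaries A d (i - 2) j = d i j ` carrier (A i j)"
  by (simp add: boundaries_def)

lemma boundaries_subset_cycles: "boundaries A d i j \<subseteq> cycles A d i j"
  using chain_complex_hom[of "i + 2" j] chain_complex_square[of _ "i + 2" j]
  by (auto simp: boundaries_def cycles_iff hom_def)

lemma boundaries_subgroup: "subgroup (boundaries A d i j) (A i j)"
  using image_hom_subgroup[OF chain_complex_hom[of "i + 2" j]] chain_complex_group
  by (simp add: boundaries_def)

lemma boundaries_subgroup_cycles:
  "subgroup (boundaries A d i j) ((A i j)\<lparr>carrier := cycles A d i j\<rparr>)"
  by (rule group.subgroup_incl[OF chain_complex_group boundaries_subgroup cycles_subgroup
        boundaries_subset_cycles])

lemma cycles_comm_group: "comm_group ((A i j)\<lparr>carrier := cycles A d i j\<rparr>)"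
  by (rule group.group_comm_groupI)
    (auto intro!: subgroup.subgroup_is_group cycles_subgroup chain_complex_group
      simp: cycles_iff comm_groupE(4)[OF chain_complex_comm_group])

lemma homology_comm_group: "comm_group (homology A d i j)"
  unfolding homology_def
  by (rule comm_group.abelian_FactGroup[OF cycles_comm_group boundaries_subgroup_cycles])

lemma homology_carrier: "carrier (homology A d i j) = homology_class A d i j ` cycles A d i j"
  by (auto simp: homology_def carrier_FactGroup homology_class_def)

lemma homology_carrierE:
  assumes "U \<in> carrier (homology A d i j)"
  obtains z where "z \<in> cycles A d i j" "U = homology_class A d i j z"
  using assms by (auto simp: homology_carrier)

lemma homology_class_eq_iff:
  assumes "x \<in> carrier (A i j)" "y \<in> carrier (A i j)"
  shows "homology_class A d i j x = homology_class A d i j y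
     \<longleftrightarrow> x \<otimes>\<^bsub>A i j\<^esub> inv\<^bsub>A i j\<^esub> y \<in> boundaries A d i j"
  unfolding homology_class_def
  using comm_group.r_coset_eq_iff[OF chain_complex_comm_group boundaries_subgroup assms] .

lemma homology_one: "\<one>\<^bsub>homology A d i j\<^esub> = boundaries A d i j"
  by (simp add: homology_def)

lemma homology_class_one_iff:
  assumes "x \<in> carrier (A i j)"
  shows "homology_class A d i j x = \<one>\<^bsub>homology A d i j\<^esub> \<longleftrightarrow> x \<in> boundaries A d i j"
proof -
  interpret G: comm_group "A i j" by (rule chain_complex_comm_group)
  have "homology_class A d i j \<one>\<^bsub>A i j\<^esub> = boundaries A d i j"
    using G.coset_mult_one[OF subgroup.subset[OF boundaries_subgroup]]
    by (simp add: homology_class_def)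
  then show ?thesis
    using homology_class_eq_iff[OF assms G.one_closed] assms by (simp add: homology_one)
qed

lemma homology_mult:
  assumes "x \<in> carrier (A i j)" "y \<in> carrier (A i j)"
  shows "homology_class A d i j x \<otimes>\<^bsub>homology A d i j\<^esub> homology_class A d i j y
     = homology_class A d i j (x \<otimes>\<^bsub>A i j\<^esub> y)"
proof -
  have "set_mult ((A i j)\<lparr>carrier := cycles A d i j\<rparr>) = set_mult (A i j)"
    by (intro ext) (simp add: set_mult_def)
  then show ?thesis
    using comm_group.set_mult_r_coset[OF chain_complex_comm_group boundaries_subgroup assms]
    by (simp add: homology_def homology_class_def)
qed

lemma homology_classE:
  assumes "y \<in> homology_class A d i j x"
  obtains w where "w \<in> carrier (A (i + 2) j)" "y = d (i + 2) j w \<otimes>\<^bsub>A i j\<^esub> x"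
  using assms by (auto simp: homology_class_def r_coset_def boundaries_def)

lemma homology_class_self: "x \<in> carrier (A i j) \<Longrightarrow> x \<in> homology_class A d i j x"
  unfolding homology_class_def
  by (rule group.rcos_self[OF chain_complex_group _ boundaries_subgroup])

lemma homology_class_boundary_mult:
  assumes "x \<in> carrier (A i j)" "w \<in> carrier (A (i + 2) j)"
  shows "homology_class A d i j (d (i + 2) j w \<otimes>\<^bsub>A i j\<^esub> x) = homology_class A d i j x"
proof -
  interpret G: comm_group "A i j" by (rule chain_complex_comm_group)
  have "d (i + 2) j w \<in> carrier (A i j)"
    using chain_complex_hom[of "i + 2" j] assms by (auto simp: hom_def)
  then show ?thesis
    using assms by (subst homology_class_eq_iff) (auto simp: boundaries_def G.m_assoc)
qed

end

section \<open>Maps induced on homology\<close>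

lemma chain_map_hom: "chain_map A d B d' f \<Longrightarrow> f i j \<in> hom (A i j) (B i j)"
  and chain_map_commute:
    "chain_map A d B d' f \<Longrightarrow> x \<in> carrier (A i j) \<Longrightarrow> f (i - 2) j (d i j x) = d' i j (f i j x)"
  by (auto simp: chain_map_def)

lemma chain_map_cycles:
  assumes "chain_complex A d" "chain_complex B d'" "chain_map A d B d' f" "z \<in> cycles A d i j"
  shows "f i j z \<in> cycles B d' i j"
proof -
  have "f (i - 2) j \<one>\<^bsub>A (i - 2) j\<^esub> = \<one>\<^bsub>B (i - 2) j\<^esub>"
    using hom_one[OF chain_map_hom[OF assms(3)]] chain_complex_group assms(1,2) by metis
  then show ?thesis
    using assms chain_map_hom[OF assms(3)] chain_map_commute[OF assms(3), symmetric]
    by (fastforce simp: cycles_iff hom_def)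
qed

text \<open>Another representative is \<open>d (i + 2) j w\<close> times \<open>z\<close>, and
  \<open>f\<close> turns the extra factor into a boundary. So all members of the union in
  \<open>induced_map\<close> are one coset, and the union is nonempty because \<open>z\<close> lies
  in its own class.\<close>

lemma induced_map_class:
  assumes A: "chain_complex A d" and B: "chain_complex B d'" and f: "chain_map A d B d' f"
    and z: "z \<in> carrier (A i j)"
  shows "induced_map B d' f i j (homology_class A d i j z) = homology_class B d' i j (f i j z)"
proof -
  have "homology_class B d' i j (f i j y) = homology_class B d' i j (f i j z)"
    if y: "y \<in> homology_class A d i j z" for y
  proof -
    obtain w where w: "w \<in> carrier (A (i + 2) j)" "y = d (i + 2) j w \<otimes>\<^bsub>A i j\<^esub> z"
      by (rule homology_classE[OF A y])
    have "d (i + 2) j w \<in> carrier (A i j)"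
      using chain_complex_hom[OF A, of "i + 2" j] w by (auto simp: hom_def)
    then have "f i j y = d' (i + 2) j (f (i + 2) j w) \<otimes>\<^bsub>B i j\<^esub> f i j z"
      using chain_map_hom[OF f, of i j] chain_map_commute[OF f w(1)] w z by (auto simp: hom_def)
    then show ?thesis
      using homology_class_boundary_mult[OF B] w z chain_map_hom[OF f]
      by (auto simp: hom_def Pi_iff)
  qed
  then show ?thesis
    using homology_class_self[OF A z] unfolding induced_map_def by blast
qed

lemma induced_map_hom:
  assumes A: "chain_complex A d" and B: "chain_complex B d'" and f: "chain_map A d B d' f"
  shows "induced_map B d' f i j \<in> hom (homology A d i j) (homology B d' i j)"
proof (rule homI)
  fix U assume "U \<in> carrier (homology A d i j)"
  then obtain x where x: "x \<in> cycles A d i j" "U = homology_class A d i j x"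
    by (rule homology_carrierE[OF A])
  then show "induced_map B d' f i j U \<in> carrier (homology B d' i j)"
    using chain_map_cycles[OF A B f x(1)] induced_map_class[OF A B f]
    by (auto simp: homology_carrier[OF B] cycles_iff[OF A])
  fix Y assume "Y \<in> carrier (homology A d i j)"
  then obtain y where y: "y \<in> cycles A d i j" "Y = homology_class A d i j y"
    by (rule homology_carrierE[OF A])
  have c: "x \<in> carrier (A i j)" "y \<in> carrier (A i j)"
    using x y by (auto simp: cycles_iff[OF A])
  have xy: "x \<otimes>\<^bsub>A i j\<^esub> y \<in> carrier (A i j)"
    using c chain_complex_group[OF A] by (simp add: group.is_monoid monoid.m_closed)
  have fc: "f i j x \<in> carrier (B i j)" "f i j y \<in> carrier (B i j)"
    "f i j (x \<otimes>\<^bsub>A i j\<^esub> y) = f i j x \<otimes>\<^bsub>B i j\<^esub> f i j y"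
    using c chain_map_hom[OF f, of i j] by (auto simp: hom_def)
  show "induced_map B d' f i j (U \<otimes>\<^bsub>homology A d i j\<^esub> Y)
      = induced_map B d' f i j U \<otimes>\<^bsub>homology B d' i j\<^esub> induced_map B d' f i j Y"
    using c xy fc
    by (simp add: x(2) y(2) homology_mult[OF A] homology_mult[OF B] induced_map_class[OF A B f])
qed

section \<open>The connecting homomorphism and exactness\<close>

context
  fixes A :: "'x bigraded" and dA f and B :: "'y bigraded" and dB g and C :: "'z bigraded" and dC
  assumes ses: "short_exact_complexes A dA f B dB g C dC"
begin

lemma ses_complexes: "chain_complex A dA" "chain_complex B dB" "chain_complex C dC"
  and ses_maps: "chain_map A dA B dB f" "chain_map B dB C dC g"
  using ses by (auto simp: short_exact_complexes_def)

lemmas ses_A = ses_complexes(1) and ses_B = ses_complexes(2) and ses_C = ses_complexes(3)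

lemma ses_inj: "inj_on (f i j) (carrier (A i j))"
  and ses_exact: "f i j ` carrier (A i j) = {b \<in> carrier (B i j). g i j b = \<one>\<^bsub>C i j\<^esub>}"
  and ses_surj: "g i j ` carrier (B i j) = carrier (C i j)"
  using ses by (auto simp: short_exact_complexes_def mon_def epi_def kernel_def)

lemma ses_exactE:
  assumes "b \<in> carrier (B i j)" "g i j b = \<one>\<^bsub>C i j\<^esub>"
  obtains a where "a \<in> carrier (A i j)" "b = f i j a"
  using assms ses_exact[of i j] by blast

lemma ses_surjE:
  assumes "z \<in> carrier (C i j)"
  obtains b where "b \<in> carrier (B i j)" "g i j b = z"
  using assms unfolding ses_surj[symmetric] by blast

lemma ses_fclosed: "a \<in> carrier (A i j) \<Longrightarrow> f i j a \<in> carrier (B i j)"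
  and ses_gclosed: "b \<in> carrier (B i j) \<Longrightarrow> g i j b \<in> carrier (C i j)"
  and ses_gf: "a \<in> carrier (A i j) \<Longrightarrow> g i j (f i j a) = \<one>\<^bsub>C i j\<^esub>"
  using ses_exact[of i j] ses_surj[of i j] by blast+

lemma ses_closed:
  "a \<in> carrier (A i j) \<Longrightarrow> dA i j a \<in> carrier (A (i - 2) j)"
  "b \<in> carrier (B i j) \<Longrightarrow> dB i j b \<in> carrier (B (i - 2) j)"
  "c \<in> carrier (C i j) \<Longrightarrow> dC i j c \<in> carrier (C (i - 2) j)"
  using chain_complex_hom[OF ses_A, of i j] chain_complex_hom[OF ses_B, of i j]
    chain_complex_hom[OF ses_C, of i j]
  by (auto simp: hom_def)

lemma ses_closed_plus:
  "a \<in> carrier (A (i + 2) j) \<Longrightarrow> dA (i + 2) j a \<in> carrier (A i j)"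
  "b \<in> carrier (B (i + 2) j) \<Longrightarrow> dB (i + 2) j b \<in> carrier (B i j)"
  "c \<in> carrier (C (i + 2) j) \<Longrightarrow> dC (i + 2) j c \<in> carrier (C i j)"
  using ses_closed[of _ "i + 2" j] by simp_all

lemma ses_mult:
  "a \<in> carrier (A i j) \<Longrightarrow> a' \<in> carrier (A i j)
    \<Longrightarrow> f i j (a \<otimes>\<^bsub>A i j\<^esub> a') = f i j a \<otimes>\<^bsub>B i j\<^esub> f i j a'"
  "b \<in> carrier (B i j) \<Longrightarrow> b' \<in> carrier (B i j)
    \<Longrightarrow> g i j (b \<otimes>\<^bsub>B i j\<^esub> b') = g i j b \<otimes>\<^bsub>C i j\<^esub> g i j b'"
  "b \<in> carrier (B i j) \<Longrightarrow> b' \<in> carrier (B i j)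
    \<Longrightarrow> dB i j (b \<otimes>\<^bsub>B i j\<^esub> b') = dB i j b \<otimes>\<^bsub>B (i - 2) j\<^esub> dB i j b'"
  using chain_map_hom[OF ses_maps(1), of i j] chain_map_hom[OF ses_maps(2), of i j]
    chain_complex_hom[OF ses_B, of i j]
  by (auto simp: hom_def)

lemma ses_inv:
  "a \<in> carrier (A i j) \<Longrightarrow> f i j (inv\<^bsub>A i j\<^esub> a) = inv\<^bsub>B i j\<^esub> f i j a"
  "b \<in> carrier (B i j) \<Longrightarrow> g i j (inv\<^bsub>B i j\<^esub> b) = inv\<^bsub>C i j\<^esub> g i j b"
  "b \<in> carrier (B i j) \<Longrightarrow> dB i j (inv\<^bsub>B i j\<^esub> b) = inv\<^bsub>B (i - 2) j\<^esub> dB i j b"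
  by (simp_all add: hom_inv[OF chain_map_hom[OF ses_maps(1)]] hom_inv[OF chain_map_hom[OF ses_maps(2)]]
        hom_inv[OF chain_complex_hom[OF ses_B]] chain_complex_group[OF ses_A]
        chain_complex_group[OF ses_B] chain_complex_group[OF ses_C])

lemma ses_one: "f i j \<one>\<^bsub>A i j\<^esub> = \<one>\<^bsub>B i j\<^esub>" "g i j \<one>\<^bsub>B i j\<^esub> = \<one>\<^bsub>C i j\<^esub>"
  using hom_one[OF chain_map_hom[OF ses_maps(1)]] hom_one[OF chain_map_hom[OF ses_maps(2)]]
    chain_complex_group ses_complexes by metis+

lemma lift_is_cycle:
  assumes "c \<in> carrier (B i j)" "a \<in> carrier (A (i - 2) j)" "dB i j c = f (i - 2) j a"
  shows "a \<in> cycles A dA (i - 2) j" "g i j c \<in> cycles C dC i j"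
proof -
  have "f (i - 2 - 2) j (dA (i - 2) j a) = f (i - 2 - 2) j \<one>\<^bsub>A (i - 2 - 2) j\<^esub>"
    using chain_map_commute[OF ses_maps(1) assms(2)] chain_complex_square[OF ses_B assms(1)] assms(3)
      ses_one by simp
  then show "a \<in> cycles A dA (i - 2) j"
    using inj_onD[OF ses_inj] assms ses_closed(1)[OF assms(2)] group.is_monoid[OF chain_complex_group[OF ses_A]]
    by (auto simp: cycles_iff[OF ses_A])
  have "dC i j (g i j c) = \<one>\<^bsub>C (i - 2) j\<^esub>"
    using chain_map_commute[OF ses_maps(2) assms(1)] assms ses_gf by simp
  then show "g i j c \<in> cycles C dC i j"
    using assms ses_gclosed by (simp add: cycles_iff[OF ses_C])
qed

lemma cycle_lift:
  assumes "z \<in> cycles C dC i j"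
  obtains c a where "c \<in> carrier (B i j)" "a \<in> carrier (A (i - 2) j)"
    "g i j c = z" "dB i j c = f (i - 2) j a"
proof -
  have z: "z \<in> carrier (C i j)" "dC i j z = \<one>\<^bsub>C (i - 2) j\<^esub>"
    using assms by (auto simp: cycles_iff[OF ses_C])
  obtain c where c: "c \<in> carrier (B i j)" "g i j c = z"
    using ses_surjE[OF z(1)] .
  have "g (i - 2) j (dB i j c) = \<one>\<^bsub>C (i - 2) j\<^esub>"
    using chain_map_commute[OF ses_maps(2) c(1)] c z by simp
  then obtain a where a: "a \<in> carrier (A (i - 2) j)" "dB i j c = f (i - 2) j a"
    by (rule ses_exactE[OF ses_closed(2)[OF c(1)]])
  show ?thesis
    by (rule that[OF c(1) a(1) c(2) a(2)])
qed

text \<open>The zigzag is well defined: in additive terms, two lifts of homologous cycles differ by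
  a boundary \<open>dB u\<close> and an element coming from \<open>A\<close>, and the latter changes
  the value by a boundary of \<open>A\<close>. Conversely, adding \<open>f w\<close> to the lift
  realises the representative \<open>dA w + a\<close>. As \<open>connecting\<close> collects all
  outcomes without a choice, both inclusions are required to obtain the whole coset.\<close>

lemma connecting_class:
  assumes c: "c \<in> carrier (B i j)" and a: "a \<in> carrier (A (i - 2) j)"
    and ca: "dB i j c = f (i - 2) j a"
  shows "connecting A f B dB g i j (homology_class C dC i j (g i j c))
    = homology_class A dA (i - 2) j a"
proof -
  interpret A: comm_group "A i j" by (rule chain_complex_comm_group[OF ses_A])
  interpret A': comm_group "A (i - 2) j" by (rule chain_complex_comm_group[OF ses_A])
  interpret B: comm_group "B i j" by (rule chain_complex_comm_group[OF ses_B])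
  interpret B': comm_group "B (i - 2) j" by (rule chain_complex_comm_group[OF ses_B])
  interpret C: comm_group "C i j" by (rule chain_complex_comm_group[OF ses_C])
  have "y \<in> homology_class A dA (i - 2) j a"
    if y: "y \<in> carrier (A (i - 2) j)" and c': "c' \<in> carrier (B i j)"
      "g i j c' \<in> homology_class C dC i j (g i j c)" "dB i j c' = f (i - 2) j y" for y c'
  proof -
    obtain w where w: "w \<in> carrier (C (i + 2) j)"
      "g i j c' = dC (i + 2) j w \<otimes>\<^bsub>C i j\<^esub> g i j c"
      by (rule homology_classE[OF ses_C c'(2)])
    obtain u where u: "u \<in> carrier (B (i + 2) j)" "g (i + 2) j u = w"
      using ses_surjE[OF w(1)] .
    have du: "dB (i + 2) j u \<in> carrier (B i j)" "g i j (dB (i + 2) j u) = dC (i + 2) j w"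
      "dB i j (dB (i + 2) j u) = \<one>\<^bsub>B (i - 2) j\<^esub>"
      using ses_closed_plus(2)[OF u(1)] chain_map_commute[OF ses_maps(2) u(1)] u(2)
        chain_complex_square[OF ses_B u(1)] by simp_all
    \<comment> \<open>\<open>u\<close> lifts the chain \<open>w\<close> by which the two cycles
      differ, so \<open>g\<close> kills \<open>e\<close>, which therefore comes from some
      \<open>p\<close> in \<open>A\<close>. Since \<open>dB\<close> kills \<open>dB u\<close>,
      applying \<open>dB\<close> to \<open>e\<close> leaves the difference of the images of
      \<open>y\<close> and \<open>a\<close>.\<close>
    define e where "e = c' \<otimes>\<^bsub>B i j\<^esub> inv\<^bsub>B i j\<^esub> (dB (i + 2) j u \<otimes>\<^bsub>B i j\<^esub> c)"
    have e: "e \<in> carrier (B i j)"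
      using c c' du by (simp add: e_def)
    have "g i j e = \<one>\<^bsub>C i j\<^esub>"
      using c c' du w ses_gclosed[OF c] ses_gclosed[OF c'(1)] ses_gclosed[OF du(1)]
      by (simp add: e_def ses_mult ses_inv)
    then obtain p where p: "p \<in> carrier (A i j)" "e = f i j p"
      using ses_exactE e by metis
    have "dB i j e = f (i - 2) j y \<otimes>\<^bsub>B (i - 2) j\<^esub> inv\<^bsub>B (i - 2) j\<^esub> f (i - 2) j a"
      using c c' du ca ses_closed(2)[OF c] ses_fclosed[OF a]
      by (simp add: e_def ses_mult ses_inv)
    then have "f (i - 2) j (dA i j p) = f (i - 2) j (y \<otimes>\<^bsub>A (i - 2) j\<^esub> inv\<^bsub>A (i - 2) j\<^esub> a)"
      using chain_map_commute[OF ses_maps(1) p(1)] p y a by (simp add: ses_mult ses_inv)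
    then have "dA i j p = y \<otimes>\<^bsub>A (i - 2) j\<^esub> inv\<^bsub>A (i - 2) j\<^esub> a"
      using inj_onD[OF ses_inj] ses_closed(1)[OF p(1)] y a by simp
    then have "homology_class A dA (i - 2) j y = homology_class A dA (i - 2) j a"
      unfolding homology_class_eq_iff[OF ses_A y a] boundaries_minus_2[OF ses_A]
      using p(1) by (intro image_eqI[of _ _ p]) simp_all
    then show ?thesis
      using homology_class_self[OF ses_A y] by simp
  qed
  moreover have "y \<in> carrier (A (i - 2) j) \<and> (\<exists>c' \<in> carrier (B i j).
      g i j c' \<in> homology_class C dC i j (g i j c) \<and> dB i j c' = f (i - 2) j y)"
    if y: "y \<in> homology_class A dA (i - 2) j a" for y
  proof -
    obtain w where w: "w \<in> carrier (A i j)" "y = dA i j w \<otimes>\<^bsub>A (i - 2) j\<^esub> a"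
      using homology_classE[OF ses_A y] by auto
    have fw: "f i j w \<in> carrier (B i j)" "g i j (f i j w) = \<one>\<^bsub>C i j\<^esub>"
      "dB i j (f i j w) = f (i - 2) j (dA i j w)"
      using w ses_fclosed ses_gf chain_map_commute[OF ses_maps(1)] by simp_all
    have "g i j (f i j w \<otimes>\<^bsub>B i j\<^esub> c) = g i j c"
      using fw c ses_gclosed by (simp add: ses_mult)
    moreover have "dB i j (f i j w \<otimes>\<^bsub>B i j\<^esub> c) = f (i - 2) j y"
      using fw c ca w a ses_closed(1)[OF w(1)] by (simp add: ses_mult)
    ultimately show ?thesis
      using homology_class_self[OF ses_C ses_gclosed[OF c]] w a ses_closed(1)[OF w(1)] fw c
      by (auto intro!: bexI[of _ "f i j w \<otimes>\<^bsub>B i j\<^esub> c"])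
  qed
  ultimately show ?thesis
    by (auto simp: connecting_def)
qed

lemma connecting_hom:
  "connecting A f B dB g i j \<in> hom (homology C dC i j) (homology A dA (i - 2) j)"
proof (rule homI)
  interpret A': comm_group "A (i - 2) j" by (rule chain_complex_comm_group[OF ses_A])
  interpret B: comm_group "B i j" by (rule chain_complex_comm_group[OF ses_B])
  fix U assume "U \<in> carrier (homology C dC i j)"
  then obtain x where x: "x \<in> cycles C dC i j" "U = homology_class C dC i j x"
    by (rule homology_carrierE[OF ses_C])
  obtain c a where c: "c \<in> carrier (B i j)" "a \<in> carrier (A (i - 2) j)"
    "g i j c = x" "dB i j c = f (i - 2) j a"
    using cycle_lift[OF x(1)] .
  note U = connecting_class[OF c(1,2,4), unfolded c(3), folded x(2)]
  show "connecting A f B dB g i j U \<in> carrier (homology A dA (i - 2) j)"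
    using U lift_is_cycle(1)[OF c(1,2,4)] by (simp add: homology_carrier[OF ses_A])
  fix Y assume "Y \<in> carrier (homology C dC i j)"
  then obtain y where y: "y \<in> cycles C dC i j" "Y = homology_class C dC i j y"
    by (rule homology_carrierE[OF ses_C])
  obtain c' a' where c': "c' \<in> carrier (B i j)" "a' \<in> carrier (A (i - 2) j)"
    "g i j c' = y" "dB i j c' = f (i - 2) j a'"
    using cycle_lift[OF y(1)] .
  note Y = connecting_class[OF c'(1,2,4), unfolded c'(3), folded y(2)]
  have "connecting A f B dB g i j (homology_class C dC i j (g i j (c \<otimes>\<^bsub>B i j\<^esub> c')))
      = homology_class A dA (i - 2) j (a \<otimes>\<^bsub>A (i - 2) j\<^esub> a')"
    using c c' by (intro connecting_class) (simp_all add: ses_mult)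
  moreover have "homology_class C dC i j (g i j (c \<otimes>\<^bsub>B i j\<^esub> c')) = U \<otimes>\<^bsub>homology C dC i j\<^esub> Y"
    using c(1,3) c'(1,3) ses_gclosed[OF c(1)] ses_gclosed[OF c'(1)]
    by (simp add: x(2) y(2) homology_mult[OF ses_C] ses_mult)
  ultimately have "connecting A f B dB g i j (U \<otimes>\<^bsub>homology C dC i j\<^esub> Y)
      = homology_class A dA (i - 2) j (a \<otimes>\<^bsub>A (i - 2) j\<^esub> a')"
    by metis
  then show "connecting A f B dB g i j (U \<otimes>\<^bsub>homology C dC i j\<^esub> Y)
      = connecting A f B dB g i j U \<otimes>\<^bsub>homology A dA (i - 2) j\<^esub> connecting A f B dB g i j Y"
    unfolding U Y homology_mult[OF ses_A c(2) c'(2)] .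
qed

lemma exact_at_middle:
  "induced_map B dB f i j ` carrier (homology A dA i j)
    = kernel (homology B dB i j) (homology C dC i j) (induced_map C dC g i j)" (is "?L = ?R")
proof (intro subset_antisym subsetI)
  fix Y assume "Y \<in> ?L"
  then obtain z where z: "z \<in> cycles A dA i j"
    and Y: "Y = induced_map B dB f i j (homology_class A dA i j z)"
    by (auto simp: homology_carrier[OF ses_A])
  have zc: "z \<in> carrier (A i j)"
    using z by (simp add: cycles_iff[OF ses_A])
  have "homology_class C dC i j (g i j (f i j z)) = \<one>\<^bsub>homology C dC i j\<^esub>"
    using ses_gf[OF zc] subgroup.one_closed[OF boundaries_subgroup[OF ses_C]]
      subgroup.mem_carrier[OF boundaries_subgroup[OF ses_C]]
    by (simp add: homology_class_one_iff[OF ses_C])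
  then show "Y \<in> ?R"
    using chain_map_cycles[OF ses_A ses_B ses_maps(1) z] zc ses_fclosed[OF zc]
    by (simp add: Y kernel_def homology_carrier[OF ses_B]
        induced_map_class[OF ses_A ses_B ses_maps(1)] induced_map_class[OF ses_B ses_C ses_maps(2)])
next
  interpret B: comm_group "B i j" by (rule chain_complex_comm_group[OF ses_B])
  interpret C: comm_group "C i j" by (rule chain_complex_comm_group[OF ses_C])
  interpret B': comm_group "B (i - 2) j" by (rule chain_complex_comm_group[OF ses_B])
  fix Y assume Y: "Y \<in> ?R"
  then obtain z where z: "z \<in> cycles B dB i j" "Y = homology_class B dB i j z"
    by (auto simp: kernel_def homology_carrier[OF ses_B])
  have zc: "z \<in> carrier (B i j)" "dB i j z = \<one>\<^bsub>B (i - 2) j\<^esub>"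
    using z by (auto simp: cycles_iff[OF ses_B])
  have "homology_class C dC i j (g i j z) = \<one>\<^bsub>homology C dC i j\<^esub>"
    using Y zc by (simp add: kernel_def z(2) induced_map_class[OF ses_B ses_C ses_maps(2)])
  then have "g i j z \<in> boundaries C dC i j"
    using ses_gclosed[OF zc(1)] by (simp add: homology_class_one_iff[OF ses_C])
  then obtain w where w: "w \<in> carrier (C (i + 2) j)" "g i j z = dC (i + 2) j w"
    unfolding boundaries_def by blast
  obtain u where u: "u \<in> carrier (B (i + 2) j)" "g (i + 2) j u = w"
    using ses_surjE[OF w(1)] .
  have du: "dB (i + 2) j u \<in> carrier (B i j)" "g i j (dB (i + 2) j u) = dC (i + 2) j w"
    "dB i j (dB (i + 2) j u) = \<one>\<^bsub>B (i - 2) j\<^esub>"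
    using ses_closed_plus(2)[OF u(1)] chain_map_commute[OF ses_maps(2) u(1)] u(2)
      chain_complex_square[OF ses_B u(1)] by simp_all
  define e where "e = z \<otimes>\<^bsub>B i j\<^esub> inv\<^bsub>B i j\<^esub> dB (i + 2) j u"
  have e: "e \<in> carrier (B i j)" "dB i j e = \<one>\<^bsub>B (i - 2) j\<^esub>"
    using zc du by (simp_all add: e_def ses_mult ses_inv)
  have "g i j e = \<one>\<^bsub>C i j\<^esub>"
    using zc du w ses_gclosed[OF du(1)] by (simp add: e_def ses_mult ses_inv)
  then obtain p where p: "p \<in> carrier (A i j)" "e = f i j p"
    using ses_exactE e by metis
  have "f (i - 2) j (dA i j p) = f (i - 2) j \<one>\<^bsub>A (i - 2) j\<^esub>"
    using chain_map_commute[OF ses_maps(1) p(1)] p e ses_one by simp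
  then have pc: "p \<in> cycles A dA i j"
    using inj_onD[OF ses_inj] ses_closed(1)[OF p(1)] p(1)
      group.is_monoid[OF chain_complex_group[OF ses_A]]
    by (auto simp: cycles_iff[OF ses_A])
  have "z = dB (i + 2) j u \<otimes>\<^bsub>B i j\<^esub> e"
    using zc du by (simp add: e_def B.m_lcomm)
  then have "Y = homology_class B dB i j (f i j p)"
    using homology_class_boundary_mult[OF ses_B e(1) u(1)] p z by simp
  then have "Y = induced_map B dB f i j (homology_class A dA i j p)"
    by (simp add: induced_map_class[OF ses_A ses_B ses_maps(1) p(1)])
  then show "Y \<in> ?L"
    using pc by (auto simp: homology_carrier[OF ses_A])
qed

lemma exact_at_quotient:
  "induced_map C dC g i j ` carrier (homology B dB i j)
    = kernel (homology C dC i j) (homology A dA (i - 2) j) (connecting A f B dB g i j)" (is "?L = ?R")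
proof (intro subset_antisym subsetI)
  fix Y assume "Y \<in> ?L"
  then obtain z where z: "z \<in> cycles B dB i j"
    and Y: "Y = induced_map C dC g i j (homology_class B dB i j z)"
    by (auto simp: homology_carrier[OF ses_B])
  have zc: "z \<in> carrier (B i j)" "dB i j z = f (i - 2) j \<one>\<^bsub>A (i - 2) j\<^esub>"
    using z ses_one by (auto simp: cycles_iff[OF ses_B])
  have Y': "Y = homology_class C dC i j (g i j z)"
    by (simp add: Y induced_map_class[OF ses_B ses_C ses_maps(2) zc(1)])
  have one: "\<one>\<^bsub>A (i - 2) j\<^esub> \<in> carrier (A (i - 2) j)"
    using chain_complex_group[OF ses_A] by (simp add: group.is_monoid)
  have "connecting A f B dB g i j Y = \<one>\<^bsub>homology A dA (i - 2) j\<^esub>"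
    using connecting_class[OF zc(1) one zc(2)] subgroup.one_closed[OF boundaries_subgroup[OF ses_A]]
    by (simp add: Y' homology_class_one_iff[OF ses_A one])
  then show "Y \<in> ?R"
    using chain_map_cycles[OF ses_B ses_C ses_maps(2) z]
    by (auto simp: kernel_def Y' homology_carrier[OF ses_C])
next
  interpret B: comm_group "B i j" by (rule chain_complex_comm_group[OF ses_B])
  interpret B': comm_group "B (i - 2) j" by (rule chain_complex_comm_group[OF ses_B])
  interpret C: comm_group "C i j" by (rule chain_complex_comm_group[OF ses_C])
  fix Y assume Y: "Y \<in> ?R"
  then obtain z where z: "z \<in> cycles C dC i j" "Y = homology_class C dC i j z"
    by (auto simp: kernel_def homology_carrier[OF ses_C])
  obtain c a where c: "c \<in> carrier (B i j)" "a \<in> carrier (A (i - 2) j)"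
    "g i j c = z" "dB i j c = f (i - 2) j a"
    using cycle_lift[OF z(1)] .
  have "homology_class A dA (i - 2) j a = \<one>\<^bsub>homology A dA (i - 2) j\<^esub>"
    using connecting_class[OF c(1,2,4)] Y z c(3) by (simp add: kernel_def)
  then obtain p where p: "p \<in> carrier (A i j)" "a = dA i j p"
    using c by (auto simp: homology_class_one_iff[OF ses_A] boundaries_minus_2[OF ses_A])
  \<comment> \<open>The value of the zigzag is the boundary of \<open>p\<close>; correcting the lift
    by \<open>f p\<close> makes it a cycle of \<open>B\<close> without changing its image in
    \<open>C\<close>.\<close>
  define e where "e = c \<otimes>\<^bsub>B i j\<^esub> inv\<^bsub>B i j\<^esub> f i j p"
  have fp: "f i j p \<in> carrier (B i j)" "dB i j (f i j p) = f (i - 2) j a" "g i j (f i j p) = \<one>\<^bsub>C i j\<^esub>"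
    using p ses_fclosed ses_gf chain_map_commute[OF ses_maps(1) p(1)] by simp_all
  have "e \<in> carrier (B i j)" "dB i j e = \<one>\<^bsub>B (i - 2) j\<^esub>" "g i j e = z"
    using c fp ses_gclosed[OF c(1)] ses_fclosed[OF c(2)] by (auto simp: e_def ses_mult ses_inv)
  then have "e \<in> cycles B dB i j" "Y = induced_map C dC g i j (homology_class B dB i j e)"
    by (simp_all add: cycles_iff[OF ses_B] induced_map_class[OF ses_B ses_C ses_maps(2)] z(2))
  then show "Y \<in> ?L"
    by (auto simp: homology_carrier[OF ses_B])
qed

text \<open>The equation \<open>dB c = f a\<close>, read in one direction, says that
  \<open>a\<close> is a value of the connecting map, and in the other that \<open>f a\<close> is a
  boundary.\<close>

lemma exact_at_sub:
  "connecting A f B dB g i j ` carrier (homology C dC i j)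
    = kernel (homology A dA (i - 2) j) (homology B dB (i - 2) j) (induced_map B dB f (i - 2) j)"
  (is "?L = ?R")
proof (intro subset_antisym subsetI)
  fix Y assume "Y \<in> ?L"
  then obtain z where z: "z \<in> cycles C dC i j"
    and Y: "Y = connecting A f B dB g i j (homology_class C dC i j z)"
    by (auto simp: homology_carrier[OF ses_C])
  obtain c a where c: "c \<in> carrier (B i j)" "a \<in> carrier (A (i - 2) j)"
    "g i j c = z" "dB i j c = f (i - 2) j a"
    using cycle_lift[OF z(1)] .
  have Y': "Y = homology_class A dA (i - 2) j a"
    using connecting_class[OF c(1,2,4)] c(3) by (simp add: Y)
  have "f (i - 2) j a \<in> boundaries B dB (i - 2) j"
    using c by (auto simp: boundaries_minus_2[OF ses_B] intro!: image_eqI[of _ _ c])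
  then show "Y \<in> ?R"
    using lift_is_cycle(1)[OF c(1,2,4)] c(2) ses_fclosed[OF c(2)]
    by (simp add: Y' kernel_def homology_carrier[OF ses_A]
        induced_map_class[OF ses_A ses_B ses_maps(1)] homology_class_one_iff[OF ses_B])
next
  fix Y assume Y: "Y \<in> ?R"
  then obtain a where a: "a \<in> cycles A dA (i - 2) j" "Y = homology_class A dA (i - 2) j a"
    by (auto simp: kernel_def homology_carrier[OF ses_A])
  have ac: "a \<in> carrier (A (i - 2) j)"
    using a by (simp add: cycles_iff[OF ses_A])
  have "f (i - 2) j a \<in> boundaries B dB (i - 2) j"
    using Y ac ses_fclosed[OF ac]
    by (simp add: kernel_def a(2) induced_map_class[OF ses_A ses_B ses_maps(1)]
        homology_class_one_iff[OF ses_B])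
  then obtain c where c: "c \<in> carrier (B i j)" "dB i j c = f (i - 2) j a"
    unfolding boundaries_minus_2[OF ses_B] by (elim imageE) (rule that, simp_all)
  have "Y = connecting A f B dB g i j (homology_class C dC i j (g i j c))"
    using connecting_class[OF c(1) ac c(2)] a by simp
  then show "Y \<in> ?L"
    using lift_is_cycle(2)[OF c(1) ac c(2)] by (auto simp: homology_carrier[OF ses_C])
qed

theorem short_exact_imp_long_exact:
  "long_exact_sequence (homology A dA) (induced_map B dB f) (homology B dB)
     (induced_map C dC g) (homology C dC) (connecting A f B dB g)"
  unfolding long_exact_sequence_def
  by (intro allI conjI homology_comm_group[OF ses_A] homology_comm_group[OF ses_B]
      homology_comm_group[OF ses_C] induced_map_hom[OF ses_A ses_B ses_maps(1)]
      induced_map_hom[OF ses_B ses_C ses_maps(2)] connecting_hom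
      exact_at_middle exact_at_quotient exact_at_sub)

end

section \<open>Planarity and orientations\<close>

lemma even_card_fixpoint_free_involution:
  assumes "finite A" "\<And>x. x \<in> A \<Longrightarrow> f x \<in> A" "\<And>x. x \<in> A \<Longrightarrow> f (f x) = x" "\<And>x. x \<in> A \<Longrightarrow> f x \<noteq> x"
  shows "even (card A)"
  using assms
proof (induction "card A" arbitrary: A rule: less_induct)
  case less
  show ?case
  proof (cases "A = {}")
    case False
    then obtain x where x: "x \<in> A" by blast
    define A' where "A' = A - {x, f x}"
    have c: "card A = card A' + 2"
      using less.prems(1) less.prems(2)[OF x] less.prems(4)[OF x] x card_Diff_subset[of "{x, f x}" A]
        card_mono[of A "{x, f x}"]
      by (auto simp: A'_def)
    moreover have "even (card A')"
    proof (rule less.hyps)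
      show "f y \<in> A'" if y: "y \<in> A'" for y
      proof -
        have yA: "y \<in> A" "y \<noteq> x" "y \<noteq> f x"
          using y by (auto simp: A'_def)
        then have "f y \<noteq> x" "f y \<noteq> f x"
          using less.prems(3)[OF yA(1)] less.prems(3)[OF x] by metis+
        then show ?thesis
          using less.prems(2)[OF yA(1)] by (simp add: A'_def)
      qed
    qed (use c less.prems in \<open>auto simp: A'_def\<close>)
    ultimately show ?thesis by simp
  qed simp
qed

lemma card_sym_diff_parity:
  assumes "finite A" "finite B"
  shows "even (card (sym_diff A B)) \<longleftrightarrow> even (card A + card B)"
proof -
  have A: "card (A - B) + card (A \<inter> B) = card A" and B: "card (B - A) + card (A \<inter> B) = card B"
    using assms card_Int_Diff[of A B] card_Int_Diff[of B A] by (simp_all add: Int_commute)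
  have "card (sym_diff A B) = card (A - B) + card (B - A)"
    using assms by (intro card_Un_disjoint) auto
  then have "card A + card B = card (sym_diff A B) + 2 * card (A \<inter> B)"
    using A B by linarith
  then show ?thesis
    by simp
qed

text \<open>Toggling one element of \<open>u\<close> in \<open>x\<close> reverses every sign, so for
  nonempty \<open>u\<close> the sum equals its own negative: a nontrivial character sums to
  zero.\<close>

lemma sum_Pow_sign:
  assumes "finite E" "u \<subseteq> E"
  shows "(\<Sum>x\<in>Pow E. (-1 :: int) ^ card (u \<inter> x)) = (if u = {} then 2 ^ card E else 0)"
proof (cases "u = {}")
  case True
  then show ?thesis
    using assms by (simp add: card_Pow)
next
  case False
  then obtain e where e: "e \<in> u" by blast
  define t where "t x = sym_diff x {e}" for x
  have tt: "t (t x) = x" for x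
    by (auto simp: t_def)
  have "(\<Sum>x\<in>Pow E. (-1 :: int) ^ card (u \<inter> x)) = (\<Sum>x\<in>Pow E. (-1) ^ card (u \<inter> t x))"
    using e assms by (intro sum.reindex_bij_witness[of _ t t]) (simp_all add: tt, auto simp: t_def)
  also have "\<dots> = (\<Sum>x\<in>Pow E. - ((-1) ^ card (u \<inter> x)))"
  proof (intro sum.cong refl)
    fix x assume "x \<in> Pow E"
    have "u \<inter> t x = sym_diff (u \<inter> x) {e}"
      using e by (auto simp: t_def)
    then have "even (card (u \<inter> t x)) \<longleftrightarrow> odd (card (u \<inter> x))"
      using card_sym_diff_parity[of "u \<inter> x" "{e}"] assms finite_subset[of u E] by auto
    then show "(-1 :: int) ^ card (u \<inter> t x) = - ((-1) ^ card (u \<inter> x))"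
      by (cases "even (card (u \<inter> x))") (auto simp: uminus_power_if)
  qed
  also have "\<dots> = - (\<Sum>x\<in>Pow E. (-1) ^ card (u \<inter> x))"
    by (simp add: sum_negf)
  finally show ?thesis
    using False by simp
qed

text \<open>
  Orthogonal subspaces of the space of subsets of E over the field with two elements, by summing
  the characters of U over all subsets of E.
\<close>

lemma card_orthogonal_le:
  assumes E: "finite E" and U: "U \<subseteq> Pow E" "U \<noteq> {}" "\<And>S T. S \<in> U \<Longrightarrow> T \<in> U \<Longrightarrow> sym_diff S T \<in> U"
    and B: "B \<subseteq> Pow E" and orth: "\<And>u b. u \<in> U \<Longrightarrow> b \<in> B \<Longrightarrow> even (card (u \<inter> b))"
  shows "card U * card B \<le> 2 ^ card E"
proof -
  have fin: "finite U" "finite B"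
    using E U(1) B by (auto intro: finite_subset)
  have "{} \<in> U"
    using U(2,3) by fastforce
  let ?s = "\<lambda>u x. (-1 :: int) ^ card (u \<inter> x)"
  have "(\<Sum>u\<in>U. \<Sum>x\<in>Pow E. ?s u x) = (\<Sum>u\<in>U. if u = {} then 2 ^ card E else 0)"
    using U(1) E by (intro sum.cong refl sum_Pow_sign) auto
  also have "\<dots> = 2 ^ card E"
    using fin \<open>{} \<in> U\<close> by simp
  finally have total: "(\<Sum>x\<in>Pow E. \<Sum>u\<in>U. ?s u x) = 2 ^ card E"
    by (subst sum.swap)
  \<comment> \<open>A character of \<open>U\<close> sums to \<open>card U\<close> if it is trivial
    and to 0 otherwise; in the second case, translating by an element \<open>v\<close> with odd
    intersection reverses every sign.\<close>
  have nonneg: "0 \<le> (\<Sum>u\<in>U. ?s u x)" if x: "x \<in> Pow E" for x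
  proof (cases "\<forall>u\<in>U. even (card (u \<inter> x))")
    case True
    then show ?thesis by (intro sum_nonneg) auto
  next
    case False
    then obtain v where v: "v \<in> U" "odd (card (v \<inter> x))" by blast
    define t where "t u = sym_diff u v" for u
    have tt: "t (t u) = u" for u
      by (auto simp: t_def)
    have "(\<Sum>u\<in>U. ?s u x) = (\<Sum>u\<in>U. ?s (t u) x)"
      using U(3) v(1) by (intro sum.reindex_bij_witness[of _ t t]) (simp_all add: tt, simp_all add: t_def)
    also have "\<dots> = (\<Sum>u\<in>U. - ?s u x)"
    proof (intro sum.cong refl)
      fix u assume u: "u \<in> U"
      have "t u \<inter> x = sym_diff (u \<inter> x) (v \<inter> x)"
        by (auto simp: t_def)
      moreover have "finite u" "finite v"
        using u v U(1) E by (auto intro: finite_subset)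
      ultimately have "even (card (t u \<inter> x)) \<longleftrightarrow> odd (card (u \<inter> x))"
        using card_sym_diff_parity[of "u \<inter> x" "v \<inter> x"] v(2) by auto
      then show "?s (t u) x = - ?s u x"
        by (cases "even (card (u \<inter> x))") (auto simp: uminus_power_if)
    qed
    also have "\<dots> = - (\<Sum>u\<in>U. ?s u x)"
      by (simp add: sum_negf)
    finally show ?thesis by simp
  qed
  \<comment> \<open>Every element of \<open>B\<close> gives the trivial character and so contributes
    \<open>card U\<close>; by nonnegativity these contributions are at most the total
    \<open>2 ^ card E\<close>.\<close>
  have "int (card U * card B) = (\<Sum>x\<in>B. int (card U))"
    by simp
  also have "\<dots> = (\<Sum>x\<in>B. \<Sum>u\<in>U. ?s u x)"
  proof (intro sum.cong refl)
    fix x assume "x \<in> B"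
    then have "(\<Sum>u\<in>U. ?s u x) = (\<Sum>u\<in>U. 1)"
      using orth by (intro sum.cong refl) simp
    then show "int (card U) = (\<Sum>u\<in>U. ?s u x)"
      by simp
  qed
  also have "\<dots> \<le> (\<Sum>x\<in>Pow E. \<Sum>u\<in>U. ?s u x)"
    using B E nonneg by (intro sum_mono2) auto
  finally show ?thesis
    using total by (simp flip: of_nat_le_iff[where ?'a = int])
qed

text \<open>Rank and nullity as an inequality: translating by a fixed \<open>T\<close> embeds each
  fibre of \<open>F\<close> into the kernel. \<open>K\<close> may be any finite set containing the
  kernel, so only an upper bound for the kernel has to be known.\<close>

lemma card_le_card_image_kernel:
  assumes X: "finite Y" "\<And>S T. S \<in> Y \<Longrightarrow> T \<in> Y \<Longrightarrow> sym_diff S T \<in> Y"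
    and F: "\<And>S T. S \<in> Y \<Longrightarrow> T \<in> Y \<Longrightarrow> F (sym_diff S T) = sym_diff (F S) (F T)"
    and K: "finite K" "\<And>S. S \<in> Y \<Longrightarrow> F S = {} \<Longrightarrow> S \<in> K"
  shows "card Y \<le> card (F ` Y) * card K"
proof -
  have fibre: "card {S \<in> Y. F S = b} \<le> card K" if b: "b \<in> F ` Y" for b
  proof -
    obtain T where T: "T \<in> Y" "F T = b"
      using b by blast
    show ?thesis
    proof (rule card_inj_on_le[OF _ _ K(1)])
      show "inj_on (\<lambda>S. sym_diff S T) {S \<in> Y. F S = b}"
        by (intro inj_on_inverseI[of _ "\<lambda>S. sym_diff S T"]) blast
      show "(\<lambda>S. sym_diff S T) ` {S \<in> Y. F S = b} \<subseteq> K"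
        using T X(2) F by (auto intro!: K(2))
    qed
  qed
  have "card Y = card (\<Union>b\<in>F ` Y. {S \<in> Y. F S = b})"
    by (rule arg_cong[of _ _ card]) blast
  also have "\<dots> \<le> (\<Sum>b\<in>F ` Y. card {S \<in> Y. F S = b})"
    using X(1) by (intro card_UN_le) simp
  also have "\<dots> \<le> card (F ` Y) * card K"
    using sum_bounded_above[of "F ` Y" _ "card K"] fibre by simp
  finally show ?thesis .
qed

text \<open>The functions modulo 2 that are locally constant along \<open>r\<close>, that is, a
  zeroth cohomology group; its dimension is the number of classes
  (\<open>card_closed_subsets\<close>).\<close>

definition closed_subsets :: "'b set \<Rightarrow> ('b \<Rightarrow> 'b \<Rightarrow> bool) \<Rightarrow> 'b set set" where
  "closed_subsets A r = {Y. Y \<subseteq> A \<and> (\<forall>x y. r x y \<longrightarrow> (x \<in> Y \<longleftrightarrow> y \<in> Y))}"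

lemma closed_subsetsD:
  "Y \<in> closed_subsets A r \<Longrightarrow> r x y \<Longrightarrow> x \<in> Y \<longleftrightarrow> y \<in> Y"
  "Y \<in> closed_subsets A r \<Longrightarrow> x \<in> Y \<Longrightarrow> x \<in> A"
  unfolding closed_subsets_def by blast+

lemma finite_closed_subsets: "finite A \<Longrightarrow> finite (closed_subsets A r)"
  by (rule finite_subset[of _ "Pow A"]) (auto simp: closed_subsets_def)

lemma closed_subsets_sym_diff:
  "S \<in> closed_subsets A r \<Longrightarrow> T \<in> closed_subsets A r \<Longrightarrow> sym_diff S T \<in> closed_subsets A r"
  by (auto simp: closed_subsets_def)

lemma equiv_equivclp: "equiv A {(x, y). x \<in> A \<and> y \<in> A \<and> equivclp r x y}"
  by (rule equivI) (auto simp: refl_on_def sym_on_def trans_on_def intro: equivclp_sym equivclp_trans)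

lemma conn_classes_alt: "conn_classes A r = (\<lambda>x. {y \<in> A. equivclp r x y}) ` A"
  by (auto simp: conn_classes_def quotient_def Image_def)

lemma conn_classes_partition:
  "\<Union> (conn_classes A r) = A"
  "C \<in> conn_classes A r \<Longrightarrow> C' \<in> conn_classes A r \<Longrightarrow> x \<in> C \<Longrightarrow> x \<in> C' \<Longrightarrow> C = C'"
  "C \<in> conn_classes A r \<Longrightarrow> C \<noteq> {}"
  using Union_quotient[OF equiv_equivclp[of A r]] quotient_disj[OF equiv_equivclp[of A r]]
    in_quotient_imp_non_empty[OF equiv_equivclp[of A r]]
  unfolding conn_classes_def by blast+

lemma card_closed_subsets:
  assumes "finite A" "\<And>x y. r x y \<Longrightarrow> x \<in> A \<and> y \<in> A"
  shows "card (closed_subsets A r) = 2 ^ card (conn_classes A r)"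
proof -
  have "inj_on \<Union> (Pow (conn_classes A r))"
  proof (rule inj_onI)
    have *: "S \<subseteq> T" if ST: "S \<subseteq> conn_classes A r" "T \<subseteq> conn_classes A r" "\<Union> S \<subseteq> \<Union> T" for S T
    proof
      fix C assume C: "C \<in> S"
      obtain x where x: "x \<in> C"
        using conn_classes_partition(3)[of C A r] C ST by blast
      then obtain C' where "C' \<in> T" "x \<in> C'"
        using C ST by blast
      then show "C \<in> T"
        using conn_classes_partition(2)[of C A r C' x] C ST x by blast
    qed
    fix S T assume "S \<in> Pow (conn_classes A r)" "T \<in> Pow (conn_classes A r)" "\<Union> S = \<Union> T"
    then show "S = T"
      using *[of S T] *[of T S] by auto
  qed
  moreover have "\<Union> ` Pow (conn_classes A r) = closed_subsets A r"
  proof (intro subset_antisym subsetI)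
    fix Y assume "Y \<in> \<Union> ` Pow (conn_classes A r)"
    then obtain S where S: "S \<subseteq> conn_classes A r" "Y = \<Union> S"
      by blast
    have *: "y \<in> Y" if xy: "equivclp r x y" "x \<in> Y" "y \<in> A" for x y
    proof -
      obtain C where C: "C \<in> S" "x \<in> C"
        using xy S by blast
      then have "y \<in> C"
        using S(1) xy by (auto simp: conn_classes_alt intro: equivclp_trans)
      then show ?thesis
        using C S by blast
    qed
    have "Y \<subseteq> A"
      using S conn_classes_partition(1)[of A r] by blast
    then show "Y \<in> closed_subsets A r"
      using * assms(2) unfolding closed_subsets_def by blast
  next
    fix Y assume Y: "Y \<in> closed_subsets A r"
    have inv: "y \<in> Y" if "equivclp r x y" "x \<in> Y" for x y
      using that by (induction rule: equivclp_induct) (use Y in \<open>auto simp: closed_subsets_def\<close>)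
    let ?S = "{C \<in> conn_classes A r. C \<subseteq> Y}"
    have "x \<in> \<Union> ?S" if x: "x \<in> Y" for x
    proof -
      have "x \<in> A"
        using x Y by (auto simp: closed_subsets_def)
      then show ?thesis
        using inv x by (intro UnionI[of "{y \<in> A. equivclp r x y}"]) (auto simp: conn_classes_alt)
    qed
    then have "Y = \<Union> ?S"
      by blast
    then show "Y \<in> \<Union> ` Pow (conn_classes A r)"
      by blast
  qed
  moreover have "finite (conn_classes A r)"
    using assms(1) by (simp add: conn_classes_alt)
  ultimately show ?thesis
    using card_image[of \<Union> "Pow (conn_classes A r)"] by (simp add: card_Pow)
qed

text \<open>
  Every crossing is a source on one strand and a sink on the other one, as in the boundary of the
  black regions of a checkerboard colouring; out x says that the arc points out of its end x into
  the crossing.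
\<close>

definition source_sink :: "'a diagram \<Rightarrow> (nat \<times> nat \<Rightarrow> bool) \<Rightarrow> bool" where
  "source_sink D out \<longleftrightarrow> (\<forall>(c, k) \<in> ends D. out (c, (k + 1) mod 4) \<noteq> out (c, k))
     \<and> (\<forall>x y. same_arc D x y \<longrightarrow> out x \<noteq> out y)"

definition twin :: "'a diagram \<Rightarrow> nat \<times> nat \<Rightarrow> nat \<times> nat" where
  "twin D x = (THE y. same_arc D x y)"

definition next_end :: "nat \<times> nat \<Rightarrow> nat \<times> nat" where
  "next_end x = (fst x, (snd x + 1) mod 4)"

lemma finite_ends [simp]: "finite (ends D)"
  by (simp add: ends_def)

lemma next_end_in_ends: "x \<in> ends D \<Longrightarrow> next_end x \<in> ends D"
  by (auto simp: next_end_def ends_def)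

lemma inj_next_end: "inj_on next_end (ends D)"
proof -
  have "(k + 1) mod 4 = (if k = 3 then 0 else k + 1)" if "k < 4" for k :: nat
    using that by auto
  then show ?thesis
    by (auto simp: inj_on_def next_end_def ends_def split: if_splits)
qed

context
  fixes D :: "'a diagram"
  assumes link: "link_diagram D"
begin

abbreviation "end_arc x \<equiv> arc_at D (fst x) (snd x)"

lemma end_arc_in_arcs: "x \<in> ends D \<Longrightarrow> end_arc x \<in> arcs D"
  using link by (auto simp: link_diagram_def)

lemma same_arc_ex1:
  assumes x: "x \<in> ends D"
  shows "\<exists>!y. same_arc D x y"
proof -
  define A where "A = {(c, k) \<in> ends D. arc_at D c k = end_arc x}"
  have A: "z \<in> A \<longleftrightarrow> z \<in> ends D \<and> end_arc z = end_arc x" for z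
    by (auto simp: A_def)
  have "finite A"
    by (rule finite_subset[OF _ finite_ends[of D]]) (auto simp: A)
  then have "card A \<noteq> 0"
    using x A[of x] by auto
  moreover have "card A \<in> {0, 2}"
    unfolding A_def using link end_arc_in_arcs[OF x] unfolding link_diagram_def by blast
  ultimately obtain u v where uv: "A = {u, v}" "u \<noteq> v"
    by (auto simp: card_2_iff)
  have "x = u \<or> x = v"
    using x A[of x] uv(1) by simp
  then obtain y where y: "A = {x, y}" "y \<noteq> x"
    using uv by (metis insert_commute)
  have "same_arc D x z \<longleftrightarrow> z \<in> A - {x}" for z
    using x A[of z] by (auto simp: same_arc_def)
  then show ?thesis
    using y by (auto intro!: ex1I[of _ y])
qed

lemma same_arc_twin: "x \<in> ends D \<Longrightarrow> same_arc D x (twin D x)"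
  unfolding twin_def by (rule theI'[OF same_arc_ex1])

lemma twin_unique: "same_arc D x y \<Longrightarrow> twin D x = y"
  unfolding twin_def by (rule the1_equality[OF same_arc_ex1]) (auto simp: same_arc_def)

lemma twin_in_ends: "x \<in> ends D \<Longrightarrow> twin D x \<in> ends D"
  and twin_neq: "x \<in> ends D \<Longrightarrow> twin D x \<noteq> x"
  and end_arc_twin: "x \<in> ends D \<Longrightarrow> end_arc (twin D x) = end_arc x"
  using same_arc_twin[of x] by (auto simp: same_arc_def)

lemma twin_twin: "x \<in> ends D \<Longrightarrow> twin D (twin D x) = x"
  using same_arc_twin[of x] by (intro twin_unique) (auto simp: same_arc_def)

lemma end_arc_eqD:
  "x \<in> ends D \<Longrightarrow> y \<in> ends D \<Longrightarrow> end_arc x = end_arc y \<Longrightarrow> y = x \<or> y = twin D x"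
  using twin_unique[of x y] by (auto simp: same_arc_def)

text \<open>\<open>H\<close> is a function modulo 2 on the ends, and an arc is selected if the
  values at its two ends differ or, with \<open>t\<close> set, if they agree; so \<open>t\<close>
  adds the cochain that is constantly one. If \<open>H\<close> is read as a set of corners, the
  corners named by \<open>x\<close> and \<open>twin D x\<close> are the two sides of the arc, and
  \<open>coboundary H False\<close> is the boundary of the region \<open>H\<close>.\<close>

definition coboundary :: "(nat \<times> nat) set \<Rightarrow> bool \<Rightarrow> 'a set" where
  "coboundary H t = end_arc ` {x \<in> ends D. ((x \<in> H) \<noteq> (twin D x \<in> H)) \<noteq> t}"

lemma coboundary_iff:
  assumes "x \<in> ends D"
  shows "end_arc x \<in> coboundary H t \<longleftrightarrow> ((x \<in> H) \<noteq> (twin D x \<in> H)) \<noteq> t"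
proof
  assume "end_arc x \<in> coboundary H t"
  then obtain y where y: "y \<in> ends D" "end_arc x = end_arc y" "((y \<in> H) \<noteq> (twin D y \<in> H)) \<noteq> t"
    by (auto simp: coboundary_def)
  have "y = x \<or> y = twin D x"
    by (rule end_arc_eqD[OF assms y(1,2)])
  then show "((x \<in> H) \<noteq> (twin D x \<in> H)) \<noteq> t"
    using y(3) twin_twin[OF assms] by (elim disjE) auto
qed (use assms in \<open>auto simp: coboundary_def\<close>)

lemma coboundary_subset: "coboundary H t \<subseteq> end_arc ` ends D"
  by (auto simp: coboundary_def)

lemma coboundary_sym_diff:
  "coboundary (sym_diff H H') (t \<noteq> t') = sym_diff (coboundary H t) (coboundary H' t')" (is "?L = ?R")
proof -
  have "end_arc x \<in> ?L \<longleftrightarrow> end_arc x \<in> ?R" if "x \<in> ends D" for x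
    unfolding Un_iff Diff_iff coboundary_iff[OF that] by blast
  moreover have "?L \<subseteq> end_arc ` ends D" "?R \<subseteq> end_arc ` ends D"
    using coboundary_subset by blast+
  ultimately show ?thesis
    by blast
qed

lemma crossing_arcs_alt: "crossing_arcs D = end_arc ` ends D"
  using end_arc_in_arcs by (force simp: crossing_arcs_def)

definition face_step :: "nat \<times> nat \<Rightarrow> nat \<times> nat \<Rightarrow> bool" where
  "face_step x y \<longleftrightarrow> x \<in> ends D \<and> y = twin D (next_end x)"

lemma face_step_in_ends: "face_step x y \<Longrightarrow> x \<in> ends D \<and> y \<in> ends D"
  by (auto simp: face_step_def intro: twin_in_ends next_end_in_ends)

text \<open>
  The relation in the definition of faces also relates pairs outside of ends D, which only
  duplicate their reductions modulo 4.
\<close>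

lemma faces_alt: "faces D = conn_classes (ends D) face_step"
proof -
  let ?r = "\<lambda>x y. same_arc D (fst x, (snd x + 1) mod 4) y"
  let ?m = "\<lambda>x. (fst x, snd x mod 4)"
  have m: "?m x = x" if "x \<in> ends D" for x
    using that by (auto simp: ends_def)
  have step: "face_step x y \<longleftrightarrow> ?r x y" if "x \<in> ends D" for x y
    using same_arc_twin[OF next_end_in_ends[OF that]] twin_unique[of "next_end x" y] that
    by (auto simp: face_step_def next_end_def)
  have rm: "face_step (?m x) (?m y)" if "?r x y" for x y
  proof -
    have "?m x \<in> ends D" "y \<in> ends D"
      using that by (auto simp: same_arc_def ends_def)
    then show ?thesis
      using that step[of "?m x" y] m by (simp add: mod_simps)
  qed
  have "equivclp ?r x y \<longleftrightarrow> equivclp face_step x y" if x: "x \<in> ends D" and y: "y \<in> ends D" for x y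
  proof
    assume "equivclp face_step x y"
    then show "equivclp ?r x y"
    proof (induction rule: equivclp_induct)
      case (step y z)
      then have "?r y z \<or> ?r z y"
        using \<open>\<And>x y. x \<in> ends D \<Longrightarrow> face_step x y \<longleftrightarrow> ?r x y\<close> face_step_in_ends by metis
      then show ?case
        using step.IH by (rule equivclp_into_equivclp[rotated])
    qed simp
  next
    assume "equivclp ?r x y"
    then have "equivclp face_step (?m x) (?m y)"
    proof (induction rule: equivclp_induct)
      case (step y z)
      then have "face_step (?m y) (?m z) \<or> face_step (?m z) (?m y)"
        using rm[of y z] rm[of z y] by (elim disjE) simp_all
      then show ?case
        by (rule equivclp_into_equivclp[OF step.IH])
    qed simp
    then show "equivclp face_step x y"
      using m x y by simp
  qed
  note eq = this
  show ?thesis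
    unfolding faces_def conn_classes_alt
    by (intro image_cong Collect_cong conj_cong refl) (rule eq)
qed

definition component_step :: "nat \<Rightarrow> nat \<Rightarrow> bool" where
  "component_step c c' \<longleftrightarrow> (\<exists>k k'. same_arc D (c, k) (c', k'))"

lemma component_step_less: "component_step c c' \<Longrightarrow> c \<in> {..<ncross D} \<and> c' \<in> {..<ncross D}"
  by (auto simp: component_step_def same_arc_def ends_def)

lemma crossing_components_alt: "crossing_components D = conn_classes {..<ncross D} component_step"
  by (simp add: crossing_components_def component_step_def[abs_def])

text \<open>
  The number ncross D is not a crossing; its membership in W encodes whether the cochain is twisted
  by the parity of the ends.
\<close>

definition crossing_cochain :: "nat set \<Rightarrow> (nat \<times> nat) set" where
  "crossing_cochain W = {x \<in> ends D. (fst x \<in> W) \<noteq> (ncross D \<in> W \<and> odd (snd x))}"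

lemma crossing_cochain_next_end:
  assumes "x \<in> ends D"
  shows "next_end x \<in> crossing_cochain W \<longleftrightarrow> (x \<in> crossing_cochain W) \<noteq> (ncross D \<in> W)"
proof -
  have "odd ((k + 1) mod 4) \<longleftrightarrow> even k" for k :: nat
    by presburger
  then show ?thesis
    using assms next_end_in_ends[OF assms]
    by (auto simp: crossing_cochain_def next_end_def)
qed

text \<open>Without \<open>ncross D\<close> in \<open>W\<close> this is the cut formed by the arcs
  leaving \<open>W\<close>. With it, the cochain alternates around each crossing, and the selected
  arcs are those whose ends fail to be opposite; if there are none, the cochain is a source-sink
  orientation.\<close>

definition crossing_coboundary :: "nat set \<Rightarrow> 'a set" where
  "crossing_coboundary W = coboundary (crossing_cochain W) (ncross D \<in> W)"

lemma crossing_coboundary_sym_diff: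
  "crossing_coboundary (sym_diff W W') = sym_diff (crossing_coboundary W) (crossing_coboundary W')"
proof -
  have 1: "crossing_cochain (sym_diff W W') = sym_diff (crossing_cochain W) (crossing_cochain W')"
    by (auto simp: crossing_cochain_def)
  have 2: "(ncross D \<in> sym_diff W W') = ((ncross D \<in> W) \<noteq> (ncross D \<in> W'))"
    by blast
  show ?thesis
    unfolding crossing_coboundary_def 1 2 by (rule coboundary_sym_diff)
qed

text \<open>Corners and arcs alternate around a face. Each corner changes the cochain by the twist
  and each arc compares its ends up to the same twist, so the twists cancel and the differences
  telescope to zero modulo 2.\<close>

lemma card_coboundary_orthogonal:
  assumes Y: "Y \<in> closed_subsets (ends D) face_step"
  shows "even (card (crossing_coboundary W \<inter> coboundary Y False))"
proof -
  define H t where "H = crossing_cochain W" and "t = (ncross D \<in> W)"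
  have Yends: "Y \<subseteq> ends D"
    using Y by (auto simp: closed_subsets_def)
  have finY: "finite S" if "S \<subseteq> Y" for S
    using that Yends finite_subset[OF _ finite_ends] by blast
  \<comment> \<open>Selected arcs are counted by their sides lying in \<open>Y\<close>: an arc with
    both sides there is counted twice (\<open>P1\<close>), and those with just one side there
    (\<open>P2\<close>) form the intersection with the boundary of \<open>Y\<close>.\<close>
  define P where "P = {x \<in> Y. ((x \<in> H) \<noteq> (twin D x \<in> H)) \<noteq> t}"
  define P1 where "P1 = {x \<in> P. twin D x \<in> Y}"
  define P2 where "P2 = {x \<in> P. twin D x \<notin> Y}"
  have ends: "x \<in> P \<Longrightarrow> x \<in> ends D" for x
    using Yends by (auto simp: P_def)
  have "even (card P1)"
  proof (rule even_card_fixpoint_free_involution)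
    show "finite P1"
      by (rule finY) (auto simp: P1_def P_def)
    fix x assume x: "x \<in> P1"
    then have xe: "x \<in> ends D"
      using ends by (simp add: P1_def)
    show "twin D (twin D x) = x" "twin D x \<noteq> x"
      using twin_twin[OF xe] twin_neq[OF xe] .
    then show "twin D x \<in> P1"
      using x by (simp add: P1_def P_def) blast
  qed
  have "crossing_coboundary W \<inter> coboundary Y False = end_arc ` P2"
  proof (intro subset_antisym subsetI)
    fix a assume a: "a \<in> crossing_coboundary W \<inter> coboundary Y False"
    then obtain x where x: "x \<in> ends D" "a = end_arc x" "(x \<in> Y) \<noteq> (twin D x \<in> Y)"
      by (auto simp: coboundary_def)
    have "((x \<in> H) \<noteq> (twin D x \<in> H)) \<noteq> t"
      using a coboundary_iff[OF x(1)] by (simp add: x(2) crossing_coboundary_def H_def t_def)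
    then have "x \<in> P2 \<or> twin D x \<in> P2"
      using x twin_twin[OF x(1)] by (auto simp: P2_def P_def)
    then show "a \<in> end_arc ` P2"
    proof (elim disjE)
      assume "twin D x \<in> P2"
      then show ?thesis
        by (rule image_eqI[rotated]) (simp add: end_arc_twin[OF x(1)] x(2))
    qed (simp add: x(2))
  next
    fix a assume "a \<in> end_arc ` P2"
    then obtain x where x: "x \<in> P2" "a = end_arc x"
      by blast
    then have "x \<in> ends D"
      using ends by (auto simp: P2_def)
    then show "a \<in> crossing_coboundary W \<inter> coboundary Y False"
      using x coboundary_iff[of x]
      by (auto simp: crossing_coboundary_def P2_def P_def H_def t_def)
  qed
  moreover have "inj_on end_arc P2"
  proof (rule inj_onI)
    fix x y assume xy: "x \<in> P2" "y \<in> P2" "end_arc x = end_arc y"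
    then have "y = x \<or> y = twin D x"
      using end_arc_eqD ends by (auto simp: P2_def)
    then show "x = y"
      using xy by (auto simp: P2_def P_def)
  qed
  ultimately have c2: "card (crossing_coboundary W \<inter> coboundary Y False) = card P2"
    by (simp add: card_image)
  \<comment> \<open>\<open>P\<close> is the sum modulo 2 of \<open>S\<close>, the values at the near
    ends, and \<open>T\<close>, the twisted values at the far ends. The face step maps
    \<open>S\<close> bijectively to \<open>T\<close>, so \<open>P\<close> has even size.\<close>
  define S T where "S = {x \<in> Y. x \<in> H}" and "T = {x \<in> Y. (twin D x \<in> H) \<noteq> t}"
  let ?f = "\<lambda>x. twin D (next_end x)"
  have step: "?f x \<in> Y \<longleftrightarrow> x \<in> Y" if "x \<in> ends D" for x
    using closed_subsetsD(1)[OF Y, of x "?f x"] that by (simp add: face_step_def)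
  have inj: "inj_on ?f (ends D)"
  proof (rule inj_onI)
    fix x y assume xy: "x \<in> ends D" "y \<in> ends D" "?f x = ?f y"
    then have "next_end x = next_end y"
      using twin_twin next_end_in_ends by metis
    then show "x = y"
      using inj_onD[OF inj_next_end] xy by blast
  qed
  have surj: "?f ` ends D = ends D"
    by (rule card_subset_eq[OF finite_ends image_subsetI card_image[OF inj]])
      (rule twin_in_ends[OF next_end_in_ends])
  have "T = ?f ` S"
  proof (intro subset_antisym subsetI)
    fix y assume y: "y \<in> T"
    then have "y \<in> ?f ` ends D"
      using Yends unfolding surj T_def by blast
    then obtain x where x: "x \<in> ends D" "y = ?f x"
      by blast
    then show "y \<in> ?f ` S"
      using y step[OF x(1)] crossing_cochain_next_end[OF x(1)] twin_twin[OF next_end_in_ends[OF x(1)]]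
      by (auto simp: S_def T_def H_def t_def)
  next
    fix y assume "y \<in> ?f ` S"
    then obtain x where x: "x \<in> S" "y = ?f x"
      by blast
    then have xe: "x \<in> ends D"
      using Yends by (auto simp: S_def)
    show "y \<in> T"
      using x step[OF xe] crossing_cochain_next_end[OF xe] twin_twin[OF next_end_in_ends[OF xe]]
      by (auto simp: S_def T_def H_def t_def)
  qed
  moreover have "inj_on ?f S"
    by (rule inj_on_subset[OF inj]) (use Yends in \<open>auto simp: S_def\<close>)
  ultimately have "card T = card S"
    by (simp add: card_image)
  moreover have "P = sym_diff S T"
    by (auto simp: P_def S_def T_def)
  ultimately have "even (card P)"
    using card_sym_diff_parity[of S T] finY[of S] finY[of T] by (auto simp: S_def T_def)
  moreover have "card P = card P1 + card P2"
  proof -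
    have "P = P1 \<union> P2" "P1 \<inter> P2 = {}" "P1 \<subseteq> Y" "P2 \<subseteq> Y"
      by (auto simp: P1_def P2_def P_def)
    then show ?thesis
      using card_Un_disjoint[of P1 P2] finY by simp
  qed
  ultimately show ?thesis
    using c2 \<open>even (card P1)\<close> by simp
qed

lemma end_crossing_in_all:
  assumes "\<And>x. x \<in> ends D \<Longrightarrow> next_end x \<in> Y \<longleftrightarrow> x \<in> Y" "c < ncross D" "k < 4"
  shows "(c, k) \<in> Y \<longleftrightarrow> (c, 0) \<in> Y"
  using assms(3)
proof (induction k)
  case (Suc k)
  then have "(c, k) \<in> ends D" "next_end (c, k) = (c, Suc k)"
    using assms(2) by (auto simp: ends_def next_end_def)
  then show ?case
    using assms(1)[of "(c, k)"] Suc by simp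
qed simp

text \<open>
  Euler's formula makes the face boundaries span all cycles modulo 2; hence the cochain that
  obstructs a source-sink orientation, being orthogonal to them, is a coboundary.
\<close>

theorem planar_source_sink: "\<exists>out. source_sink D out"
proof (rule ccontr)
  assume no: "\<nexists>out. source_sink D out"
  let ?V = "{..<ncross D}" and ?W = "Pow {..ncross D}" and ?E = "end_arc ` ends D"
  let ?F = "closed_subsets (ends D) face_step" and ?K = "closed_subsets ?V component_step"
  let ?c = "card (crossing_components D)"
  have K: "card ?K = 2 ^ ?c" "finite ?K"
    unfolding crossing_components_alt
    using card_closed_subsets[of ?V component_step] component_step_less
    by (simp_all add: finite_closed_subsets)
  have F: "card ?F = 2 ^ card (faces D)"
    unfolding faces_alt using card_closed_subsets[of "ends D" face_step] face_step_in_ends by simp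
  \<comment> \<open>The kernel of \<open>crossing_coboundary\<close>: an element containing the
    twist would be an orientation, which is excluded by assumption, and the others are constant on
    components.\<close>
  have "W \<in> ?K" if W: "W \<in> ?W" "crossing_coboundary W = {}" for W
  proof -
    have cocycle: "((x \<in> crossing_cochain W) \<noteq> (twin D x \<in> crossing_cochain W)) = (ncross D \<in> W)"
      if "x \<in> ends D" for x
      using coboundary_iff[OF that] W(2) unfolding crossing_coboundary_def by auto
    have nW: "ncross D \<notin> W"
    proof
      assume "ncross D \<in> W"
      then have "source_sink D (\<lambda>x. x \<in> crossing_cochain W)"
        using cocycle crossing_cochain_next_end[of _ W] twin_unique
        by (fastforce simp: source_sink_def next_end_def same_arc_def)
      then show False
        using no by blast
    qed
    have "c \<in> W \<longleftrightarrow> c' \<in> W" if "component_step c c'" for c c'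
    proof -
      obtain k k' where k: "same_arc D (c, k) (c', k')"
        using \<open>component_step c c'\<close> by (auto simp: component_step_def)
      then have "(c, k) \<in> ends D" "(c', k') \<in> ends D"
        by (auto simp: same_arc_def)
      then show ?thesis
        using cocycle[of "(c, k)"] twin_unique[OF k] nW by (auto simp: crossing_cochain_def)
    qed
    moreover have "W \<subseteq> ?V"
      using W(1) nW by (force simp: order.order_iff_strict)
    ultimately show ?thesis
      by (auto simp: closed_subsets_def)
  qed
  then have "card ?W \<le> card (crossing_coboundary ` ?W) * card ?K"
    using K by (intro card_le_card_image_kernel crossing_coboundary_sym_diff) auto
  then have 1: "2 ^ (ncross D + 1) \<le> card (crossing_coboundary ` ?W) * 2 ^ ?c"
    using K by (simp add: card_Pow)
  \<comment> \<open>A region with empty boundary contains all or none of the corners of each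
    component, so the kernel is indexed by unions of components.\<close>
  let ?L = "(\<lambda>W. {x \<in> ends D. fst x \<in> W}) ` ?K"
  have "Y \<in> ?L" if Y: "Y \<in> ?F" "coboundary Y False = {}" for Y
  proof -
    have tw: "twin D x \<in> Y \<longleftrightarrow> x \<in> Y" if "x \<in> ends D" for x
      using coboundary_iff[OF that] Y(2) by auto
    have st: "twin D (next_end x) \<in> Y \<longleftrightarrow> x \<in> Y" if "x \<in> ends D" for x
      using closed_subsetsD(1)[OF Y(1), of x "twin D (next_end x)"] that by (simp add: face_step_def)
    have "next_end x \<in> Y \<longleftrightarrow> x \<in> Y" if "x \<in> ends D" for x
      using st[OF that] tw[OF next_end_in_ends[OF that]] by simp
    note k0 = end_crossing_in_all[OF this]
    let ?w = "{c \<in> ?V. (c, 0) \<in> Y}"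
    have "Y = {x \<in> ends D. fst x \<in> ?w}"
    proof -
      have "x \<in> Y \<longleftrightarrow> fst x \<in> ?w" if "x \<in> ends D" for x
        using k0[of "fst x" "snd x"] that by (auto simp: ends_def)
      then show ?thesis
        using closed_subsetsD(2)[OF Y(1)] by blast
    qed
    moreover have "?w \<in> ?K"
    proof -
      have "(c, 0) \<in> Y \<longleftrightarrow> (c', 0) \<in> Y" if "component_step c c'" for c c'
      proof -
        obtain k k' where k: "same_arc D (c, k) (c', k')"
          using \<open>component_step c c'\<close> by (auto simp: component_step_def)
        then have "c < ncross D" "k < 4" "c' < ncross D" "k' < 4" "(c, k) \<in> ends D"
          by (auto simp: same_arc_def ends_def)
        then show ?thesis
          using tw[of "(c, k)"] twin_unique[OF k] k0[of c k] k0[of c' k'] by simp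
      qed
      then show ?thesis
        using component_step_less by (fastforce simp: closed_subsets_def)
    qed
    ultimately show ?thesis
      by blast
  qed
  then have "card ?F \<le> card ((\<lambda>Y. coboundary Y False) ` ?F) * card ?L"
    using K coboundary_sym_diff[of _ _ False False]
    by (intro card_le_card_image_kernel closed_subsets_sym_diff finite_closed_subsets) auto
  also have "\<dots> \<le> card ((\<lambda>Y. coboundary Y False) ` ?F) * 2 ^ ?c"
    by (intro mult_le_mono2) (rule order.trans[OF card_image_le[OF K(2)]], simp add: K(1))
  finally have 2: "2 ^ card (faces D) \<le> card ((\<lambda>Y. coboundary Y False) ` ?F) * 2 ^ ?c"
    unfolding F .
  have 3: "card (crossing_coboundary ` ?W) * card ((\<lambda>Y. coboundary Y False) ` ?F) \<le> 2 ^ card ?E"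
  proof (rule card_orthogonal_le)
    show "sym_diff S T \<in> crossing_coboundary ` ?W"
      if ST: "S \<in> crossing_coboundary ` ?W" "T \<in> crossing_coboundary ` ?W" for S T
    proof -
      obtain W W' where "W \<in> ?W" "W' \<in> ?W" "S = crossing_coboundary W" "T = crossing_coboundary W'"
        using ST by blast
      then show ?thesis
        using crossing_coboundary_sym_diff[of W W'] by (intro image_eqI[of _ _ "sym_diff W W'"]) auto
    qed
  qed (use coboundary_subset card_coboundary_orthogonal in \<open>auto simp: crossing_coboundary_def\<close>)
  \<comment> \<open>The summand 1 in the exponent is the dimension of the twist; it is exactly what
    Euler's formula leaves no room for.\<close>
  have "(2 :: nat) ^ (ncross D + 1 + card (faces D))
      \<le> (card (crossing_coboundary ` ?W) * 2 ^ ?c) * (card ((\<lambda>Y. coboundary Y False) ` ?F) * 2 ^ ?c)"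
    unfolding power_add[of _ "ncross D + 1"] by (rule mult_le_mono[OF 1 2])
  also have "\<dots> \<le> 2 ^ card ?E * (2 ^ ?c * 2 ^ ?c)"
    using mult_le_mono1[OF 3, of "2 ^ ?c * 2 ^ ?c"] by (simp add: mult.assoc mult.left_commute)
  also have "\<dots> = 2 ^ (card ?E + 2 * ?c)"
    by (simp add: power_add mult_2)
  finally have "ncross D + 1 + card (faces D) \<le> card ?E + 2 * ?c"
    by (rule power_le_imp_le_exp[rotated]) simp
  moreover have "int (ncross D) - int (card ?E) + int (card (faces D)) = 2 * int ?c"
    using link by (simp add: link_diagram_def planar_def crossing_arcs_alt)
  ultimately show False
    by linarith
qed

end

section \<open>Splitting and merging of circles\<close>

lemma funpow_in: "f ` S \<subseteq> S \<Longrightarrow> x \<in> S \<Longrightarrow> (f ^^ n) x \<in> S"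
  by (induction n) auto

lemma funpow_returns:
  assumes "finite S" "f ` S \<subseteq> S" "inj_on f S" "x \<in> S"
  obtains m where "0 < m" "(f ^^ m) x = x"
proof -
  have inj: "inj_on (f ^^ n) S" for n
  proof (induction n)
    case (Suc n)
    have "inj_on f ((f ^^ n) ` S)"
      using funpow_in[OF assms(2)] by (intro inj_on_subset[OF assms(3)]) blast
    then show ?case
      using comp_inj_on[OF Suc, of f] by (simp add: comp_def)
  qed simp
  have "\<not> inj (\<lambda>n. (f ^^ n) x)"
  proof
    assume "inj (\<lambda>n. (f ^^ n) x)"
    moreover have "finite (range (\<lambda>n. (f ^^ n) x))"
      by (rule finite_subset[OF _ assms(1)]) (use funpow_in[OF assms(2,4)] in blast)
    ultimately show False
      using finite_imageD by auto
  qed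
  then obtain i j where ij: "i < j" "(f ^^ i) x = (f ^^ j) x"
    by (metis injI linorder_neqE_nat)
  have "(f ^^ j) x = (f ^^ i) ((f ^^ (j - i)) x)"
    using ij(1) by (simp flip: comp_apply[of "f ^^ i"] funpow_add)
  then have "(f ^^ (j - i)) x = x"
    using inj_onD[OF inj[of i], of "(f ^^ (j - i)) x" x] ij(2) funpow_in[OF assms(2,4)] assms(4)
    by simp
  then show ?thesis
    using that[of "j - i"] ij(1) by simp
qed

lemma funpow_orbit_sym:
  assumes "finite S" "f ` S \<subseteq> S" "inj_on f S" "x \<in> S" "(f ^^ n) x = y"
  obtains k where "(f ^^ k) y = x"
proof -
  obtain m where m: "0 < m" "(f ^^ m) x = x"
    by (rule funpow_returns[OF assms(1-4)])
  \<comment> \<open>The multiple \<open>n * m\<close> of the return time \<open>m\<close> brings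
    \<open>x\<close> back and is at least \<open>n\<close>, so \<open>n * m - n\<close> further
    steps lead from \<open>y\<close> to \<open>x\<close>.\<close>
  define k where "k = n * m - n"
  have "n \<le> n * m"
    using m(1) by simp
  then have "(f ^^ k) y = (f ^^ (n * m)) x"
    unfolding assms(5)[symmetric] k_def by (simp flip: comp_apply[of "f ^^ _"] funpow_add)
  also have "\<dots> = x"
    using funpow_mod_eq[OF m(2), of "n * m"] by simp
  finally show ?thesis
    by (rule that)
qed

text \<open>Composing a permutation with a transposition cuts a cycle or joins two cycles.\<close>

lemma orbit_transposition:
  assumes S: "finite S" and f: "f ` S \<subseteq> S" "inj_on f S" and f': "f' ` S \<subseteq> S" "inj_on f' S"
    and xy: "x \<in> S" "y \<in> S" "x \<noteq> y"
    and swap: "f' x = f y" "f' y = f x" "\<And>z. z \<in> S \<Longrightarrow> z \<noteq> x \<Longrightarrow> z \<noteq> y \<Longrightarrow> f' z = f z"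
  shows "(\<exists>n. (f' ^^ n) x = y) \<longleftrightarrow> \<not> (\<exists>n. (f ^^ n) x = y)"
proof -
  \<comment> \<open>After a common first image the two maps agree for as long as the orbit has not
    met \<open>x\<close> or \<open>y\<close> again.\<close>
  have step: "(f' ^^ j) a = (f ^^ j) b"
    if ab: "f' a = f b" "b \<in> S" "0 < j" "j \<le> n" "\<And>i. 0 < i \<Longrightarrow> i < n \<Longrightarrow> (f ^^ i) b \<notin> {x, y}" for a b j n
    using ab(3,4)
  proof (induction j)
    case (Suc j)
    show ?case
    proof (cases "j = 0")
      case False
      then show ?thesis
        using Suc ab(5)[of j] swap(3)[of "(f ^^ j) b"] funpow_in[OF f(1) ab(2), of j] by simp
    qed (use ab(1) in simp)
  qed simp
  show ?thesis
  proof (cases "\<exists>n. (f ^^ n) x = y")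
    case True
    \<comment> \<open>\<open>n\<close> is the first time at which \<open>f\<close> takes
      \<open>x\<close> to \<open>y\<close>. Under \<open>f'\<close> the point \<open>y\<close> runs
      through this segment and closes up after \<open>n\<close> steps without meeting
      \<open>x\<close>: the cycle is cut.\<close>
    define n where "n = (LEAST n. (f ^^ n) x = y)"
    have n: "(f ^^ n) x = y"
      unfolding n_def using True by (rule LeastI_ex)
    have less: "(f ^^ j) x \<noteq> y" if "j < n" for j
      using not_less_Least[of j "\<lambda>n. (f ^^ n) x = y"] that by (simp add: n_def)
    have "n \<noteq> 0"
      using n xy(3) by (intro notI) simp
    have nx: "(f ^^ j) x \<noteq> x" if "0 < j" "j \<le> n" for j
    proof
      assume "(f ^^ j) x = x"
      moreover have "(f ^^ n) x = (f ^^ (n - j)) ((f ^^ j) x)"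
        using that by (simp flip: comp_apply[of "f ^^ _"] funpow_add)
      ultimately have "(f ^^ (n - j)) x = y"
        using n by simp
      then show False
        using less[of "n - j"] that by simp
    qed
    have eq: "(f' ^^ j) y = (f ^^ j) x" if "0 < j" "j \<le> n" for j
      by (rule step[OF swap(2) xy(1) that]) (use less nx in auto)
    have per: "(f' ^^ n) y = y"
      using eq[of n] n \<open>n \<noteq> 0\<close> by simp
    have no: "(f' ^^ j) y \<noteq> x" for j
    proof -
      have "(f' ^^ (j mod n)) y \<noteq> x"
        using eq[of "j mod n"] nx[of "j mod n"] xy(3) \<open>n \<noteq> 0\<close>
        by (cases "j mod n = 0") (auto simp: less_imp_le)
      then show ?thesis
        using funpow_mod_eq[OF per, of j] by simp
    qed
    have "\<not> (\<exists>k. (f' ^^ k) x = y)"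
      using funpow_orbit_sym[OF S f' xy(1)] no by metis
    then show ?thesis
      using True by simp
  next
    case False
    obtain m0 where m0: "0 < m0" "(f ^^ m0) y = y"
      by (rule funpow_returns[OF S f xy(2)])
    \<comment> \<open>\<open>m\<close> is the period of \<open>y\<close>. Under \<open>f'\<close>
      the point \<open>x\<close> enters the cycle of \<open>y\<close> and reaches \<open>y\<close>
      after \<open>m\<close> steps: the two cycles are joined.\<close>
    define m where "m = (LEAST m. 0 < m \<and> (f ^^ m) y = y)"
    have m: "0 < m" "(f ^^ m) y = y"
      using LeastI[of "\<lambda>m. 0 < m \<and> (f ^^ m) y = y" m0] m0 by (simp_all add: m_def)
    have less: "(f ^^ j) y \<noteq> y" if "0 < j" "j < m" for j
      using not_less_Least[of j "\<lambda>m. 0 < m \<and> (f ^^ m) y = y"] that by (simp add: m_def)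
    have "(f ^^ j) y \<noteq> x" for j
      using funpow_orbit_sym[OF S f xy(2)] False by metis
    then have "(f' ^^ m) x = (f ^^ m) y"
      by (intro step[OF swap(1) xy(2) m(1), of m]) (use less in auto)
    then show ?thesis
      using m(2) False by auto
  qed
qed

text \<open>A positive marker pairs the ends 0, 1 and 2, 3; any other value pairs 1, 2 and 3, 0.
  Adding 3 is the step back modulo 4 on natural numbers.\<close>

definition partner :: "(nat \<Rightarrow> int) \<Rightarrow> nat \<times> nat \<Rightarrow> nat \<times> nat" where
  "partner s x =
     (fst x, if (s (fst x) = 1) = even (snd x) then (snd x + 1) mod 4 else (snd x + 3) mod 4)"

lemma less_4_cases: "k < 4 \<Longrightarrow> k = 0 \<or> k = 1 \<or> k = 2 \<or> k = (3 :: nat)"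
  by auto

lemma partner_in_ends: "x \<in> ends D \<Longrightarrow> partner s x \<in> ends D"
  by (auto simp: partner_def ends_def)

lemma partner_partner: "x \<in> ends D \<Longrightarrow> partner s (partner s x) = x"
  using less_4_cases[of "snd x"] by (cases x) (auto simp: partner_def ends_def)

text \<open>\<open>joined\<close> lists each smoothing strand in its counterclockwise direction
  only; the parity condition selects the end at which that direction begins.\<close>

lemma joined_iff_partner:
  "joined D s a b \<longleftrightarrow> (\<exists>x \<in> ends D. odd (snd x) = (s (fst x) \<noteq> 1)
     \<and> a = arc_at D (fst x) (snd x) \<and> b = arc_at D (fst (partner s x)) (snd (partner s x)))"
proof
  assume "joined D s a b"
  then obtain c where c: "c < ncross D" "if s c = 1
     then a = arc_at D c 0 \<and> b = arc_at D c 1 \<or> a = arc_at D c 2 \<and> b = arc_at D c 3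
     else a = arc_at D c 1 \<and> b = arc_at D c 2 \<or> a = arc_at D c 3 \<and> b = arc_at D c 0"
    unfolding joined_def by (elim exE conjE) (rule that)
  then obtain k where k: "k < 4" "odd k = (s c \<noteq> 1)" "a = arc_at D c k" "b = arc_at D c ((k + 1) mod 4)"
  proof (cases "s c = 1")
    case True
    then show ?thesis
      using c(2) that[of 0] that[of 2] by auto
  next
    case False
    then show ?thesis
      using c(2) that[of 1] that[of 3] by (auto simp flip: numeral_2_eq_2)
  qed
  then show "\<exists>x \<in> ends D. odd (snd x) = (s (fst x) \<noteq> 1)
     \<and> a = arc_at D (fst x) (snd x) \<and> b = arc_at D (fst (partner s x)) (snd (partner s x))"
    using c(1) by (intro bexI[of _ "(c, k)"]) (auto simp: partner_def ends_def)
next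
  assume "\<exists>x \<in> ends D. odd (snd x) = (s (fst x) \<noteq> 1)
     \<and> a = arc_at D (fst x) (snd x) \<and> b = arc_at D (fst (partner s x)) (snd (partner s x))"
  then obtain c k where ck: "c < ncross D" "k < 4" "odd k = (s c \<noteq> 1)"
    "a = arc_at D c k" "b = arc_at D c ((k + 1) mod 4)"
    by (auto simp: partner_def ends_def)
  show "joined D s a b"
    unfolding joined_def using ck less_4_cases[OF ck(2)]
    by (intro exI[of _ c]) (elim disjE; simp flip: numeral_2_eq_2)
qed

definition conn :: "'a diagram \<Rightarrow> (nat \<Rightarrow> int) \<Rightarrow> 'a \<Rightarrow> 'a \<Rightarrow> bool" where
  "conn D s = equivclp (joined D s)"

lemma conn_refl [simp]: "conn D s x x"
  and conn_sym: "conn D s x y \<Longrightarrow> conn D s y x"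
  and conn_trans: "conn D s x y \<Longrightarrow> conn D s y z \<Longrightarrow> conn D s x z"
  unfolding conn_def by (auto intro: equivclp_sym equivclp_trans)

lemma conn_joined: "joined D s x y \<Longrightarrow> conn D s x y"
  unfolding conn_def by (rule r_into_equivclp)

lemma conn_partner:
  assumes "x \<in> ends D"
  shows "conn D s (arc_at D (fst x) (snd x)) (arc_at D (fst (partner s x)) (snd (partner s x)))"
proof (cases "odd (snd x) = (s (fst x) \<noteq> 1)")
  case True
  then show ?thesis
    using assms by (intro conn_joined) (auto simp: joined_iff_partner)
next
  case False
  moreover have "odd ((k + 1) mod 4) \<longleftrightarrow> even k" "odd ((k + 3) mod 4) \<longleftrightarrow> even k" for k :: nat
    by presburger+
  ultimately have "odd (snd (partner s x)) = (s (fst (partner s x)) \<noteq> 1)"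
    by (auto simp: partner_def)
  then have "joined D s (arc_at D (fst (partner s x)) (snd (partner s x))) (arc_at D (fst x) (snd x))"
    using partner_partner[OF assms] partner_in_ends[OF assms, of s]
    by (auto simp: joined_iff_partner intro!: bexI[of _ "partner s x"])
  then show ?thesis
    by (intro conn_sym[OF conn_joined])
qed

lemma conn_corners:
  assumes "v < ncross D"
  shows "s v = 1 \<Longrightarrow> conn D s (arc_at D v 0) (arc_at D v 1)"
    "s v = 1 \<Longrightarrow> conn D s (arc_at D v 2) (arc_at D v 3)"
    "s v \<noteq> 1 \<Longrightarrow> conn D s (arc_at D v 1) (arc_at D v 2)"
    "s v \<noteq> 1 \<Longrightarrow> conn D s (arc_at D v 3) (arc_at D v 0)"
  using assms by (auto intro!: conn_joined exI[of _ v] simp: joined_def)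

context
  fixes D :: "'a diagram"
  assumes link: "link_diagram D"
begin

text \<open>One step along a circle: through the crossing to the partner, then along that arc to its
  other end. On all ends it follows every circle in both directions; \<open>travel_out\<close>
  separates the two.\<close>

definition travel :: "(nat \<Rightarrow> int) \<Rightarrow> nat \<times> nat \<Rightarrow> nat \<times> nat" where
  "travel s x = twin D (partner s x)"

lemma source_sink_twin:
  assumes "source_sink D out" "x \<in> ends D"
  shows "out (twin D x) \<longleftrightarrow> \<not> out x"
  using same_arc_twin[OF link assms(2)] assms(1) unfolding source_sink_def by blast

lemma source_sink_next:
  assumes "source_sink D out" "c < ncross D" "k < 4"
  shows "out (c, (k + 1) mod 4) \<longleftrightarrow> \<not> out (c, k)"
  using assms by (auto simp: source_sink_def ends_def)

lemma source_sink_partner: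
  assumes "source_sink D out" "x \<in> ends D"
  shows "out (partner s x) \<longleftrightarrow> \<not> out x"
proof -
  obtain c k where x: "x = (c, k)" "c < ncross D" "k < 4"
    using assms(2) by (auto simp: ends_def)
  have "((k + 3) mod 4 + 1) mod 4 = k"
    using less_4_cases[OF x(3)] by auto
  then show ?thesis
    using source_sink_next[OF assms(1) x(2), of k] x(3)
      source_sink_next[OF assms(1) x(2), of "(k + 3) mod 4"]
    by (auto simp: x(1) partner_def)
qed

lemma travel_in_ends: "z \<in> ends D \<Longrightarrow> travel s z \<in> ends D"
  unfolding travel_def by (rule twin_in_ends[OF link partner_in_ends])

lemma travel_out: "source_sink D out \<Longrightarrow> z \<in> ends D \<Longrightarrow> out (travel s z) \<longleftrightarrow> out z"
  by (simp add: travel_def source_sink_twin source_sink_partner partner_in_ends)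

lemma inj_travel: "inj_on (travel s) (ends D)"
proof (rule inj_onI)
  fix u w assume uw: "u \<in> ends D" "w \<in> ends D" "travel s u = travel s w"
  then have "partner s u = partner s w"
    unfolding travel_def using twin_twin[OF link partner_in_ends] by metis
  then show "u = w"
    using partner_partner uw by metis
qed

text \<open>An arc with ends has exactly one outgoing end, so a chain of joined arcs yields a chain
  of outgoing ends, each the image or a preimage of the one before under \<open>travel\<close>.
  Preimages stay in the orbit, because \<open>travel\<close> permutes a finite set.\<close>

lemma conn_iff_orbit:
  assumes ss: "source_sink D out"
    and x: "x \<in> ends D" "out x" and y: "y \<in> ends D" "out y"
  shows "conn D s (end_arc D x) (end_arc D y) \<longleftrightarrow> (\<exists>n. (travel s ^^ n) x = y)"
proof
  let ?f = "travel s"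
  note fin = travel_in_ends[of _ s] travel_out[OF ss, of _ s] and inj = inj_travel[of s]
  have sub: "?f ` ends D \<subseteq> ends D"
    using fin by blast
  {
    assume "\<exists>n. (?f ^^ n) x = y"
    then obtain n where n: "(?f ^^ n) x = y"
      by blast
    have "conn D s (end_arc D x) (end_arc D ((?f ^^ n) x))" for n
    proof (induction n)
      case (Suc n)
      let ?z = "(?f ^^ n) x"
      have z: "?z \<in> ends D"
        by (rule funpow_in[OF sub x(1)])
      have "conn D s (end_arc D ?z) (end_arc D (?f ?z))"
        using conn_partner[OF z] end_arc_twin[OF link partner_in_ends[OF z]]
        by (simp add: travel_def[of s ?z])
      then show ?case
        using Suc conn_trans by fastforce
    qed simp
    then show "conn D s (end_arc D x) (end_arc D y)"
      using n by blast
  }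
  have orb_back: "\<exists>n. (?f ^^ n) x = z" if z: "z \<in> ends D" "(?f ^^ n) x = ?f z" for z n
  proof -
    obtain m where m: "0 < m" "(?f ^^ m) z = z"
      by (rule funpow_returns[OF finite_ends sub inj z(1)])
    then have "(?f ^^ (m - 1)) (?f z) = z"
      by (cases m) (simp_all add: funpow_swap1)
    then have "(?f ^^ (m - 1 + n)) x = z"
      using z(2) by (simp add: funpow_add)
    then show ?thesis
      by blast
  qed
  have orb_step: "\<exists>n. (?f ^^ n) x = w"
    if e: "e \<in> ends D" and IH: "\<And>w. w \<in> ends D \<Longrightarrow> out w \<Longrightarrow> end_arc D w = end_arc D e \<Longrightarrow> \<exists>n. (?f ^^ n) x = w"
      and w: "w \<in> ends D" "out w" "end_arc D w = end_arc D (partner s e)" for e w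
  proof -
    have p: "partner s e \<in> ends D"
      by (rule partner_in_ends[OF e])
    have "w = partner s e \<or> w = ?f e"
      unfolding travel_def using end_arc_eqD[OF link p w(1)] w(3) by simp
    then show ?thesis
    proof
      assume "w = ?f e"
      then have "out e"
        using fin(2)[OF e] w(2) by simp
      then obtain n where "(?f ^^ n) x = e"
        using IH[OF e] by blast
      then have "(?f ^^ Suc n) x = w"
        using \<open>w = ?f e\<close> by simp
      then show ?thesis
        by blast
    next
      assume we: "w = partner s e"
      then have "out (twin D e)"
        using w(2) source_sink_partner[OF ss e] source_sink_twin[OF ss e] by simp
      then obtain n where "(?f ^^ n) x = twin D e"
        using IH[OF twin_in_ends[OF link e]] end_arc_twin[OF link e] by blast
      then have "(?f ^^ n) x = ?f w"
        using we partner_partner[OF e] by (simp add: travel_def)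
      then show ?thesis
        by (rule orb_back[OF w(1)])
    qed
  qed
  assume "conn D s (end_arc D x) (end_arc D y)"
  then have "\<exists>n. (?f ^^ n) x = w" if "w \<in> ends D" "out w" "end_arc D w = end_arc D y" for w
    unfolding conn_def using that
  proof (induction arbitrary: w rule: equivclp_induct)
    case base
    then have "w = x \<or> w = twin D x"
      using end_arc_eqD[OF link x(1) base(1)] by simp
    then have "w = x"
      using base(2) x source_sink_twin[OF ss x(1)] by blast
    then show ?case
      by (intro exI[of _ 0]) simp
  next
    case (step u z)
    from step.hyps(2) obtain e where e: "e \<in> ends D" "u = end_arc D e" "z = end_arc D (partner s e)"
    proof
      assume "joined D s u z"
      then show ?thesis
        using that unfolding joined_iff_partner by blast
    next
      assume "joined D s z u"
      then obtain e where "e \<in> ends D" "z = end_arc D e" "u = end_arc D (partner s e)"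
        unfolding joined_iff_partner by blast
      then show ?thesis
        using that[of "partner s e"] partner_in_ends[of e D s] partner_partner[of e D s] by simp
    qed
    show ?case
      using step.IH e(2) by (intro orb_step[OF e(1) _ step.prems(1,2)]) (use step.prems(3) e in auto)
  qed
  then show "\<exists>n. (?f ^^ n) x = y"
    using y by blast
qed

text \<open>Exactly two of the four ends at \<open>v\<close> are outgoing, and they are opposite.
  Changing the smoothing exchanges their images, so \<open>travel s'\<close> is
  \<open>travel s\<close> composed with a transposition, and \<open>conn_iff_orbit\<close>
  translates \<open>orbit_transposition\<close> into a statement about circles.\<close>

theorem conn_flip_iff:
  assumes v: "v < ncross D" and s: "s v = 1" and s': "s' v \<noteq> 1"
    and off: "\<And>c. c < ncross D \<Longrightarrow> c \<noteq> v \<Longrightarrow> s c = s' c"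
  shows "conn D s' (arc_at D v 1) (arc_at D v 3) \<longleftrightarrow> \<not> conn D s (arc_at D v 1) (arc_at D v 3)"
proof -
  obtain out where ss: "source_sink D out"
    using planar_source_sink[OF link] by (rule exE)
  let ?S = "{x \<in> ends D. out x}"
  have alt: "out (v, 1) \<noteq> out (v, 0)" "out (v, 2) \<noteq> out (v, 1)" "out (v, 3) \<noteq> out (v, 2)"
    using source_sink_next[OF ss v, of 0] source_sink_next[OF ss v, of 1]
      source_sink_next[OF ss v, of 2]
    by (simp_all flip: numeral_2_eq_2)
  have sub: "travel t ` ?S \<subseteq> ?S" for t
    using travel_in_ends travel_out[OF ss] by blast
  have inj: "inj_on (travel t) ?S" for t
    by (rule inj_on_subset[OF inj_travel]) simp
  have fin: "finite ?S"
    by simp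
  define k k' where "k = (if out (v, 1) then 1 else 0 :: nat)"
    and "k' = (if out (v, 1) then 3 else 2 :: nat)"
  let ?x = "(v, k)" and ?y = "(v, k')"
  have xy: "?x \<in> ?S" "?y \<in> ?S" "?x \<noteq> ?y"
    using v alt by (simp_all add: k_def k'_def ends_def)
  have swap: "travel s' ?x = travel s ?y" "travel s' ?y = travel s ?x"
    using s s' by (simp_all add: travel_def partner_def k_def k'_def flip: numeral_2_eq_2)
  have other: "travel s' z = travel s z" if z: "z \<in> ?S" "z \<noteq> ?x" "z \<noteq> ?y" for z
  proof -
    obtain c j where cj: "z = (c, j)" "c < ncross D" "j < 4" "out (c, j)"
      using z by (cases z) (auto simp: ends_def)
    have "c \<noteq> v"
      using cj z less_4_cases[OF cj(3)] alt by (auto simp: k_def k'_def split: if_splits)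
    then show ?thesis
      using off[OF cj(2)] by (simp add: travel_def partner_def cj(1))
  qed
  have "(\<exists>n. (travel s' ^^ n) ?x = ?y) \<longleftrightarrow> \<not> (\<exists>n. (travel s ^^ n) ?x = ?y)"
    using fin sub inj sub inj xy swap other by (rule orbit_transposition)
  then have *: "conn D s' (end_arc D ?x) (end_arc D ?y) \<longleftrightarrow> \<not> conn D s (end_arc D ?x) (end_arc D ?y)"
    using conn_iff_orbit[OF ss, of ?x ?y] xy by simp
  show ?thesis
  proof (cases "out (v, 1)")
    case True
    then show ?thesis
      using * by (simp add: k_def k'_def)
  next
    case False
    \<comment> \<open>With 0 and 2 outgoing, the strands 0-1 and 2-3 of \<open>s\<close> and the
      strands 1-2 and 3-0 of \<open>s'\<close> transfer the result to the ends 1 and 3.\<close>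
    have "conn D s (arc_at D v 0) (arc_at D v 2) \<longleftrightarrow> conn D s (arc_at D v 1) (arc_at D v 3)"
      using conn_corners(1,2)[OF v, of s] s by (meson conn_sym conn_trans)
    moreover have "conn D s' (arc_at D v 0) (arc_at D v 2) \<longleftrightarrow> conn D s' (arc_at D v 1) (arc_at D v 3)"
      using conn_corners(3,4)[OF v, of s'] s' by (meson conn_sym conn_trans)
    ultimately show ?thesis
      using * False by (simp add: k_def k'_def)
  qed
qed

end

section \<open>Labelled circles\<close>

text \<open>
  The functions p and q send an arc to its circle before and after the smoothing at one crossing is
  changed, and x and y are arcs on the two strands of the crossing.  Either the circles p x and p y
  are distinct and merge, or they coincide and split.
\<close>

definition surgery :: "'a set \<Rightarrow> ('a \<Rightarrow> 'c) \<Rightarrow> ('a \<Rightarrow> 'c) \<Rightarrow> 'a \<Rightarrow> 'a \<Rightarrow> bool" where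
  "surgery A p q x y \<longleftrightarrow> x \<in> A \<and> y \<in> A \<and> (p x = p y \<longleftrightarrow> q x \<noteq> q y)
     \<and> (\<forall>a \<in> A. p a \<in> {p x, p y} \<longleftrightarrow> q a \<in> {q x, q y})
     \<and> (\<forall>a \<in> A. p a \<notin> {p x, p y} \<longrightarrow> q a = p a)"

text \<open>
  P and Q are the sets of positive circles.  Reading positive as X and negative as 1, this is the
  matrix of the multiplication and the comultiplication of the Frobenius algebra Z[X]/X^2.
\<close>

definition transition :: "('a \<Rightarrow> 'c) \<Rightarrow> ('a \<Rightarrow> 'c) \<Rightarrow> 'a \<Rightarrow> 'a \<Rightarrow> 'c set \<Rightarrow> 'c set \<Rightarrow> bool" where
  "transition p q x y P Q \<longleftrightarrow> P - {p x, p y} = Q - {q x, q y}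
     \<and> (if q x = q y then \<not> (p x \<in> P \<and> p y \<in> P) \<and> (q x \<in> Q \<longleftrightarrow> p x \<in> P \<or> p y \<in> P)
        else if p x \<in> P then q x \<in> Q \<and> q y \<in> Q else (q x \<in> Q) \<noteq> (q y \<in> Q))"

lemma surgeryD:
  assumes "surgery A p q x y"
  shows "x \<in> A" "y \<in> A" "p x = p y \<longleftrightarrow> q x \<noteq> q y"
    "a \<in> A \<Longrightarrow> p a \<in> {p x, p y} \<longleftrightarrow> q a \<in> {q x, q y}"
    "a \<in> A \<Longrightarrow> p a \<notin> {p x, p y} \<Longrightarrow> q a = p a"
  using assms unfolding surgery_def by blast+

lemma insert_Diff_eq_iff:
  assumes "c \<notin> P" "c \<notin> S" "c \<notin> T"
  shows "insert c P - S = Q - T \<longleftrightarrow> c \<in> Q \<and> P - S = Q - {c} - T"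
proof
  assume e: "insert c P - S = Q - T"
  have "c \<in> insert c P - S" "P - S = (insert c P - S) - {c}"
    using assms by blast+
  then show "c \<in> Q \<and> P - S = Q - {c} - T"
    unfolding e by blast
next
  assume r: "c \<in> Q \<and> P - S = Q - {c} - T"
  have "insert c P - S = insert c (P - S)"
    using assms by blast
  also have "\<dots> = Q - T"
    using assms r by blast
  finally show "insert c P - S = Q - T" .
qed

text \<open>
  Together with transition_delete: the transition matrix commutes with multiplication by the X of
  the circle through a.
\<close>

lemma transition_insert:
  assumes s: "surgery A p q x y" and a: "a \<in> A" "p a \<notin> P"
  shows "transition p q x y (insert (p a) P) Q \<longleftrightarrow> q a \<in> Q \<and> transition p q x y P (Q - {q a})"
proof (cases "p a \<in> {p x, p y}")
  case False
  then have q: "q a = p a" "q a \<notin> {q x, q y}"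
    using surgeryD(4,5)[OF s a(1)] by blast+
  have "insert (p a) P - {p x, p y} = Q - {q x, q y}
      \<longleftrightarrow> q a \<in> Q \<and> P - {p x, p y} = Q - {q a} - {q x, q y}"
    unfolding q(1) using False a(2) q by (intro insert_Diff_eq_iff) simp_all
  moreover have "p x \<noteq> p a" "p y \<noteq> p a" "q x \<noteq> q a" "q y \<noteq> q a"
    using False q(2) by auto
  ultimately show ?thesis
    unfolding transition_def by simp
next
  case True
  then have q: "q a \<in> {q x, q y}"
    using surgeryD(4)[OF s a(1)] by blast
  have 1: "insert (p a) P - {p x, p y} = P - {p x, p y}" "Q - {q a} - {q x, q y} = Q - {q x, q y}"
    using True q by blast+
  show ?thesis
  proof (cases "q x = q y")
    case m: True
    then have "p x \<noteq> p y" "q a = q x"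
      using surgeryD(3)[OF s] q by simp_all
    then show ?thesis
      using True a(2) unfolding transition_def 1 by (elim insertE emptyE) (simp_all add: m conj_commute)
  next
    case n: False
    then have e: "p x = p y" "p a = p x"
      using surgeryD(3)[OF s] True by simp_all
    then show ?thesis
      using q a(2) n unfolding transition_def 1 by (elim insertE emptyE) (simp_all, blast+)
  qed
qed

text \<open>This is \<open>X * X = 0\<close>: multiplication by X at \<open>a\<close> kills a
  labelling that is already positive there, so it must kill the image as well. In other words, no
  term of the image is negative on the circle of \<open>a\<close>.\<close>

lemma transition_delete:
  assumes s: "surgery A p q x y" and a: "a \<in> A" "p a \<in> P"
  shows "\<not> (q a \<in> Q \<and> transition p q x y P (Q - {q a}))"
proof (cases "p a \<in> {p x, p y}")
  case False
  then have q: "q a = p a" "q a \<notin> {q x, q y}"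
    using surgeryD(4,5)[OF s a(1)] by blast+
  then have "P - {p x, p y} \<noteq> Q - {q a} - {q x, q y}"
    using False a(2) by (metis Diff_iff insertI1)
  then show ?thesis
    unfolding transition_def by simp
next
  case True
  then have q: "q a \<in> {q x, q y}"
    using surgeryD(4)[OF s a(1)] by blast
  show ?thesis
  proof (cases "q x = q y")
    case m: True
    then have "p x \<noteq> p y" "q a = q x"
      using surgeryD(3)[OF s] q by simp_all
    then show ?thesis
      using True a(2) unfolding transition_def by (elim insertE emptyE) (simp_all add: m)
  next
    case n: False
    then have e: "p x = p y" "p a = p x"
      using surgeryD(3)[OF s] True by simp_all
    then show ?thesis
      using q a(2) n unfolding transition_def by (elim insertE emptyE) simp_all
  qed
qed

text \<open>The labelling is X at \<open>a\<close> times the one with \<open>p a\<close> removed,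
  and the transition commutes with this factor. This is what keeps chains that are positive at the
  base point closed under the differential.\<close>

lemma transition_positive:
  assumes s: "surgery A p q x y" and a: "a \<in> A" "p a \<in> P" and t: "transition p q x y P Q"
  shows "q a \<in> Q"
  using transition_insert[OF s a(1), of "P - {p a}" Q] t a(2) by (simp add: insert_absorb)

text \<open>The image of the unit: \<open>1 * 1 = 1\<close> for a merge, and for a split the sum of
  X on one piece and X on the other.\<close>

lemma transition_empty:
  assumes "surgery A p q x y"
  shows "transition p q x y {} Q \<longleftrightarrow> (if q x = q y then Q = {} else Q = {q x} \<or> Q = {q y})"
  unfolding transition_def by auto

lemma transition_singleton:
  assumes "surgery A p q x y" "z \<in> A"
  shows "transition p q x y {p z} Q
    \<longleftrightarrow> q z \<in> Q \<and> (if q x = q y then Q = {q z} else Q - {q z} = {q x} \<or> Q - {q z} = {q y})"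
  using transition_insert[OF assms, of "{}"] transition_empty[OF assms(1)] by auto

lemma transition_subset:
  assumes s: "surgery A p q x y" and P: "P \<subseteq> p ` A" and t: "transition p q x y P Q"
  shows "Q \<subseteq> q ` A"
proof
  fix c assume c: "c \<in> Q"
  show "c \<in> q ` A"
  proof (cases "c \<in> {q x, q y}")
    case False
    then have "c \<in> P" "c \<notin> {p x, p y}"
      using t c by (auto simp: transition_def)
    then obtain a where "a \<in> A" "c = p a" "q a = p a"
      using P surgeryD(5)[OF s] by blast
    then show ?thesis
      by (intro image_eqI[of _ _ a]) simp_all
  qed (use surgeryD(1,2)[OF s] in blast)
qed

lemma card_surgery:
  assumes s: "surgery A p q x y" and A: "finite A"
  shows "q x \<noteq> q y \<Longrightarrow> card (q ` A) = card (p ` A) + 1"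
    "q x = q y \<Longrightarrow> card (p ` A) = card (q ` A) + 1"
proof -
  have diff: "p ` A - {p x, p y} = q ` A - {q x, q y}"
  proof (intro subset_antisym subsetI)
    fix c assume "c \<in> p ` A - {p x, p y}"
    then obtain a where "a \<in> A" "c = p a" "p a \<notin> {p x, p y}"
      by blast
    then show "c \<in> q ` A - {q x, q y}"
      using surgeryD(4,5)[OF s, of a] by (intro DiffI image_eqI[of _ _ a]) simp_all
  next
    fix c assume "c \<in> q ` A - {q x, q y}"
    then obtain a where "a \<in> A" "c = q a" "q a \<notin> {q x, q y}"
      by blast
    then show "c \<in> p ` A - {p x, p y}"
      using surgeryD(4,5)[OF s, of a] by (intro DiffI image_eqI[of _ _ a]) simp_all
  qed
  have c: "card (f ` A) = card (f ` A - {f x, f y}) + card {f x, f y}" for f :: "'a \<Rightarrow> 'b"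
    using A surgeryD(1,2)[OF s] by (subst card_Diff_subset) (auto intro!: card_mono le_add_diff_inverse2[symmetric])
  have *: "card (p ` A) + card {q x, q y} = card (q ` A) + card {p x, p y}"
    using c[of p, unfolded diff] c[of q] by linarith
  show "q x \<noteq> q y \<Longrightarrow> card (q ` A) = card (p ` A) + 1"
    "q x = q y \<Longrightarrow> card (p ` A) = card (q ` A) + 1"
    using * surgeryD(3)[OF s] by auto
qed

text \<open>Transition matrices have entries 0 and 1, so the cardinality of this set is the matrix
  entry of the composite of two transitions.\<close>

definition two_step ::
    "('a \<Rightarrow> 'c) \<Rightarrow> ('a \<Rightarrow> 'c) \<Rightarrow> ('a \<Rightarrow> 'c) \<Rightarrow> 'a \<Rightarrow> 'a \<Rightarrow> 'a \<Rightarrow> 'a \<Rightarrow> 'c set \<Rightarrow> 'c set \<Rightarrow> 'c set set" where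
  "two_step p q r x y x' y' P R = {Q. transition p q x y P Q \<and> transition q r x' y' Q R}"

text \<open>Inserting \<open>q a\<close> is a bijection between the intermediate labellings. By
  \<open>transition_delete\<close> the smaller ones do not contain \<open>q a\<close>, which makes
  the insertion injective.\<close>

lemma card_two_step_insert:
  assumes s: "surgery A p q x y" and s': "surgery A q r x' y'" and a: "a \<in> A" "p a \<notin> P"
  shows "card (two_step p q r x y x' y' (insert (p a) P) R)
    = (if r a \<in> R then card (two_step p q r x y x' y' P (R - {r a})) else 0)"
proof (cases "r a \<in> R")
  case True
  have "q a \<notin> Q" if "Q \<in> two_step p q r x y x' y' P (R - {r a})" for Q
    using transition_delete[OF s' a(1), of Q R] that True by (auto simp: two_step_def)
  then have inj: "inj_on (insert (q a)) (two_step p q r x y x' y' P (R - {r a}))"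
    by (meson inj_onI insert_ident)
  have "two_step p q r x y x' y' (insert (p a) P) R
      = insert (q a) ` two_step p q r x y x' y' P (R - {r a})" (is "?L = ?I")
  proof (intro subset_antisym subsetI)
    fix Q assume "Q \<in> ?L"
    then have t: "q a \<in> Q" "transition p q x y P (Q - {q a})" "transition q r x' y' Q R"
      using transition_insert[OF s a] by (auto simp: two_step_def)
    then have "transition q r x' y' (Q - {q a}) (R - {r a})"
      using transition_insert[OF s' a(1), of "Q - {q a}" R] by (simp add: insert_absorb)
    then show "Q \<in> ?I"
      using t by (intro image_eqI[of _ _ "Q - {q a}"]) (auto simp: two_step_def)
  next
    fix Q assume "Q \<in> ?I"
    then obtain Q' where Q': "Q = insert (q a) Q'" "Q' \<in> two_step p q r x y x' y' P (R - {r a})"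
      by blast
    then have n: "q a \<notin> Q'"
      using \<open>\<And>Q. Q \<in> two_step p q r x y x' y' P (R - {r a}) \<Longrightarrow> q a \<notin> Q\<close> by blast
    then show "Q \<in> ?L"
      using Q' True transition_insert[OF s a, of Q] transition_insert[OF s' a(1) n, of R]
      by (auto simp: two_step_def)
  qed
  then show ?thesis
    using True card_image[OF inj] by simp
next
  case False
  have "two_step p q r x y x' y' (insert (p a) P) R = {}"
    using transition_insert[OF s a] transition_positive[OF s' a(1)] False
    by (auto simp: two_step_def)
  then show ?thesis
    using False by simp
qed

text \<open>The composites applied to 1: two merges give 1, a merge and a split in either order give
  a sum of two X, and two splits give a sum over one choice of X in each step. The condition
  \<open>r a \<noteq> r b\<close> drops the choices with \<open>X * X = 0\<close>.\<close>

lemma card_two_step_empty: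
  assumes s: "surgery A p q x y" and s': "surgery A q r x' y'"
  shows "q x = q y \<Longrightarrow> r x' = r y' \<Longrightarrow> card (two_step p q r x y x' y' {} R) = of_bool (R = {})"
    "q x = q y \<Longrightarrow> r x' \<noteq> r y' \<Longrightarrow>
      card (two_step p q r x y x' y' {} R) = of_bool (R = {r x'}) + of_bool (R = {r y'})"
    "q x \<noteq> q y \<Longrightarrow> r x' = r y' \<Longrightarrow>
      card (two_step p q r x y x' y' {} R) = of_bool (R = {r x}) + of_bool (R = {r y})"
    "q x \<noteq> q y \<Longrightarrow> r x' \<noteq> r y' \<Longrightarrow> card (two_step p q r x y x' y' {} R)
      = (\<Sum>a\<in>{x, y}. \<Sum>b\<in>{x', y'}. of_bool (r a \<noteq> r b \<and> R = {r a, r b}))"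
proof -
  note e = transition_empty[OF s] transition_empty[OF s']
  have xy: "x \<in> A" "y \<in> A"
    using surgeryD[OF s] by blast+
  note sx = transition_singleton[OF s' xy(1), of R] and sy = transition_singleton[OF s' xy(2), of R]
  let ?N = "two_step p q r x y x' y' {} R"
  {
    assume m: "q x = q y"
    then have "?N = (if transition q r x' y' {} R then {{}} else {})"
      by (auto simp: two_step_def e)
    then show "r x' = r y' \<Longrightarrow> card ?N = of_bool (R = {})"
      "r x' \<noteq> r y' \<Longrightarrow> card ?N = of_bool (R = {r x'}) + of_bool (R = {r y'})"
      by (auto simp: e)
  }
  {
    assume n: "q x \<noteq> q y"
    then have "?N = (if transition q r x' y' {q x} R then {{q x}} else {})
        \<union> (if transition q r x' y' {q y} R then {{q y}} else {})"
      by (auto simp: two_step_def e)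
    then have c: "card ?N = of_bool (transition q r x' y' {q x} R) + of_bool (transition q r x' y' {q y} R)"
      using n by auto
    show "r x' = r y' \<Longrightarrow> card ?N = of_bool (R = {r x}) + of_bool (R = {r y})"
      unfolding c sx sy by (auto intro!: arg_cong2[of _ _ _ _ "(+)"] arg_cong[of _ _ of_bool])
    assume n': "r x' \<noteq> r y'"
    have "r z \<in> R \<and> (if r x' = r y' then R = {r z} else R - {r z} = {r x'} \<or> R - {r z} = {r y'})
      \<longleftrightarrow> r z \<noteq> r x' \<and> R = {r z, r x'} \<or> r z \<noteq> r y' \<and> R = {r z, r y'}" for z
      using n' by auto
    moreover have "x' \<noteq> y'" "x \<noteq> y"
      using n n' by auto
    ultimately show "card ?N = (\<Sum>a\<in>{x, y}. \<Sum>b\<in>{x', y'}. of_bool (r a \<noteq> r b \<and> R = {r a, r b}))"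
      unfolding c sx sy using n' by (auto simp: doubleton_eq_iff)
  }
qed

text \<open>Each change alters the number of circles by exactly one, and both orders have the same
  total. This excludes ten of the sixteen patterns.\<close>

lemma merge_split_cases:
  fixes a b c d :: nat
  assumes "\<not> m1 \<Longrightarrow> b = a + 1" "m1 \<Longrightarrow> a = b + 1" "\<not> m4 \<Longrightarrow> d = c + 1" "m4 \<Longrightarrow> c = d + 1"
    "\<not> m2 \<Longrightarrow> d = b + 1" "m2 \<Longrightarrow> b = d + 1" "\<not> m3 \<Longrightarrow> c = a + 1" "m3 \<Longrightarrow> a = c + 1"
  shows "m1 \<and> m2 \<and> m3 \<and> m4 \<or> \<not> m1 \<and> \<not> m2 \<and> \<not> m3 \<and> \<not> m4 \<or> m1 \<and> \<not> m2 \<and> m3 \<and> \<not> m4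
    \<or> \<not> m1 \<and> m2 \<and> \<not> m3 \<and> m4 \<or> m1 \<and> \<not> m2 \<and> \<not> m3 \<and> m4 \<or> \<not> m1 \<and> m2 \<and> m3 \<and> \<not> m4"
proof -
  have "int b - int a = (if m1 then -1 else 1)" "int d - int c = (if m4 then -1 else 1)"
    using assms(1-4) by simp_all
  moreover have "int d - int b = (if m2 then -1 else 1)" "int c - int a = (if m3 then -1 else 1)"
    using assms(5-8) by simp_all
  ultimately have "(if m1 then -1 else 1) + (if m2 then -1 else 1)
      = (if m3 then -1 else 1) + (if m4 then -1 else (1 :: int))"
    by linarith
  then show ?thesis
    by (cases m1; cases m2; cases m3; cases m4) simp_all
qed

text \<open>
  Both sides commute with the multiplications by X, and the labelling without positive circles
  generates all the others, so it suffices to compare the images of the latter.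
\<close>

theorem card_two_step_commute:
  assumes A: "finite A"
    and v: "surgery A p q x y" "surgery A q' r x y" and w: "surgery A q r x' y'" "surgery A p q' x' y'"
    and P: "P \<subseteq> p ` A"
  shows "card (two_step p q r x y x' y' P R) = card (two_step p q' r x' y' x y P R)"
proof -
  have "finite P"
    using A P finite_subset by blast
  then show ?thesis
    using P
  proof (induction P arbitrary: R rule: finite_induct)
    case (insert c P)
    then obtain a where a: "a \<in> A" "c = p a" "p a \<notin> P"
      by blast
    show ?case
      unfolding a(2) card_two_step_insert[OF v(1) w(1) a(1,3)] card_two_step_insert[OF w(2) v(2) a(1,3)]
      using insert by simp
  next
    case empty
    have xy: "x \<in> A" "y \<in> A" "x' \<in> A" "y' \<in> A"
      using surgeryD(1,2)[OF v(1)] surgeryD(1,2)[OF w(1)] by blast+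
    note cards = card_surgery[OF v(1) A] card_surgery[OF v(2) A] card_surgery[OF w(1) A]
      card_surgery[OF w(2) A]
    note N1 = card_two_step_empty[OF v(1) w(1), of R] and N2 = card_two_step_empty[OF w(2) v(2), of R]
    \<comment> \<open>The letters record merge or split, first for the order \<open>x\<close>,
      \<open>y\<close> before \<open>x'\<close>, \<open>y'\<close>, then for the opposite
      order.\<close>
    consider (mm) "q x = q y" "r x' = r y'" "q' x' = q' y'" "r x = r y"
      | (ss) "q x \<noteq> q y" "r x' \<noteq> r y'" "q' x' \<noteq> q' y'" "r x \<noteq> r y"
      | (msms) "q x = q y" "r x' \<noteq> r y'" "q' x' = q' y'" "r x \<noteq> r y"
      | (smsm) "q x \<noteq> q y" "r x' = r y'" "q' x' \<noteq> q' y'" "r x = r y"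
      | (mssm) "q x = q y" "r x' \<noteq> r y'" "q' x' \<noteq> q' y'" "r x = r y"
      | (smms) "q x \<noteq> q y" "r x' = r y'" "q' x' = q' y'" "r x \<noteq> r y"
    proof -
      have "q x = q y \<and> r x' = r y' \<and> q' x' = q' y' \<and> r x = r y
        \<or> q x \<noteq> q y \<and> r x' \<noteq> r y' \<and> q' x' \<noteq> q' y' \<and> r x \<noteq> r y
        \<or> q x = q y \<and> r x' \<noteq> r y' \<and> q' x' = q' y' \<and> r x \<noteq> r y
        \<or> q x \<noteq> q y \<and> r x' = r y' \<and> q' x' \<noteq> q' y' \<and> r x = r y
        \<or> q x = q y \<and> r x' \<noteq> r y' \<and> q' x' \<noteq> q' y' \<and> r x = r y
        \<or> q x \<noteq> q y \<and> r x' = r y' \<and> q' x' = q' y' \<and> r x \<noteq> r y"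
        by (rule merge_split_cases) (fact cards)+
      then show ?thesis
        using that by blast
    qed
    then show ?case
    proof cases
      case mm
      then show ?thesis
        using N1(1) N2(1) by simp
    next
      case ss
      show ?thesis
        unfolding N1(4)[OF ss(1,2)] N2(4)[OF ss(3,4)]
        by (subst sum.swap) (intro sum.cong refl arg_cong[of _ _ of_bool], auto)
    next
      \<comment> \<open>The second crossing would merge if changed first, but splits after the merge
        at the first; so its strands lie on the two circles just merged. Both orders therefore end
        with the same two circles.\<close>
      case msms
      have p: "p x \<noteq> p y" "p x' \<noteq> p y'" "q x' = q y'"
        using msms surgeryD(3)[OF v(1)] surgeryD(3)[OF w(1)] surgeryD(3)[OF w(2)] by blast+
      have "p x' \<in> {p x, p y}"
        using surgeryD(4,5)[OF v(1) xy(3)] surgeryD(4,5)[OF v(1) xy(4)] p msms by metis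
      then have "q x' = q x"
        using surgeryD(4)[OF v(1) xy(3)] msms by simp
      then have "r x \<in> {r x', r y'}" "r y \<in> {r x', r y'}"
        using surgeryD(4)[OF w(1) xy(1)] surgeryD(4)[OF w(1) xy(2)] msms by simp_all
      then have "r x = r x' \<and> r y = r y' \<or> r x = r y' \<and> r y = r x'"
        using msms by auto
      then show ?thesis
        unfolding N1(2)[OF msms(1,2)] N2(2)[OF msms(3,4)] by auto
    next
      \<comment> \<open>Interleaved strands on one circle: all four arcs end up on a single circle,
        and both orders give 2X by counting it twice.\<close>
      case smsm
      have p: "p x = p y" "p x' = p y'" "q x' \<noteq> q y'"
        using smsm surgeryD(3)[OF v(1)] surgeryD(3)[OF w(1)] surgeryD(3)[OF w(2)] by blast+
      have "p x' = p x"
      proof (rule ccontr)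
        assume "p x' \<noteq> p x"
        then have "p x' \<notin> {p x, p y}" "p y' \<notin> {p x, p y}"
          using p(1,2) by simp_all
        then show False
          using surgeryD(5)[OF v(1) xy(3)] surgeryD(5)[OF v(1) xy(4)] p(2,3) by metis
      qed
      then have "q x' \<in> {q x, q y}" "q y' \<in> {q x, q y}"
        using surgeryD(4)[OF v(1) xy(3)] surgeryD(4)[OF v(1) xy(4)] p by simp_all
      then have "q x \<in> {q x', q y'}" "q y \<in> {q x', q y'}"
        using p(3) by auto
      then have "r x = r x'" "r y = r x'"
        using surgeryD(4)[OF w(1) xy(1)] surgeryD(4)[OF w(1) xy(2)] smsm by simp_all
      then show ?thesis
        unfolding N1(3)[OF smsm(1,2)] N2(3)[OF smsm(3,4)] using smsm by simp
    next
      case mssm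
      then show ?thesis
        unfolding N1(2)[OF mssm(1,2)] N2(3)[OF mssm(3,4)] by simp
    next
      case smms
      then show ?thesis
        unfolding N1(3)[OF smms(1,2)] N2(2)[OF smms(3,4)] by simp
    qed
  qed
qed

lemma transition_iff_card:
  fixes p q :: "'a \<Rightarrow> 'c"
  assumes "p x = p y \<longleftrightarrow> q x \<noteq> q y" "finite P" "finite Q"
  shows "transition p q x y P Q \<longleftrightarrow> P - {p x, p y} = Q - {q x, q y}
    \<and> card Q = card P + (if q x = q y then 0 else 1)"
proof -
  have c: "card R = card (R - {u, w}) + (if u = w then of_bool (u \<in> R) else of_bool (u \<in> R) + of_bool (w \<in> R))"
    if "finite R" for R and u w :: 'c
  proof -
    have "R \<inter> {u, w} = (if u \<in> R then {u} else {}) \<union> (if w \<in> R then {w} else {})"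
      by auto
    then have "card (R \<inter> {u, w}) = (if u = w then of_bool (u \<in> R) else of_bool (u \<in> R) + of_bool (w \<in> R))"
      by auto
    then show ?thesis
      using card_Int_Diff[OF that, of "{u, w}"] by simp
  qed
  show ?thesis
  proof (cases "P - {p x, p y} = Q - {q x, q y}")
    case True
    define k where "k = card (Q - {q x, q y})"
    have P: "card P = k + (if p x = p y then of_bool (p x \<in> P) else of_bool (p x \<in> P) + of_bool (p y \<in> P))"
      using c[OF assms(2), of "p x" "p y"] unfolding k_def True .
    have Q: "card Q = k + (if q x = q y then of_bool (q x \<in> Q) else of_bool (q x \<in> Q) + of_bool (q y \<in> Q))"
      using c[OF assms(3), of "q x" "q y"] unfolding k_def .
    show ?thesis
    proof (cases "q x = q y")
      case m: True
      then show ?thesis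
        unfolding transition_def P Q using True assms(1) by simp
    next
      case n: False
      then have "p x = p y"
        using assms(1) by simp
      then show ?thesis
        unfolding transition_def P Q using True n by simp
    qed
  qed (simp add: transition_def)
qed

section \<open>The differential\<close>

definition circ :: "'a diagram \<Rightarrow> (nat \<Rightarrow> int) \<Rightarrow> 'a \<Rightarrow> 'a set" where
  "circ D s a = {b \<in> arcs D. conn D s a b}"

definition positive_circles :: "'a diagram \<Rightarrow> 'a enhanced_state \<Rightarrow> 'a set set" where
  "positive_circles D S = {C \<in> circles D (fst S). snd S C = 1}"

definition flip :: "nat \<Rightarrow> (nat \<Rightarrow> int) \<Rightarrow> nat \<Rightarrow> int" where
  "flip v s = s(v := -1)"

text \<open>The arcs at the ends 1 and 3 lie on the two strands of either smoothing at v.\<close>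

definition flip_transition :: "'a diagram \<Rightarrow> nat \<Rightarrow> (nat \<Rightarrow> int) \<Rightarrow> 'a set set \<Rightarrow> 'a set set \<Rightarrow> bool" where
  "flip_transition D v s =
     transition (circ D s) (circ D (flip v s)) (arc_at D v 1) (arc_at D v 3)"

text \<open>The part of the differential that changes \<open>v\<close>, without its sign and without
  reference to degrees; \<open>incidence_kh_step\<close> relates it to
  \<open>incidence\<close>.\<close>

definition kh_step :: "'a diagram \<Rightarrow> nat \<Rightarrow> 'a enhanced_state \<Rightarrow> 'a enhanced_state \<Rightarrow> bool" where
  "kh_step D v S S' \<longleftrightarrow> v < ncross D \<and> fst S v = 1 \<and> fst S' = flip v (fst S)
     \<and> flip_transition D v (fst S) (positive_circles D S) (positive_circles D S')"

lemma circles_alt: "circles D s = circ D s ` arcs D"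
  by (simp add: circles_def conn_classes_alt circ_def[abs_def] conn_def)

lemma circ_eq_iff: "a \<in> arcs D \<Longrightarrow> b \<in> arcs D \<Longrightarrow> circ D s a = circ D s b \<longleftrightarrow> conn D s a b"
  unfolding circ_def by (blast intro: conn_sym conn_trans conn_refl)

lemma positive_circles_subset: "positive_circles D S \<subseteq> circ D (fst S) ` arcs D"
  by (auto simp: positive_circles_def circles_alt)

lemma mem_circle_iff:
  assumes "C \<in> circles D s" "a \<in> arcs D"
  shows "a \<in> C \<longleftrightarrow> C = circ D s a"
proof -
  obtain c where c: "c \<in> arcs D" "C = circ D s c"
    using assms(1) by (auto simp: circles_alt)
  have "a \<in> circ D s c \<longleftrightarrow> conn D s c a"
    using assms(2) by (simp add: circ_def)
  then show ?thesis
    unfolding c(2) using circ_eq_iff[OF c(1) assms(2)] by simp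
qed

lemma enhanced_state_eqI:
  assumes "S \<in> enhanced_states D" "S' \<in> enhanced_states D" "fst S = fst S'"
    "positive_circles D S = positive_circles D S'"
  shows "S = S'"
proof -
  have e: "snd S \<in> circles D (fst S) \<rightarrow>\<^sub>E {1, -1}" "snd S' \<in> circles D (fst S) \<rightarrow>\<^sub>E {1, -1}"
    using assms by (auto simp: enhanced_states_def)
  have "snd S C = snd S' C" if C: "C \<in> circles D (fst S)" for C
  proof -
    have "snd S C = 1 \<longleftrightarrow> snd S' C = 1"
      using assms(3,4) C unfolding positive_circles_def by auto
    moreover have "snd S C \<in> {1, -1}" "snd S' C \<in> {1, -1}"
      using PiE_mem[OF e(1) C] PiE_mem[OF e(2) C] .
    ultimately show ?thesis
      by auto
  qed
  then have "snd S = snd S'"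
    by (rule PiE_ext[OF e])
  then show ?thesis
    using assms(3) by (simp add: prod_eq_iff)
qed

lemma enhanced_state_exists:
  assumes "s \<in> kauffman_states D" "P \<subseteq> circles D s"
  obtains S where "S \<in> enhanced_states D" "fst S = s" "positive_circles D S = P"
proof
  let ?S = "(s, \<lambda>C \<in> circles D s. if C \<in> P then 1 else (-1 :: int))"
  show "?S \<in> enhanced_states D" "fst ?S = s"
    using assms(1) by (auto simp: enhanced_states_def)
  show "positive_circles D ?S = P"
    using assms(2) by (auto simp: positive_circles_def)
qed

lemma flip_kauffman_state:
  "s \<in> kauffman_states D \<Longrightarrow> v < ncross D \<Longrightarrow> flip v s \<in> kauffman_states D"
  by (auto simp: kauffman_states_def flip_def PiE_iff extensional_def)

lemma kauffman_state_values:
  "s \<in> kauffman_states D \<Longrightarrow> c < ncross D \<Longrightarrow> s c = 1 \<or> s c = -1"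
  by (auto simp: kauffman_states_def PiE_iff)

lemma sigma_flip:
  assumes "v < ncross D" "fst S v = 1" "fst S' = flip v (fst S)"
  shows "sigma D S' = sigma D S - 2"
proof -
  let ?p = "\<lambda>S. {c. c < ncross D \<and> fst S c = 1}" and ?m = "\<lambda>S. {c. c < ncross D \<and> fst S c = -1}"
  have "?p S = insert v (?p S')" "v \<notin> ?p S'" "?m S' = insert v (?m S)" "v \<notin> ?m S"
    using assms by (auto simp: flip_def)
  then show ?thesis
    unfolding sigma_def by simp
qed

context
  fixes D :: "'a diagram"
  assumes link: "link_diagram D"
begin

lemma arc_at_in_arcs: "v < ncross D \<Longrightarrow> k < 4 \<Longrightarrow> arc_at D v k \<in> arcs D"
  using end_arc_in_arcs[OF link, of "(v, k)"] by (simp add: ends_def)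

lemma finite_arcs: "finite (arcs D)"
  using link by (simp add: link_diagram_def)

lemma finite_circles: "finite (circles D s)"
  by (simp add: circles_alt finite_arcs)

lemma finite_positive_circles: "finite (positive_circles D S)"
  by (simp add: positive_circles_def finite_circles)

lemma finite_states_in: "finite (states_in D i j)"
proof (rule finite_subset)
  show "states_in D i j \<subseteq> (SIGMA s:kauffman_states D. circles D s \<rightarrow>\<^sub>E {1, -1})"
    by (auto simp: states_in_def enhanced_states_def)
  show "finite (SIGMA s:kauffman_states D. circles D s \<rightarrow>\<^sub>E {1, -1 :: int})"
    by (intro finite_SigmaI finite_PiE finite_circles) (simp_all add: kauffman_states_def finite_PiE)
qed

lemma tau_positive_circles:
  assumes "S \<in> enhanced_states D"
  shows "tau D S = 2 * int (card (positive_circles D S)) - int (card (circles D (fst S)))"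
proof -
  have "snd S C = 1 \<or> snd S C = -1" if "C \<in> circles D (fst S)" for C
    using assms that by (auto simp: enhanced_states_def PiE_iff)
  then have "{C \<in> circles D (fst S). snd S C = -1} = circles D (fst S) - positive_circles D S"
    by (force simp: positive_circles_def)
  moreover have "positive_circles D S \<subseteq> circles D (fst S)"
    by (auto simp: positive_circles_def)
  ultimately have "int (card {C \<in> circles D (fst S). snd S C = -1})
      = int (card (circles D (fst S))) - int (card (positive_circles D S))"
    using finite_positive_circles finite_circles
    by (simp add: card_Diff_subset card_mono of_nat_diff)
  then show ?thesis
    by (simp add: tau_def positive_circles_def)
qed

lemma conn_strand:
  assumes "v < ncross D" "k < 4"
  shows "conn D s (arc_at D v k) (arc_at D v 1) \<or> conn D s (arc_at D v k) (arc_at D v 3)"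
  using conn_corners[OF assms(1), of s] less_4_cases[OF assms(2)]
  by (cases "s v = 1") (auto intro: conn_sym)

text \<open>A path of \<open>s\<close> that avoids \<open>v\<close> is a path of \<open>s'\<close>.
  Otherwise its outer pieces connect both endpoints to arcs at \<open>v\<close>, and under
  \<open>s'\<close> too each of these lies on the strand of the end 1 or of the end 3.\<close>

lemma conn_off:
  assumes v: "v < ncross D" and off: "\<And>c. c < ncross D \<Longrightarrow> c \<noteq> v \<Longrightarrow> s c = s' c"
    and xy: "conn D s x y"
  defines "T \<equiv> \<lambda>z. conn D s' z (arc_at D v 1) \<or> conn D s' z (arc_at D v 3)"
  shows "conn D s' x y \<or> T x \<and> T y"
proof -
  have T: "T z" if zw: "conn D s' z w" "T w" for z w
    using zw(2) conn_trans[OF zw(1)] unfolding T_def by blast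
  have step: "conn D s' y z \<or> T y \<and> T z" if j: "joined D s y z" for y z
  proof -
    obtain c where c: "c < ncross D" "if s c = 1
     then y = arc_at D c 0 \<and> z = arc_at D c 1 \<or> y = arc_at D c 2 \<and> z = arc_at D c 3
     else y = arc_at D c 1 \<and> z = arc_at D c 2 \<or> y = arc_at D c 3 \<and> z = arc_at D c 0"
      using j unfolding joined_def by (elim exE conjE) (rule that)
    show ?thesis
    proof (cases "c = v")
      case True
      have "\<exists>k < 4. y = arc_at D v k" "\<exists>k < 4. z = arc_at D v k"
        using c(2) True by (auto split: if_splits intro: exI[of _ 0] exI[of _ 1] exI[of _ 2] exI[of _ 3])
      then show ?thesis
        unfolding T_def using conn_strand[OF v] by blast
    next
      case False
      then have "joined D s' y z"
        unfolding joined_def using c off[OF c(1)] by (intro exI[of _ c]) simp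
      then show ?thesis
        by (simp add: conn_joined)
    qed
  qed
  have step': "conn D s' y z \<or> T y \<and> T z" if "joined D s y z \<or> joined D s z y" for y z
    using that step[of y z] step[of z y] conn_sym[of D s' z y] by blast
  from xy show ?thesis
    unfolding conn_def[of D s]
  proof (induction rule: equivclp_induct)
    case (step y z)
    then show ?case
      using step'[OF step.hyps(2)] T[of x y] T[of z y] conn_trans[of D s' x y z] conn_sym[of D s' y z]
      by blast
  qed simp
qed

text \<open>\<open>conn_flip_iff\<close> gives the alternative of merging and splitting;
  \<open>conn_off\<close>, used in both directions, shows that the other circles are the same sets
  of arcs.\<close>

lemma surgery_flip:
  assumes v: "v < ncross D" "s v = 1"
  shows "surgery (arcs D) (circ D s) (circ D (flip v s)) (arc_at D v 1) (arc_at D v 3)"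
proof -
  let ?s = "flip v s" and ?x = "arc_at D v 1" and ?y = "arc_at D v 3"
  have xy: "?x \<in> arcs D" "?y \<in> arcs D"
    using arc_at_in_arcs[OF v(1)] by simp_all
  have off: "s c = ?s c" "?s c = s c" if "c < ncross D" "c \<noteq> v" for c
    using that by (simp_all add: flip_def)
  define T where "T t z \<longleftrightarrow> conn D t z ?x \<or> conn D t z ?y" for t z
  have fwd: "conn D ?s a b \<or> T ?s a \<and> T ?s b" if "conn D s a b" for a b
    unfolding T_def using that by (intro conn_off[OF v(1), of s ?s]) (simp_all add: off(2))
  have bwd: "conn D s a b \<or> T s a \<and> T s b" if "conn D ?s a b" for a b
    unfolding T_def using that by (intro conn_off[OF v(1), of ?s s]) (simp_all add: off(2))
  have Teq: "T s z \<longleftrightarrow> T ?s z" for z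
    using fwd[of z ?x] fwd[of z ?y] bwd[of z ?x] bwd[of z ?y] T_def[of s z] T_def[of ?s z] by blast
  have circT: "circ D t a \<in> {circ D t ?x, circ D t ?y} \<longleftrightarrow> T t a" if "a \<in> arcs D" for t a
    using that xy by (simp add: T_def circ_eq_iff)
  have "conn D s ?x ?y \<longleftrightarrow> \<not> conn D ?s ?x ?y"
    using conn_flip_iff[OF link v(1), of s ?s] v(2) by (simp add: flip_def)
  then have 1: "circ D s ?x = circ D s ?y \<longleftrightarrow> circ D ?s ?x \<noteq> circ D ?s ?y"
    using xy by (simp add: circ_eq_iff)
  have 2: "circ D ?s a = circ D s a" if "\<not> T s a" for a
  proof -
    have "conn D s a b \<longleftrightarrow> conn D ?s a b" for b
      using fwd[of a b] bwd[of a b] that Teq by blast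
    then show ?thesis
      by (simp add: circ_def)
  qed
  show ?thesis
    unfolding surgery_def using xy 1 2 circT Teq by simp
qed

lemma touches_iff:
  assumes "v < ncross D" "C \<in> circles D s"
  shows "touches D v C \<longleftrightarrow> C \<in> {circ D s (arc_at D v 1), circ D s (arc_at D v 3)}"
proof -
  have in_arcs: "arc_at D v k \<in> arcs D" if "k < 4" for k
    by (rule arc_at_in_arcs[OF assms(1) that])
  have "touches D v C \<longleftrightarrow> (\<exists>k < 4. C = circ D s (arc_at D v k))"
    unfolding touches_def using mem_circle_iff[OF assms(2) in_arcs] by blast
  moreover have "circ D s (arc_at D v k) \<in> {circ D s (arc_at D v 1), circ D s (arc_at D v 3)}" if "k < 4" for k
    using conn_strand[OF assms(1) that, of s] in_arcs[OF that] in_arcs[of 1] in_arcs[of 3]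
    by (simp add: circ_eq_iff)
  moreover have "(1 :: nat) < 4" "(3 :: nat) < 4"
    by simp_all
  ultimately show ?thesis
    by blast
qed

lemma agree_off_iff:
  assumes S: "S \<in> enhanced_states D" "S' \<in> enhanced_states D" and v: "v < ncross D" "fst S v = 1"
    and f: "fst S' = flip v (fst S)"
  defines "x \<equiv> arc_at D v 1" and "y \<equiv> arc_at D v 3"
  shows "(\<forall>C \<in> circles D (fst S). \<not> touches D v C \<longrightarrow> snd S C = snd S' C)
    \<longleftrightarrow> positive_circles D S - {circ D (fst S) x, circ D (fst S) y}
      = positive_circles D S' - {circ D (fst S') x, circ D (fst S') y}" (is "?L \<longleftrightarrow> ?P - ?T = ?P' - ?T'")
proof -
  note su = surgery_flip[of v "fst S", OF v, folded f]
  have same: "C \<in> circles D (fst S) \<and> C \<notin> ?T \<longleftrightarrow> C \<in> circles D (fst S') \<and> C \<notin> ?T'" for C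
  proof
    assume C: "C \<in> circles D (fst S) \<and> C \<notin> ?T"
    then obtain a where "a \<in> arcs D" "C = circ D (fst S) a"
      by (auto simp: circles_alt)
    then show "C \<in> circles D (fst S') \<and> C \<notin> ?T'"
      using C surgeryD(4,5)[OF su, of a] unfolding x_def y_def circles_alt by (metis imageI)
  next
    assume C: "C \<in> circles D (fst S') \<and> C \<notin> ?T'"
    then obtain a where "a \<in> arcs D" "C = circ D (fst S') a"
      by (auto simp: circles_alt)
    then show "C \<in> circles D (fst S) \<and> C \<notin> ?T"
      using C surgeryD(4,5)[OF su, of a] unfolding x_def y_def circles_alt by (metis imageI)
  qed
  have vals: "snd S C = 1 \<or> snd S C = -1" "snd S' C = 1 \<or> snd S' C = -1"
    if "C \<in> circles D (fst S) \<and> C \<notin> ?T" for C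
  proof -
    have "C \<in> circles D (fst S)" "C \<in> circles D (fst S')"
      using that same by blast+
    then show "snd S C = 1 \<or> snd S C = -1" "snd S' C = 1 \<or> snd S' C = -1"
      using S by (auto simp: enhanced_states_def PiE_iff)
  qed
  have "?L \<longleftrightarrow> (\<forall>C. C \<in> circles D (fst S) \<and> C \<notin> ?T \<longrightarrow> snd S C = snd S' C)"
    using touches_iff[OF v(1), of _ "fst S"] unfolding x_def y_def by blast
  also have "\<dots> \<longleftrightarrow> (\<forall>C. C \<in> circles D (fst S) \<and> C \<notin> ?T \<longrightarrow> (snd S C = 1 \<longleftrightarrow> snd S' C = 1))"
    using vals by (metis one_neq_neg_one)
  also have "\<dots> \<longleftrightarrow> (\<forall>C. C \<in> ?P - ?T \<longleftrightarrow> C \<in> ?P' - ?T')"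
  proof (rule iff_allI)
    fix C
    have "C \<in> ?P - ?T \<longleftrightarrow> (C \<in> circles D (fst S) \<and> C \<notin> ?T) \<and> snd S C = 1"
      unfolding positive_circles_def by blast
    moreover have "C \<in> ?P' - ?T' \<longleftrightarrow> (C \<in> circles D (fst S) \<and> C \<notin> ?T) \<and> snd S' C = 1"
      unfolding positive_circles_def same by blast
    ultimately show "(C \<in> circles D (fst S) \<and> C \<notin> ?T \<longrightarrow> (snd S C = 1 \<longleftrightarrow> snd S' C = 1))
      \<longleftrightarrow> (C \<in> ?P - ?T \<longleftrightarrow> C \<in> ?P' - ?T')"
      by (simp only:) blast
  qed
  also have "\<dots> \<longleftrightarrow> ?P - ?T = ?P' - ?T'"
    by (rule set_eq_iff[symmetric])
  finally show ?thesis .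
qed

lemma kh_step_iff:
  assumes S: "S \<in> enhanced_states D" "S' \<in> enhanced_states D" and v: "v < ncross D" "fst S v = 1"
    and f: "fst S' = flip v (fst S)"
  shows "kh_step D v S S' \<longleftrightarrow>
    (\<forall>C \<in> circles D (fst S). \<not> touches D v C \<longrightarrow> snd S C = snd S' C) \<and> tau D S' = tau D S + 1"
proof -
  define x y where "x = arc_at D v 1" and "y = arc_at D v 3"
  note su = surgery_flip[of v "fst S", OF v, folded f x_def y_def]
  note fin = finite_positive_circles[of S] finite_positive_circles[of S']
  \<comment> \<open>\<open>tau\<close> is twice the number of positive circles minus the number of
    circles. A merge removes a circle and a split adds one, so raising \<open>tau\<close> by 1 asks
    for 0 or 1 additional positive circles.\<close>
  have "tau D S' = tau D S + 1 \<longleftrightarrow> card (positive_circles D S')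
      = card (positive_circles D S) + (if circ D (fst S') x = circ D (fst S') y then 0 else 1)"
    unfolding tau_positive_circles[OF S(1)] tau_positive_circles[OF S(2)]
    using card_surgery[OF su finite_arcs, folded circles_alt] by (auto split: if_splits)
  then show ?thesis
    unfolding kh_step_def flip_transition_def f[symmetric] x_def[symmetric] y_def[symmetric]
      agree_off_iff[OF S v f, folded x_def y_def] transition_iff_card[OF surgeryD(3)[OF su] fin]
    using v f by simp
qed

lemma kh_step_states_in:
  assumes "S \<in> states_in D i j" "S' \<in> enhanced_states D" "kh_step D v S S'"
  shows "S' \<in> states_in D (i - 2) j"
proof -
  have v: "v < ncross D" "fst S v = 1" "fst S' = flip v (fst S)"
    using assms(3) by (auto simp: kh_step_def)
  show ?thesis
    using assms sigma_flip[of v D S S', OF v] kh_step_iff[of S S', OF _ assms(2) v]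
    by (auto simp: states_in_def)
qed

text \<open>\<open>differ_at\<close> is symmetric in the two states; the degree rules out a change
  from negative to positive, which would raise \<open>sigma\<close> by 2.\<close>

lemma differ_at_flip:
  assumes "S \<in> enhanced_states D" "S' \<in> enhanced_states D" "differ_at D S S' v"
    "sigma D S' = sigma D S - 2"
  shows "fst S v = 1" "fst S' = flip v (fst S)"
proof -
  have k: "fst S \<in> kauffman_states D" "fst S' \<in> kauffman_states D"
    using assms by (auto simp: enhanced_states_def)
  have v: "v < ncross D" "\<And>c. c < ncross D \<Longrightarrow> c \<noteq> v \<Longrightarrow> fst S c = fst S' c" "fst S v \<noteq> fst S' v"
    using assms(3) unfolding differ_at_def by blast+
  have eq: "t = flip v t'" if t: "t \<in> kauffman_states D" "t' \<in> kauffman_states D" "t v = -1"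
    "\<And>c. c < ncross D \<Longrightarrow> c \<noteq> v \<Longrightarrow> t c = t' c" for t t'
  proof (rule PiE_ext)
    show "t \<in> {..<ncross D} \<rightarrow>\<^sub>E {1, -1}" "flip v t' \<in> {..<ncross D} \<rightarrow>\<^sub>E {1, -1}"
      using t(1) flip_kauffman_state[OF t(2) v(1)] by (simp_all add: kauffman_states_def)
    show "t c = flip v t' c" if "c \<in> {..<ncross D}" for c
      using that t(3,4) by (simp add: flip_def)
  qed
  show 1: "fst S v = 1"
  proof (rule ccontr)
    assume "fst S v \<noteq> 1"
    then have m: "fst S v = -1" "fst S' v = 1"
      using kauffman_state_values[OF k(1) v(1)] kauffman_state_values[OF k(2) v(1)] v(3) by auto
    then have "fst S = flip v (fst S')"
      using v(2) by (intro eq[OF k]) auto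
    then have "sigma D S = sigma D S' - 2"
      using sigma_flip[of v D S' S] v(1) m by simp
    then show False
      using assms(4) by simp
  qed
  have "fst S' v = -1"
    using 1 kauffman_state_values[OF k(2) v(1)] v(3) by auto
  then show "fst S' = flip v (fst S)"
    using v(2) by (intro eq[OF k(2,1)]) auto
qed

lemma flip_differ_at:
  assumes "v < ncross D" "fst S v = 1" "fst S' = flip v (fst S)"
  shows "differ_at D S S' w \<longleftrightarrow> w = v"
  using assms by (auto simp: differ_at_def flip_def)

lemma incidence_kh_step:
  assumes S: "S \<in> states_in D i j" "S' \<in> states_in D (i - 2) j"
  shows "incidence D S S' = of_bool (\<exists>v. kh_step D v S S')"
proof -
  have e: "S \<in> enhanced_states D" "S' \<in> enhanced_states D" and
    st: "sigma D S' = sigma D S - 2" "tau D S' = tau D S + 1"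
    using S by (auto simp: states_in_def)
  have "kh_step D v S S' \<longleftrightarrow> differ_at D S S' v
    \<and> (\<forall>C \<in> circles D (fst S). \<not> touches D v C \<longrightarrow> snd S C = snd S' C)" for v
  proof
    assume k: "kh_step D v S S'"
    then have v: "v < ncross D" "fst S v = 1" "fst S' = flip v (fst S)"
      by (auto simp: kh_step_def)
    show "differ_at D S S' v \<and> (\<forall>C \<in> circles D (fst S). \<not> touches D v C \<longrightarrow> snd S C = snd S' C)"
      using k unfolding kh_step_iff[OF e v] flip_differ_at[of v S S', OF v] by blast
  next
    assume d: "differ_at D S S' v \<and> (\<forall>C \<in> circles D (fst S). \<not> touches D v C \<longrightarrow> snd S C = snd S' C)"
    then have dv: "differ_at D S S' v"
      by (rule conjunct1)
    then have "v < ncross D"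
      by (simp add: differ_at_def)
    note v = this differ_at_flip[OF e dv st(1)]
    show "kh_step D v S S'"
      using d st(2) unfolding kh_step_iff[OF e v] by blast
  qed
  then show ?thesis
    by (simp add: incidence_def)
qed

section \<open>Signs, intermediate states and the square of the differential\<close>

definition neg_beyond :: "nat \<Rightarrow> (nat \<Rightarrow> int) \<Rightarrow> nat" where
  "neg_beyond v s = card {c. c < ncross D \<and> v < c \<and> s c = -1}"

lemma neg_after_kh_step: "kh_step D v S S' \<Longrightarrow> neg_after D S S' = neg_beyond v (fst S)"
  using flip_differ_at[of v S S'] by (auto simp: neg_after_def neg_beyond_def kh_step_def)

text \<open>The source of anticommutation: of the two inequalities between distinct crossings
  exactly one holds, so exactly one of the two orders picks up an extra sign.\<close>

lemma neg_beyond_flip: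
  assumes "w < ncross D" "s w = 1"
  shows "neg_beyond v (flip w s) = neg_beyond v s + of_bool (v < w)"
proof (cases "v < w")
  case True
  then have "{c. c < ncross D \<and> v < c \<and> flip w s c = -1} = insert w {c. c < ncross D \<and> v < c \<and> s c = -1}"
    using assms by (auto simp: flip_def)
  then show ?thesis
    using True assms by (simp add: neg_beyond_def)
next
  case False
  then have "{c. c < ncross D \<and> v < c \<and> flip w s c = -1} = {c. c < ncross D \<and> v < c \<and> s c = -1}"
    using assms by (auto simp: flip_def)
  then show ?thesis
    using False by (simp add: neg_beyond_def)
qed

definition intermediate_states ::
    "nat \<Rightarrow> nat \<Rightarrow> 'a enhanced_state \<Rightarrow> 'a enhanced_state \<Rightarrow> 'a enhanced_state set" where
  "intermediate_states v w S S'' = {S' \<in> enhanced_states D. kh_step D v S S' \<and> kh_step D w S' S''}"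

text \<open>The markers of an intermediate state are prescribed, so it is determined by its positive
  circles, and every set of circles is the positive set of some state.\<close>

lemma card_intermediate_states:
  assumes S: "S \<in> enhanced_states D" and vw: "v \<noteq> w" "v < ncross D" "w < ncross D"
    "fst S v = 1" "fst S w = 1" "fst S'' = flip w (flip v (fst S))"
  shows "card (intermediate_states v w S S'') = card (two_step (circ D (fst S)) (circ D (flip v (fst S)))
    (circ D (fst S'')) (arc_at D v 1) (arc_at D v 3) (arc_at D w 1) (arc_at D w 3)
    (positive_circles D S) (positive_circles D S''))" (is "_ = card ?T")
proof (rule bij_betw_same_card, rule bij_betwI')
  let ?f = "positive_circles D"
  fix S1 S2 assume "S1 \<in> intermediate_states v w S S''" "S2 \<in> intermediate_states v w S S''"
  then show "?f S1 = ?f S2 \<longleftrightarrow> S1 = S2"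
    using enhanced_state_eqI[of S1 D S2] by (auto simp: intermediate_states_def kh_step_def)
next
  fix S' assume S': "S' \<in> intermediate_states v w S S''"
  then have "fst S' = flip v (fst S)"
    by (simp add: intermediate_states_def kh_step_def)
  then show "positive_circles D S' \<in> ?T"
    using S' vw(6) by (simp add: intermediate_states_def two_step_def kh_step_def flip_transition_def)
next
  fix Q assume Q: "Q \<in> ?T"
  have k: "flip v (fst S) \<in> kauffman_states D"
    using S by (intro flip_kauffman_state vw) (auto simp: enhanced_states_def)
  have "Q \<subseteq> circles D (flip v (fst S))"
    unfolding circles_alt using Q
    by (intro transition_subset[OF surgery_flip[of v "fst S", OF vw(2,4)] positive_circles_subset]) (simp add: two_step_def)
  then obtain S' where S': "S' \<in> enhanced_states D" "fst S' = flip v (fst S)" "positive_circles D S' = Q"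
    by (rule enhanced_state_exists[OF k])
  have "flip v (fst S) w = 1"
    using vw by (simp add: flip_def)
  then have "S' \<in> intermediate_states v w S S''"
    using Q S' vw
    by (simp add: intermediate_states_def two_step_def kh_step_def flip_transition_def)
  then show "\<exists>S' \<in> intermediate_states v w S S''. Q = positive_circles D S'"
    using S'(3) by blast
qed

lemma card_intermediate_states_commute:
  assumes S: "S \<in> enhanced_states D" and vw: "v \<noteq> w" "v < ncross D" "w < ncross D"
    "fst S v = 1" "fst S w = 1" "fst S'' = flip w (flip v (fst S))"
  shows "card (intermediate_states v w S S'') = card (intermediate_states w v S S'')"
proof -
  have c: "fst S'' = flip v (flip w (fst S))"
    using vw(1,6) by (simp add: flip_def fun_upd_twist)
  have "flip v (fst S) w = 1" "flip w (fst S) v = 1"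
    using vw by (simp_all add: flip_def)
  then show ?thesis
    unfolding card_intermediate_states[OF S vw] card_intermediate_states[OF S vw(1)[symmetric] vw(3,2,5,4) c]
    using surgery_flip[of v "fst S", OF vw(2,4)] surgery_flip[of w "fst S", OF vw(3,5)]
      surgery_flip[OF vw(3), of "flip v (fst S)", folded vw(6)]
      surgery_flip[OF vw(2), of "flip w (fst S)", folded c]
    by (intro card_two_step_commute[OF finite_arcs] positive_circles_subset)
qed

definition kh_coeff :: "'a enhanced_state \<Rightarrow> 'a enhanced_state \<Rightarrow> int" where
  "kh_coeff S S' = (-1) ^ neg_after D S S' * incidence D S S'"

lemma kh_coeff_step:
  assumes "S \<in> states_in D i j" "S' \<in> states_in D (i - 2) j" "kh_step D v S S'"
  shows "kh_coeff S S' = (-1) ^ neg_beyond v (fst S)"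
  using incidence_kh_step[OF assms(1,2)] assms(3) neg_after_kh_step[OF assms(3)]
  by (auto simp: kh_coeff_def)

lemma kh_coeff_nonzero:
  assumes "S \<in> states_in D i j" "S' \<in> states_in D (i - 2) j" "kh_coeff S S' \<noteq> 0"
  obtains v where "kh_step D v S S'"
  using incidence_kh_step[OF assms(1,2)] assms(3) by (auto simp: kh_coeff_def)

text \<open>
  If two states differ at two crossings, then the crossings can be changed in either order.  The
  numbers of intermediate states agree, and the signs are opposite.
\<close>

lemma kh_coeff_square:
  assumes S: "S \<in> states_in D i j" and S'': "S'' \<in> states_in D (i - 2 - 2) j"
  shows "(\<Sum>S' \<in> states_in D (i - 2) j. kh_coeff S S' * kh_coeff S' S'') = 0"
proof (cases "\<exists>S' \<in> states_in D (i - 2) j. kh_coeff S S' * kh_coeff S' S'' \<noteq> 0")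
  case True
  then obtain S0 where S0: "S0 \<in> states_in D (i - 2) j" "kh_coeff S S0 \<noteq> 0" "kh_coeff S0 S'' \<noteq> 0"
    by auto
  obtain v w where v: "kh_step D v S S0" and w: "kh_step D w S0 S''"
    using kh_coeff_nonzero[OF S S0(1,2)] kh_coeff_nonzero[OF S0(1) S'' S0(3)] by metis
  have vw: "v < ncross D" "w < ncross D" "fst S v = 1" "flip v (fst S) w = 1"
    "fst S'' = flip w (flip v (fst S))"
    using v w by (auto simp: kh_step_def)
  then have ne: "v \<noteq> w" and w1: "fst S w = 1"
    by (auto simp: flip_def split: if_splits)
  let ?Z = "intermediate_states v w S S''" and ?Z' = "intermediate_states w v S S''"
  let ?t = "\<lambda>S'. kh_coeff S S' * kh_coeff S' S''"
  define g where "g = neg_beyond v (fst S) + neg_beyond w (fst S)"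
  have e: "S \<in> enhanced_states D"
    using S by (simp add: states_in_def)
  have in_states: "S' \<in> states_in D (i - 2) j"
    if "S' \<in> intermediate_states a b S S''" for S' a b
    using that kh_step_states_in[OF S] unfolding intermediate_states_def by blast
  have summand: "?t S' = (-1) ^ (neg_beyond a (fst S) + neg_beyond b (fst S) + of_bool (b < a))"
    if "S' \<in> intermediate_states a b S S''" for S' a b
  proof -
    have st: "kh_step D a S S'" "kh_step D b S' S''"
      using that by (auto simp: intermediate_states_def)
    then have "neg_beyond b (fst S') = neg_beyond b (fst S) + of_bool (b < a)"
      using neg_beyond_flip[of a "fst S" b] by (auto simp: kh_step_def)
    then show ?thesis
      using kh_coeff_step[OF S in_states[OF that] st(1)] kh_coeff_step[OF in_states[OF that] S'' st(2)]
      by (simp add: power_add)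
  qed
  \<comment> \<open>\<open>S\<close> and \<open>S''\<close> determine the pair of crossings changed
    on the way, so every nonzero term belongs to one of the two orders.\<close>
  have cover: "S' \<in> ?Z \<union> ?Z'" if S': "S' \<in> states_in D (i - 2) j" "?t S' \<noteq> 0" for S'
  proof -
    have "kh_coeff S S' \<noteq> 0" "kh_coeff S' S'' \<noteq> 0"
      using S'(2) by auto
    then obtain a b where ab: "kh_step D a S S'" "kh_step D b S' S''"
      using kh_coeff_nonzero[OF S S'(1)] kh_coeff_nonzero[OF S'(1) S''] by metis
    have f: "flip b (flip a (fst S)) = flip w (flip v (fst S))" and ab': "fst S a = 1" "flip a (fst S) b = 1"
      using ab vw(5) by (auto simp: kh_step_def)
    have "a \<noteq> b" "fst S b = 1"
      using ab'(2) by (auto simp: flip_def split: if_splits)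
    moreover have "flip w (flip v (fst S)) a = -1" "flip w (flip v (fst S)) b = -1"
      unfolding f[symmetric] by (simp_all add: flip_def)
    moreover note ab'(1)
    ultimately have "a = v \<and> b = w \<or> a = w \<and> b = v"
      by (auto simp: flip_def split: if_splits)
    then show ?thesis
      using ab S'(1) by (auto simp: intermediate_states_def states_in_def)
  qed
  have disj: "?Z \<inter> ?Z' = {}"
  proof -
    have "flip v (fst S) v \<noteq> flip w (fst S) v"
      using ne vw(3) by (simp add: flip_def)
    then show ?thesis
      by (auto simp: intermediate_states_def kh_step_def)
  qed
  have fin: "finite ?Z" "finite ?Z'"
    using in_states finite_states_in[of "i - 2" j] by (meson finite_subset subsetI)+
  have "(\<Sum>S' \<in> states_in D (i - 2) j. ?t S') = (\<Sum>S' \<in> ?Z \<union> ?Z'. ?t S')"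
  proof (rule sum.mono_neutral_right[OF finite_states_in])
    show "?Z \<union> ?Z' \<subseteq> states_in D (i - 2) j"
      using in_states by blast
    show "\<forall>S' \<in> states_in D (i - 2) j - (?Z \<union> ?Z'). ?t S' = 0"
      using cover by blast
  qed
  also have "\<dots> = (\<Sum>S' \<in> ?Z. ?t S') + (\<Sum>S' \<in> ?Z'. ?t S')"
    by (rule sum.union_disjoint[OF fin disj])
  also have "\<dots> = int (card ?Z) * (-1) ^ (g + of_bool (w < v)) + int (card ?Z') * (-1) ^ (g + of_bool (v < w))"
    using summand[of _ v w] summand[of _ w v] by (simp add: g_def add.commute)
  also have "\<dots> = 0"
    using ne card_intermediate_states_commute[OF e ne vw(1,2,3) w1 vw(5)] by (cases "v < w") auto
  finally show ?thesis .
qed (simp add: sum.neutral)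

lemma kh_step_pos_states:
  assumes b: "b \<in> arcs D" and S: "S \<in> pos_states D b" "S' \<in> enhanced_states D" "kh_step D v S S'"
  shows "S' \<in> pos_states D b"
proof -
  have iff: "S \<in> pos_states D b \<longleftrightarrow> S \<in> enhanced_states D \<and> circ D (fst S) b \<in> positive_circles D S" for S
  proof -
    have "circ D (fst S) b \<in> circles D (fst S)"
      using b by (simp add: circles_alt)
    then show ?thesis
      using mem_circle_iff[OF _ b, of _ "fst S"] by (auto simp: pos_states_def positive_circles_def)
  qed
  have v: "v < ncross D" "fst S v = 1" "fst S' = flip v (fst S)"
    and t: "flip_transition D v (fst S) (positive_circles D S) (positive_circles D S')"
    using S(3) by (auto simp: kh_step_def)
  have "circ D (flip v (fst S)) b \<in> positive_circles D S'"
    using transition_positive[OF surgery_flip[of v "fst S", OF v(1,2)] b _ t[unfolded flip_transition_def]]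
      S(1) iff by blast
  then show ?thesis
    using iff S(2) v(3) by simp
qed

end

section \<open>Quotient complexes\<close>

lemma quotient_complex_short_exact:
  fixes B :: "'x bigraded"
  assumes B: "chain_complex B d" and N: "\<And>i j. subgroup (N i j) (B i j)"
    and dN: "\<And>i j x. x \<in> N i j \<Longrightarrow> d i j x \<in> N (i - 2) j"
  shows "short_exact_complexes (\<lambda>i j. (B i j)\<lparr>carrier := N i j\<rparr>) d (\<lambda>i j c. c) B d
    (\<lambda>i j c. N i j #>\<^bsub>B i j\<^esub> c) (\<lambda>i j. B i j Mod N i j)
    (\<lambda>i j Z. \<Union>c \<in> Z. N (i - 2) j #>\<^bsub>B (i - 2) j\<^esub> d i j c)"
    (is "short_exact_complexes ?A d ?f B d ?g ?C ?d")
proof -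
  note G = chain_complex_comm_group[OF B] and grp = chain_complex_group[OF B]
  have normal: "N i j \<lhd> B i j" for i j
    by (rule comm_group.subgroup_imp_normal[OF G N])
  have sub: "N i j \<subseteq> carrier (B i j)" for i j
    by (rule subgroup.subset[OF N])
  have d_closed: "d i j x \<in> carrier (B (i - 2) j)" if "x \<in> carrier (B i j)" for i j x
    using chain_complex_hom[OF B, of i j] that by (auto simp: hom_def)
  have d_mult: "d i j (x \<otimes>\<^bsub>B i j\<^esub> y) = d i j x \<otimes>\<^bsub>B (i - 2) j\<^esub> d i j y"
    if "x \<in> carrier (B i j)" "y \<in> carrier (B i j)" for i j x y
    using chain_complex_hom[OF B, of i j] that by (auto simp: hom_def)
  have C_carrier: "carrier (?C i j) = ?g i j ` carrier (B i j)" for i j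
    by (rule carrier_FactGroup)
  have C_mult: "?g i j x \<otimes>\<^bsub>?C i j\<^esub> ?g i j y = ?g i j (x \<otimes>\<^bsub>B i j\<^esub> y)"
    if "x \<in> carrier (B i j)" "y \<in> carrier (B i j)" for i j x y
    using normal.rcos_sum[OF normal that] by simp
  have C_one: "\<one>\<^bsub>?C i j\<^esub> = N i j" for i j
    by simp
  have g_one_iff: "?g i j x = N i j \<longleftrightarrow> x \<in> N i j" if "x \<in> carrier (B i j)" for i j x
  proof -
    interpret comm_group "B i j" by (rule G)
    have "?g i j x = ?g i j \<one>\<^bsub>B i j\<^esub> \<longleftrightarrow> x \<in> N i j"
      using r_coset_eq_iff[OF N that one_closed] that by simp
    then show ?thesis
      using coset_mult_one[OF sub] by simp
  qed
  \<comment> \<open>Elements of a coset differ by \<open>N\<close>, which \<open>d\<close> maps into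
    \<open>N\<close>; so the quotient differential is a union of equal cosets.\<close>
  have dg: "?d i j (?g i j x) = ?g (i - 2) j (d i j x)" if x: "x \<in> carrier (B i j)" for i j x
  proof -
    interpret B': comm_group "B (i - 2) j" by (rule G)
    have same: "?g (i - 2) j (d i j y) = ?g (i - 2) j (d i j x)" if y: "y \<in> ?g i j x" for y
    proof -
      obtain n where n: "n \<in> N i j" "y = n \<otimes>\<^bsub>B i j\<^esub> x"
        using y by (auto simp: r_coset_def)
      have "d i j y = d i j n \<otimes>\<^bsub>B (i - 2) j\<^esub> d i j x"
        using n(2) d_mult[OF subsetD[OF sub n(1)] x] by simp
      moreover have "d i j n \<in> carrier (B (i - 2) j)"
        by (rule subsetD[OF sub dN[OF n(1)]])
      ultimately show ?thesis
        using dN[OF n(1)] d_closed[OF x]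
        by (subst B'.r_coset_eq_iff[OF N]) (simp_all add: B'.m_assoc)
    qed
    have "?g i j x \<noteq> {}"
      using group.rcos_self[OF grp x N] by (intro notI) simp
    then show ?thesis
      by (rule SUP_eq_const) (rule same)
  qed
  have A_complex: "chain_complex ?A d"
    unfolding chain_complex_def
  proof (intro allI conjI ballI)
    fix i j
    interpret comm_group "B i j" by (rule G)
    show "comm_group (?A i j)"
      by (rule group.group_comm_groupI[OF subgroup.subgroup_is_group[OF N is_group]])
        (use subsetD[OF sub] m_comm in simp)
    show "d i j \<in> hom (?A i j) (?A (i - 2) j)"
      by (intro homI) (simp_all add: subsetD[OF sub] dN d_mult)
    show "d (i - 2) j (d i j x) = \<one>\<^bsub>?A (i - 2 - 2) j\<^esub>" if "x \<in> carrier (?A i j)" for x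
      using chain_complex_square[OF B, of x i j] that subsetD[OF sub, of x i j] by simp
  qed
  have g_hom: "?g i j \<in> hom (B i j) (?C i j)" for i j
    using C_carrier C_mult by (intro homI) simp_all
  have C_complex: "chain_complex ?C ?d"
    unfolding chain_complex_def
  proof (intro allI conjI ballI)
    fix i j
    show "comm_group (?C i j)"
      by (rule comm_group.abelian_FactGroup[OF G N])
    show "?d i j \<in> hom (?C i j) (?C (i - 2) j)"
    proof (rule homI)
      fix Y assume "Y \<in> carrier (?C i j)"
      then obtain y where y: "y \<in> carrier (B i j)" "Y = ?g i j y"
        unfolding C_carrier by blast
      then show "?d i j Y \<in> carrier (?C (i - 2) j)"
        unfolding C_carrier using dg d_closed by simp
      fix Z assume "Z \<in> carrier (?C i j)"
      then obtain z where z: "z \<in> carrier (B i j)" "Z = ?g i j z"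
        unfolding C_carrier by blast
      have yz: "y \<otimes>\<^bsub>B i j\<^esub> z \<in> carrier (B i j)"
        using y z grp by (simp add: group.is_monoid monoid.m_closed)
      show "?d i j (Y \<otimes>\<^bsub>?C i j\<^esub> Z) = ?d i j Y \<otimes>\<^bsub>?C (i - 2) j\<^esub> ?d i j Z"
        unfolding y(2) z(2) C_mult[OF y(1) z(1)] dg[OF y(1)] dg[OF z(1)] dg[OF yz] d_mult[OF y(1) z(1)]
          C_mult[OF d_closed[OF y(1)] d_closed[OF z(1)]] ..
    qed
    fix Y assume "Y \<in> carrier (?C i j)"
    then obtain y where y: "y \<in> carrier (B i j)" "Y = ?g i j y"
      unfolding C_carrier by blast
    show "?d (i - 2) j (?d i j Y) = \<one>\<^bsub>?C (i - 2 - 2) j\<^esub>"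
      unfolding y(2) dg[OF y(1)] dg[OF d_closed[OF y(1)]] chain_complex_square[OF B y(1)] C_one
      using g_one_iff[of "\<one>\<^bsub>B (i - 2 - 2) j\<^esub>"] subgroup.one_closed[OF N] sub by blast
  qed
  have "chain_map ?A d B d ?f"
    by (simp add: chain_map_def hom_def Pi_iff subsetD[OF sub])
  moreover have "chain_map B d ?C ?d ?g"
    using g_hom dg by (simp add: chain_map_def)
  moreover have "?f i j \<in> mon (?A i j) (B i j)" for i j
    by (simp add: mon_def hom_def Pi_iff subsetD[OF sub])
  moreover have "?f i j ` carrier (?A i j) = kernel (B i j) (?C i j) (?g i j)" for i j
    using g_one_iff[of _ i j] subsetD[OF sub, of _ i j] by (auto simp: kernel_def)
  moreover have "?g i j \<in> epi (B i j) (?C i j)" for i j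
    using g_hom C_carrier by (simp add: epi_def)
  ultimately show ?thesis
    using A_complex B C_complex by (simp add: short_exact_complexes_def)
qed

section \<open>Chain groups\<close>

text \<open>Membership becomes a condition on supports, because a chain supported in
  \<open>B\<close> is built from the generators by taking differences.\<close>

lemma carrier_subgroup_generated_frag_of:
  assumes "B \<subseteq> T"
  shows "carrier (subgroup_generated (free_Abelian_group T) (frag_of ` B)) = {c. Poly_Mapping.keys c \<subseteq> B}"
    (is "carrier ?G = ?K")
proof (rule subset_antisym)
  have K: "subgroup ?K (free_Abelian_group T)"
  proof
    show "x \<otimes>\<^bsub>free_Abelian_group T\<^esub> y \<in> ?K" if "x \<in> ?K" "y \<in> ?K" for x y
      using that keys_add[of x y] by auto
    show "inv\<^bsub>free_Abelian_group T\<^esub> x \<in> ?K" if "x \<in> ?K" for x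
      using that assms by (simp add: order.trans)
  qed (use assms in auto)
  show "carrier ?G \<subseteq> ?K"
    by (rule group.subgroup_generated_minimal[OF group_free_Abelian_group K]) auto
  have sg: "subgroup (carrier ?G) (free_Abelian_group T)"
    by (rule group.subgroup_subgroup_generated[OF group_free_Abelian_group])
  show "?K \<subseteq> carrier ?G"
  proof
    fix c assume "c \<in> ?K"
    then have "Poly_Mapping.keys c \<subseteq> B"
      by simp
    then show "c \<in> carrier ?G"
    proof (induction c rule: frag_induction)
      case zero
      show ?case
        using subgroup.one_closed[OF sg] by simp
    next
      case (one S)
      show ?case
        using assms one by (intro subsetD[OF group.subgroup_generated_subset_carrier_subset[OF group_free_Abelian_group]]) auto
    next
      case (diff x y)
      have "Poly_Mapping.keys y \<subseteq> T"
        using subgroup.mem_carrier[OF sg diff(2)] by simp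
      then show ?case
        using subgroup.m_closed[OF sg diff(1) subgroup.m_inv_closed[OF sg diff(2)]] by simp
    qed
  qed
qed

lemma frag_cmul_sum_left: "frag_cmul (sum f I) x = (\<Sum>i\<in>I. frag_cmul (f i) x)"
  by (induction I rule: infinite_finite_induct) (simp_all add: frag_cmul_distrib)

lemma keys_sum_subset:
  fixes f :: "'b \<Rightarrow> 'c \<Rightarrow>\<^sub>0 int"
  shows "(\<And>i. i \<in> I \<Longrightarrow> Poly_Mapping.keys (f i) \<subseteq> S) \<Longrightarrow> Poly_Mapping.keys (sum f I) \<subseteq> S"
  using sum_closed_free_Abelian_group[of I f S] by simp

lemma keys_frag_cmul_frag_of: "s \<in> S \<Longrightarrow> Poly_Mapping.keys (frag_cmul k (frag_of s)) \<subseteq> S"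
  using keys_cmul[of k "frag_of s"] by auto

context
  fixes D :: "'a diagram"
  assumes link: "link_diagram D"
begin

lemma kh_diff_frag_of:
  "kh_diff D i j (frag_of S)
    = (\<Sum>S' \<in> states_in D (i - 2) j. frag_cmul (kh_coeff D S S') (frag_of S'))"
  by (simp add: kh_diff_def kh_coeff_def[OF link])

lemma kh_diff_diff: "kh_diff D i j (x - y) = kh_diff D i j x - kh_diff D i j y"
  by (simp add: kh_diff_def frag_extend_diff)

lemma kh_diff_zero: "kh_diff D i j 0 = 0"
  by (simp add: kh_diff_def)

lemma keys_kh_diff: "Poly_Mapping.keys (kh_diff D i j c) \<subseteq> states_in D (i - 2) j"
proof -
  have "Poly_Mapping.keys (kh_diff D i j (frag_of S)) \<subseteq> states_in D (i - 2) j" for S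
    unfolding kh_diff_frag_of by (intro keys_sum_subset keys_frag_cmul_frag_of)
  then show ?thesis
    unfolding kh_diff_def using keys_frag_extend by fastforce
qed

lemma kh_diff_square:
  assumes "Poly_Mapping.keys c \<subseteq> states_in D i j"
  shows "kh_diff D (i - 2) j (kh_diff D i j c) = 0"
  using assms
proof (induction c rule: frag_induction)
  case (one S)
  let ?X = "states_in D (i - 2) j" and ?Y = "states_in D (i - 2 - 2) j"
  have "kh_diff D (i - 2) j (kh_diff D i j (frag_of S))
      = (\<Sum>S' \<in> ?X. frag_cmul (kh_coeff D S S') (kh_diff D (i - 2) j (frag_of S')))"
    unfolding kh_diff_frag_of[of i j S]
    by (simp add: kh_diff_def frag_extend_sum[OF finite_states_in[OF link]] frag_extend_cmul)
  also have "\<dots> = (\<Sum>S' \<in> ?X. \<Sum>S'' \<in> ?Y. frag_cmul (kh_coeff D S S' * kh_coeff D S' S'') (frag_of S''))"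
    by (simp add: kh_diff_frag_of frag_cmul_sum)
  also have "\<dots> = (\<Sum>S'' \<in> ?Y. frag_cmul (\<Sum>S' \<in> ?X. kh_coeff D S S' * kh_coeff D S' S'') (frag_of S''))"
    by (subst sum.swap) (simp add: frag_cmul_sum_left)
  also have "\<dots> = 0"
    using kh_coeff_square[OF link one] by simp
  finally show ?case .
qed (simp_all add: kh_diff_diff kh_diff_zero)

lemma kh_chain_complex: "chain_complex (kh_chains D) (kh_diff D)"
  unfolding chain_complex_def kh_chains_def
proof (intro allI conjI ballI)
  fix i j
  show "comm_group (free_Abelian_group (states_in D i j))"
    by (rule abelian_free_Abelian_group)
  show "kh_diff D i j \<in> hom (free_Abelian_group (states_in D i j)) (free_Abelian_group (states_in D (i - 2) j))"
    using keys_kh_diff by (intro homI) (simp_all, simp add: kh_diff_def frag_extend_add)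
  show "kh_diff D (i - 2) j (kh_diff D i j x) = \<one>\<^bsub>free_Abelian_group (states_in D (i - 2 - 2) j)\<^esub>"
    if "x \<in> carrier (free_Abelian_group (states_in D i j))" for x
    using that kh_diff_square by simp
qed

lemma pos_chains_carrier:
  "carrier (pos_chains D b i j) = {c. Poly_Mapping.keys c \<subseteq> pos_states D b \<inter> states_in D i j}"
  unfolding pos_chains_def kh_chains_def by (intro carrier_subgroup_generated_frag_of) simp

lemma pos_chains_alt:
  "pos_chains D b i j = (kh_chains D i j)\<lparr>carrier := carrier (pos_chains D b i j)\<rparr>"
  by (simp add: pos_chains_def subgroup_generated_def)

lemma pos_chains_subgroup: "subgroup (carrier (pos_chains D b i j)) (kh_chains D i j)"
  unfolding pos_chains_def kh_chains_def
  by (rule group.subgroup_subgroup_generated[OF group_free_Abelian_group])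

lemma kh_diff_pos_chains:
  assumes b: "b \<in> arcs D" and c: "c \<in> carrier (pos_chains D b i j)"
  shows "kh_diff D i j c \<in> carrier (pos_chains D b (i - 2) j)"
proof -
  let ?Q = "pos_states D b \<inter> states_in D (i - 2) j"
  have "Poly_Mapping.keys (kh_diff D i j (frag_of S)) \<subseteq> ?Q" if S: "S \<in> pos_states D b \<inter> states_in D i j" for S
  proof -
    have "Poly_Mapping.keys (frag_cmul (kh_coeff D S S') (frag_of S')) \<subseteq> ?Q"
      if S': "S' \<in> states_in D (i - 2) j" for S'
    proof (cases "kh_coeff D S S' = 0")
      case False
      then obtain v where "kh_step D v S S'"
        using kh_coeff_nonzero[OF link, of S i j S'] S S' by blast
      then have "S' \<in> pos_states D b"
        using S S' by (intro kh_step_pos_states[OF link b, of S S' v]) (simp_all add: states_in_def)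
      then show ?thesis
        using S' by (intro keys_frag_cmul_frag_of) simp
    qed simp
    then show ?thesis
      unfolding kh_diff_frag_of by (rule keys_sum_subset)
  qed
  then show ?thesis
    using c unfolding pos_chains_carrier kh_diff_frag_of unfolding kh_diff_def kh_coeff_def[OF link]
    using keys_frag_extend by fastforce
qed

theorem khovanov_short_exact:
  assumes "b \<in> arcs D"
  shows "short_exact_complexes (pos_chains D b) (kh_diff D) incl (kh_chains D) (kh_diff D) (quot D b)
    (coreduced_chains D b) (coreduced_diff D b)"
proof -
  have 1: "pos_chains D b = (\<lambda>i j. (kh_chains D i j)\<lparr>carrier := carrier (pos_chains D b i j)\<rparr>)"
    by (intro ext) (rule pos_chains_alt)
  have 2: "quot D b = (\<lambda>i j c. carrier (pos_chains D b i j) #>\<^bsub>kh_chains D i j\<^esub> c)"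
    "coreduced_chains D b = (\<lambda>i j. kh_chains D i j Mod carrier (pos_chains D b i j))"
    "incl = (\<lambda>i j (c :: 'a enhanced_state \<Rightarrow>\<^sub>0 int). c)"
    by (intro ext, simp add: quot_def coreduced_chains_def incl_def)+
  have 3: "coreduced_diff D b = (\<lambda>i j Z. \<Union>c \<in> Z. carrier (pos_chains D b (i - 2) j)
      #>\<^bsub>kh_chains D (i - 2) j\<^esub> kh_diff D i j c)"
    by (intro ext) (simp add: coreduced_diff_def quot_def)
  show ?thesis
    unfolding 2 3
    \<comment> \<open>Only the first complex is rewritten: the right-hand side of the equation
      mentions \<open>pos_chains\<close> again, and there it keeps its form as the subgroup
      \<open>N\<close>.\<close>
    by (subst (1) 1) (rule quotient_complex_short_exact[OF kh_chain_complex pos_chains_subgroup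
          kh_diff_pos_chains[OF assms]])
qed

lemma pos_diff_eq: "pos_diff D b i j c = pos_part D b (kh_diff D i j c)"
proof -
  have "Poly_Mapping.keys c \<subseteq> UNIV"
    by simp
  then show ?thesis
    by (induction c rule: frag_induction)
      (simp_all add: pos_diff_def pos_part_def kh_diff_diff kh_diff_zero frag_extend_diff)
qed

lemma pos_part_id:
  assumes "Poly_Mapping.keys c \<subseteq> pos_states D b"
  shows "pos_part D b c = c"
proof -
  have "pos_part D b c = frag_extend frag_of c"
    unfolding pos_part_def using assms by (intro frag_extend_eq) auto
  then show ?thesis
    using frag_expansion[of c] by simp
qed

text \<open>The chain \<open>x\<close> is a lift of its own class. That its image is a cycle means
  that its differential already lies in the positive chains, so it is itself the value of the zigzag
  and \<open>pos_part\<close> leaves it unchanged. For a single enhanced state the differential may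
  have negative components; these have to cancel only in the whole chain.\<close>

lemma connecting_quot:
  assumes b: "b \<in> arcs D" and x: "x \<in> carrier (kh_chains D i j)"
    and z: "quot D b i j x \<in> cycles (coreduced_chains D b) (coreduced_diff D b) i j"
  shows "connecting (pos_chains D b) incl (kh_chains D) (kh_diff D) (quot D b) i j
      (homology_class (coreduced_chains D b) (coreduced_diff D b) i j (quot D b i j x))
    = homology_class (pos_chains D b) (kh_diff D) (i - 2) j (pos_diff D b i j x)"
proof -
  note ses = khovanov_short_exact[OF b]
  have dx: "kh_diff D i j x \<in> carrier (kh_chains D (i - 2) j)"
    by (rule ses_closed(2)[OF ses x])
  have "quot D b (i - 2) j (kh_diff D i j x) = \<one>\<^bsub>coreduced_chains D b (i - 2) j\<^esub>"
    using z chain_map_commute[OF ses_maps(2)[OF ses] x] cycles_iff[OF ses_C[OF ses]] by simp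
  then obtain a where "a \<in> carrier (pos_chains D b (i - 2) j)" "kh_diff D i j x = incl (i - 2) j a"
    by (rule ses_exactE[OF ses dx])
  then have d: "kh_diff D i j x \<in> carrier (pos_chains D b (i - 2) j)"
    by (simp add: incl_def)
  then have "pos_diff D b i j x = kh_diff D i j x"
    by (simp add: pos_diff_eq pos_part_id pos_chains_carrier)
  then show ?thesis
    using connecting_class[OF ses x d] by (simp add: incl_def)
qed

end

theorem theoremX7p4:
  fixes D :: "'a diagram" and b :: 'a
  assumes "link_diagram D" and "b \<in> arcs D"
  shows "short_exact_complexes
           (pos_chains D b) (kh_diff D) incl
           (kh_chains D) (kh_diff D) (quot D b)
           (coreduced_chains D b) (coreduced_diff D b)
       \<and> long_exact_sequence
           (reduced_homology D b) (induced_map (kh_chains D) (kh_diff D) incl)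
           (kh_homology D) (induced_map (coreduced_chains D b) (coreduced_diff D b) (quot D b))
           (coreduced_homology D b)
           (connecting (pos_chains D b) incl (kh_chains D) (kh_diff D) (quot D b))
       \<and> (\<forall>i j. \<forall>x \<in> carrier (neg_chains D b i j).
           quot D b i j x \<in> cycles (coreduced_chains D b) (coreduced_diff D b) i j \<longrightarrow>
           connecting (pos_chains D b) incl (kh_chains D) (kh_diff D) (quot D b) i j
             (homology_class (coreduced_chains D b) (coreduced_diff D b) i j (quot D b i j x))
           = homology_class (pos_chains D b) (kh_diff D) (i - 2) j (pos_diff D b i j x))"
proof (intro conjI allI ballI impI)
  note ses = khovanov_short_exact[OF assms]
  show "short_exact_complexes (pos_chains D b) (kh_diff D) incl (kh_chains D) (kh_diff D) (quot D b)
      (coreduced_chains D b) (coreduced_diff D b)"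
    by (rule ses)
  show "long_exact_sequence
      (reduced_homology D b) (induced_map (kh_chains D) (kh_diff D) incl)
      (kh_homology D) (induced_map (coreduced_chains D b) (coreduced_diff D b) (quot D b))
      (coreduced_homology D b) (connecting (pos_chains D b) incl (kh_chains D) (kh_diff D) (quot D b))"
    by (rule short_exact_imp_long_exact[OF ses])
  fix i j x
  assume x: "x \<in> carrier (neg_chains D b i j)"
    and z: "quot D b i j x \<in> cycles (coreduced_chains D b) (coreduced_diff D b) i j"
  have "x \<in> carrier (kh_chains D i j)"
    using x group.carrier_subgroup_generated_subset[OF group_free_Abelian_group]
    unfolding neg_chains_def kh_chains_def by blast
  then show "connecting (pos_chains D b) incl (kh_chains D) (kh_diff D) (quot D b) i j
      (homology_class (coreduced_chains D b) (coreduced_diff D b) i j (quot D b i j x))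
    = homology_class (pos_chains D b) (kh_diff D) (i - 2) j (pos_diff D b i j x)"
    by (rule connecting_quot[OF assms _ z])
qed

end
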